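(* Suppose that $(W_N)_N$ is a non-decreasing sequence converging to $w_0\in(0,\infty]$ as $N\to\infty$. Suppose that for a given probability measure $\mu_0$ on $\mathbb{R}_+$ it holds that $$\langle x,\mu_0^N\rangle\le\langle x,\mu_0\rangle<\infty\quad\text{for all }N,$$ and that $\mu_0^N\Rightarrow\mu_0$ weakly as $N\to\infty$. Then the sequence of random measure-valued processes $(\mu_t^N)_{t\ge 0}$ converges in probability in $D([0,\infty);\mathcal{M}_1(\mathbb{R}_+))$ as $N\to\infty$. The limit $(\mu_t)_{t\ge 0}$ is continuous in $t$ and satisfies the kinetic equation $$\mu_t=\mu_0+\int_0^t Q(\mu_s)\,ds,\qquad t\ge 0.$$ In particular, for all $g\in C_b(\mathbb{R}_+)$ and any time $t\ge 0$ the following limits hold in probability as $N\to\infty$: (A) $\sup_{s\le t}\langle g,\mu_s^N-\mu_s\rangle\to 0$; (B) $\sup_{0\le s\le t}|M_s^{g,N}|\to 0$; (C) $\int_0^t\langle g,Q^{(N)}(\mu_s^N)\rangle\,ds\to\int_0^t\langle g,Q(\mu_s)\rangle\,ds$. As a consequence, the kinetic equation $\langle g,\mu_t\rangle=\langle g,\mu_0\rangle+\int_0^t\langle g,Q(\mu_s)\rangle\,ds$ is obtained as the limit in probability, as $N\to\infty$, of the identity $M_t^{g,N}=\langle g,\mu_t^N\rangle-\langle g,\mu_0^N\rangle-\int_0^t\langle g,Q^{(N)}(\mu_s^N)\rangle\,ds$.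
   Context: $\mathcal{M}_1(\mathbb{R}_+)$ is the space of probability measures on $\mathbb{R}_+=[0,\infty)$ with the weak topology, $D([0,\infty);\mathcal{M}_1(\mathbb{R}_+))$ is the Skorokhod space of càdlàg paths, $C_b(\mathbb{R}_+)$ is the set of bounded continuous real functions on $\mathbb{R}_+$, and $\langle g,\mu\rangle=\int_{\mathbb{R}_+}g(x)\,\mu(dx)$ (also written for $g(x)=x$). Particle system: for each number of agents $N\ge 2$ and total wealth $W_N\ge 0$, $\mathbf{X}^N_t=(X^{1,N}_t,\dots,X^{N,N}_t)$ is the continuous-time Markov jump process on $\{(x_1,\dots,x_N): x_i\ge 0,\ \sum_i x_i=W_N\}$ in which each ordered pair $(i,j)$ with $i\ne j$ interacts at rate $1/N$. At an interaction, a fresh independent $r$ uniform on $[0,1]$ is drawn and $(X^{i,N},X^{j,N})$ is replaced by $(r(X^{i,N}+X^{j,N}),(1-r)(X^{i,N}+X^{j,N}))$. The empirical measure is $\mu_t^N=\frac1N\sum_{i=1}^N\delta_{X_t^{i,N}}$, so that $\langle x,\mu_t^N\rangle=W_N/N$. Its generator is $$\mathcal{G}F(\mu^N)=\int_0^1\int_{\mathbb{R}_+}\int_{\mathbb{R}_+}\{F(\mu^{(x,y,r),N})-F(\mu^N)\}\mathbf{1}_{\{x+y\le W_N\}}N\mu^{(2,N)}(dx,dy)\,dr,$$ where $\mu^{(x,y,r),N}=\mu^N+\frac1N(\delta_{r(x+y)}+\delta_{(1-r)(x+y)}-\delta_x-\delta_y)$ and $\mu^{(2,N)}(A\times B)=\mu^N(A)\mu^N(B)-\frac1N\mu^N(A\cap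 B)$ for Borel sets $A,B$. Operators: for $g\in C_b(\mathbb{R}_+)$, $$\langle g,Q^{(N)}(\mu^N)\rangle=\int_0^1\int_{\mathbb{R}_+}\int_{\mathbb{R}_+}\big(g(r(x+y))+g((1-r)(x+y))-g(x)-g(y)\big)\mathbf{1}_{\{x+y\le W_N\}}\mu^{(2,N)}(dx,dy)\,dr,$$ $$\langle g,Q(\mu)\rangle=\int_0^1\int_{\mathbb{R}_+}\int_{\mathbb{R}_+}\big(g(r(x+y))+g((1-r)(x+y))-g(x)-g(y)\big)\mathbf{1}_{\{x+y\le w_0\}}\mu(dx)\mu(dy)\,dr,$$ with $w_0=\lim_N W_N$ (the indicator is $1$ if $w_0=\infty$). The kinetic equation is understood weakly, i.e. tested against every $g\in C_b(\mathbb{R}_+)$. Finally $M_t^{g,N}=\langle g,\mu_t^N\rangle-\langle g,\mu_0^N\rangle-\int_0^t\langle g,Q^{(N)}(\mu_s^N)\rangle\,ds$, which is a martingale. *)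

theory Defs
  imports "HOL-Probability.Probability"
begin

section \<open>Probability measures on the half-line\<close>

definition Rplus :: "real measure" where
  "Rplus = restrict_space borel {0..}"

definition M1 :: "real measure set" where
  "M1 = {\<mu>. prob_space \<mu> \<and> sets \<mu> = sets Rplus}"

definition Cb :: "(real \<Rightarrow> real) set" where
  "Cb = {g. continuous_on {0..} g \<and> bounded (g ` {0..})}"

definition weak_topology :: "real measure topology" where
  "weak_topology =
     topology_generated_by {{\<mu> \<in> M1. (\<integral>x. g x \<partial>\<mu>) \<in> U} | g U. g \<in> Cb \<and> open U}"

definition thickening :: "real \<Rightarrow> real set \<Rightarrow> real set" where
  "thickening \<epsilon> A = {x \<in> {0..}. \<exists>a\<in>A. dist x a < \<epsilon>}"

text \<open>The Prokhorov metric, which metrizes the weak topology on M1 and is bounded by 1.\<close>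

definition prokhorov :: "real measure \<Rightarrow> real measure \<Rightarrow> real" where
  "prokhorov \<mu> \<nu> = Inf {\<epsilon>. 0 < \<epsilon> \<and>
     (\<forall>A \<in> sets Rplus. measure \<mu> A \<le> measure \<nu> (thickening \<epsilon> A) + \<epsilon> \<and>
                       measure \<nu> A \<le> measure \<mu> (thickening \<epsilon> A) + \<epsilon>)}"


section \<open>The Skorokhod space of cadlag paths in M1\<close>

text \<open>Paths are functions on the real line of which only the values at times \<open>t \<ge> 0\<close> matter.\<close>

definition cadlag_paths :: "(real \<Rightarrow> real measure) set" where
  "cadlag_paths = {x. \<forall>t\<ge>0. x t \<in> M1
      \<and> limitin weak_topology x (x t) (at_right t)
      \<and> (0 < t \<longrightarrow> (\<exists>l. limitin weak_topology x l (at_left t)))}"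

definition time_changes :: "(real \<Rightarrow> real) set" where
  "time_changes = {l. strict_mono_on {0..} l \<and> bij_betw l {0..} {0..}}"

definition log_slope :: "(real \<Rightarrow> real) \<Rightarrow> ennreal" where
  "log_slope l = (SUP (s, t) \<in> {(s, t). 0 \<le> t \<and> t < s}. ennreal \<bar>ln ((l s - l t) / (s - t))\<bar>)"

text \<open>The metric of Ethier and Kurtz (Markov Processes, Section 3.5) for the Skorokhod (J1)
  topology. Their truncation of the metric of the state space at 1 is not needed, the Prokhorov
  metric being bounded by 1. Time changes with infinite log-slope do not contribute to the
  infimum.\<close>

definition skorokhod_dist :: "(real \<Rightarrow> real measure) \<Rightarrow> (real \<Rightarrow> real measure) \<Rightarrow> ennreal" where
  "skorokhod_dist x y =
     (INF l \<in> time_changes. max (log_slope l)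
        (\<integral>\<^sup>+u\<in>{0..}. ennreal (exp (- u)) *
           (SUP t \<in> {0..}. ennreal (prokhorov (x (min t u)) (y (min (l t) u)))) \<partial>lborel))"

definition skorokhod_open :: "(real \<Rightarrow> real measure) set \<Rightarrow> bool" where
  "skorokhod_open U \<longleftrightarrow> U \<subseteq> cadlag_paths \<and>
     (\<forall>x\<in>U. \<exists>\<epsilon>>0. \<forall>y\<in>cadlag_paths. skorokhod_dist x y < ennreal \<epsilon> \<longrightarrow> y \<in> U)"

definition skorokhod_topology :: "(real \<Rightarrow> real measure) topology" where
  "skorokhod_topology = topology skorokhod_open"

lemma istopology_skorokhod_open: "istopology skorokhod_open"
  unfolding istopology_def
proof (intro conjI allI impI)
  fix S T assume S: "skorokhod_open S" and T: "skorokhod_open T"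
  show "skorokhod_open (S \<inter> T)"
    unfolding skorokhod_open_def
  proof (intro conjI ballI)
    show "S \<inter> T \<subseteq> cadlag_paths"
      using S by (auto simp: skorokhod_open_def)
    fix x assume x: "x \<in> S \<inter> T"
    from S x have "\<exists>a>0. \<forall>y\<in>cadlag_paths. skorokhod_dist x y < ennreal a \<longrightarrow> y \<in> S"
      unfolding skorokhod_open_def by blast
    then obtain a where a: "0 < a" "\<forall>y\<in>cadlag_paths. skorokhod_dist x y < ennreal a \<longrightarrow> y \<in> S"
      by blast
    from T x have "\<exists>b>0. \<forall>y\<in>cadlag_paths. skorokhod_dist x y < ennreal b \<longrightarrow> y \<in> T"
      unfolding skorokhod_open_def by blast
    then obtain b where b: "0 < b" "\<forall>y\<in>cadlag_paths. skorokhod_dist x y < ennreal b \<longrightarrow> y \<in> T"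
      by blast
    have "ennreal (min a b) \<le> ennreal a" "ennreal (min a b) \<le> ennreal b"
      by (simp_all add: ennreal_leI)
    then have "\<forall>y\<in>cadlag_paths. skorokhod_dist x y < ennreal (min a b) \<longrightarrow> y \<in> S \<inter> T"
      using a(2) b(2) by (blast dest: less_le_trans)
    with a(1) b(1) show "\<exists>\<epsilon>>0. \<forall>y\<in>cadlag_paths. skorokhod_dist x y < ennreal \<epsilon> \<longrightarrow> y \<in> S \<inter> T"
      by (intro exI[of _ "min a b"]) auto
  qed
next
  fix K assume K: "\<forall>S\<in>K. skorokhod_open S"
  show "skorokhod_open (\<Union>K)"
    unfolding skorokhod_open_def
  proof (intro conjI ballI)
    show "\<Union>K \<subseteq> cadlag_paths"
      using K by (auto simp: skorokhod_open_def)
    fix x assume "x \<in> \<Union>K"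
    then obtain S where S: "S \<in> K" "x \<in> S" by blast
    then obtain a where "0 < a" "\<forall>y\<in>cadlag_paths. skorokhod_dist x y < ennreal a \<longrightarrow> y \<in> S"
      using K unfolding skorokhod_open_def by blast
    with S show "\<exists>\<epsilon>>0. \<forall>y\<in>cadlag_paths. skorokhod_dist x y < ennreal \<epsilon> \<longrightarrow> y \<in> \<Union>K"
      by blast
  qed
qed

lemma openin_skorokhod_topology: "openin skorokhod_topology U \<longleftrightarrow> skorokhod_open U"
  unfolding skorokhod_topology_def
  by (simp only: topology_inverse'[OF istopology_skorokhod_open])


section \<open>Convergence in probability to a deterministic limit\<close>

text \<open>The \<open>n\<close>-th random element \<open>Z n\<close> may live on its own probability space \<open>P n\<close>. For a
  metrizable topology \<open>T\<close>, the condition below says that the distance of \<open>Z n\<close> to \<open>c\<close> tends to 0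
  in probability. The outer measure agrees with the measure on events; it prevents a
  non-measurable set from counting as a null set.\<close>

definition tendsto_in_prob ::
  "(nat \<Rightarrow> 'w measure) \<Rightarrow> 'b topology \<Rightarrow> (nat \<Rightarrow> 'w \<Rightarrow> 'b) \<Rightarrow> 'b \<Rightarrow> bool" where
  "tendsto_in_prob P T Z c \<longleftrightarrow> c \<in> topspace T \<and>
     (\<forall>U. openin T U \<and> c \<in> U \<longrightarrow>
        (\<lambda>n. outer_measure_of (P n) {\<omega> \<in> space (P n). Z n \<omega> \<notin> U}) \<longlonglongrightarrow> 0)"


section \<open>Markov jump processes\<close>

text \<open>\<open>q x A\<close> is the rate of jumps from the state \<open>x\<close> into the set \<open>A\<close>; the total rate
  \<open>q x (space S)\<close> must be positive for every state \<open>x\<close>. Given the past up to the \<open>n\<close>-th jump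
  time \<open>T n\<close>, the holding time in the state \<open>Y n\<close> is exponential with the total rate and,
  independently, the next state has the law given by the normalised rates. A jump may lead
  back to the same state.\<close>

definition markov_jump_process ::
  "'w measure \<Rightarrow> 's measure \<Rightarrow> ('s \<Rightarrow> 's set \<Rightarrow> real) \<Rightarrow> (real \<Rightarrow> 'w \<Rightarrow> 's) \<Rightarrow> bool" where
  "markov_jump_process P S q X \<longleftrightarrow> prob_space P \<and>
     (\<exists>(T :: nat \<Rightarrow> 'w \<Rightarrow> real) (Y :: nat \<Rightarrow> 'w \<Rightarrow> 's).
        (\<forall>n. T n \<in> borel_measurable P \<and> Y n \<in> measurable P S) \<and>
        (\<forall>\<omega>\<in>space P. T 0 \<omega> = 0 \<and> (\<forall>n. T n \<omega> < T (Suc n) \<omega>)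
           \<and> filterlim (\<lambda>n. T n \<omega>) at_top sequentially) \<and>
        (\<forall>\<omega>\<in>space P. \<forall>t n. T n \<omega> \<le> t \<and> t < T (Suc n) \<omega> \<longrightarrow> X t \<omega> = Y n \<omega>) \<and>
        (\<forall>n. \<forall>C \<in> sets (\<Pi>\<^sub>M k\<in>{..n}. borel \<Otimes>\<^sub>M S). \<forall>u\<ge>0. \<forall>A \<in> sets S.
           measure P {\<omega> \<in> space P. (\<lambda>k\<in>{..n}. (T k \<omega>, Y k \<omega>)) \<in> C
                        \<and> u < T (Suc n) \<omega> - T n \<omega> \<and> Y (Suc n) \<omega> \<in> A}
           = (\<integral>\<omega>\<in>{\<omega> \<in> space P. (\<lambda>k\<in>{..n}. (T k \<omega>, Y k \<omega>)) \<in> C}.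
                exp (- q (Y n \<omega>) (space S) * u) * (q (Y n \<omega>) A / q (Y n \<omega>) (space S)) \<partial>P)))"


section \<open>The particle system\<close>

text \<open>Agents are numbered \<open>0, \<dots>, N - 1\<close>; \<open>w\<close> is the total wealth.\<close>

definition wealth_space :: "nat \<Rightarrow> real \<Rightarrow> (nat \<Rightarrow> real) measure" where
  "wealth_space N w = restrict_space (\<Pi>\<^sub>M i\<in>{..<N}. borel)
     {x. (\<forall>i<N. 0 \<le> x i) \<and> (\<Sum>i<N. x i) = w}"

definition exchange :: "nat \<Rightarrow> nat \<Rightarrow> real \<Rightarrow> (nat \<Rightarrow> real) \<Rightarrow> nat \<Rightarrow> real" where
  "exchange i j r x = x(i := r * (x i + x j), j := (1 - r) * (x i + x j))"

text \<open>Every ordered pair of distinct agents interacts at rate \<open>1 / N\<close>, with \<open>r\<close> uniform on the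
  unit interval.\<close>

definition exchange_rate :: "nat \<Rightarrow> (nat \<Rightarrow> real) \<Rightarrow> (nat \<Rightarrow> real) set \<Rightarrow> real" where
  "exchange_rate N x A =
     (\<Sum>(i, j) \<in> {(i, j). i < N \<and> j < N \<and> i \<noteq> j}.
        1 / real N * measure lborel {r \<in> {0..1}. exchange i j r x \<in> A})"

definition particle_system ::
  "nat \<Rightarrow> real \<Rightarrow> 'w measure \<Rightarrow> (real \<Rightarrow> 'w \<Rightarrow> nat \<Rightarrow> real) \<Rightarrow> bool" where
  "particle_system N w P X \<longleftrightarrow> markov_jump_process P (wealth_space N w) (exchange_rate N) X"

text \<open>The push-forward of the uniform distribution on the agents, i.e. the average of the Dirac
  measures at the \<open>x i\<close>.\<close>

definition empirical :: "nat \<Rightarrow> (nat \<Rightarrow> real) \<Rightarrow> real measure" where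
  "empirical N x = distr (uniform_count_measure {..<N}) Rplus x"


section \<open>Interaction operators and the kinetic equation\<close>

definition exchange_gain :: "(real \<Rightarrow> real) \<Rightarrow> real \<Rightarrow> real \<Rightarrow> real \<Rightarrow> real" where
  "exchange_gain g r x y = g (r * (x + y)) + g ((1 - r) * (x + y)) - g x - g y"

text \<open>The integral against the signed measure that takes the value
  \<open>\<mu>(A) \<mu>(B) - \<mu>(A \<inter> B) / N\<close> on rectangles: the product measure minus \<open>1 / N\<close> times the
  push-forward of \<open>\<mu>\<close> to the diagonal.\<close>

definition pair_integral :: "nat \<Rightarrow> real measure \<Rightarrow> (real \<Rightarrow> real \<Rightarrow> real) \<Rightarrow> real" where
  "pair_integral N \<mu> F = (\<integral>y. (\<integral>x. F x y \<partial>\<mu>) \<partial>\<mu>) - 1 / real N * (\<integral>x. F x x \<partial>\<mu>)"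

lemma pair_integral_rectangle:
  assumes \<mu>: "\<mu> \<in> M1" and A: "A \<in> sets Rplus" and B: "B \<in> sets Rplus"
  shows "pair_integral N \<mu> (\<lambda>x y. indicator (A \<times> B) (x, y))
         = measure \<mu> A * measure \<mu> B - 1 / real N * measure \<mu> (A \<inter> B)"
proof -
  interpret prob_space \<mu> using \<mu> by (simp add: M1_def)
  have \<mu>_sets [simp]: "A \<in> sets \<mu>" "B \<in> sets \<mu>" using \<mu> A B by (simp_all add: M1_def)
  have ind: "indicator (A \<times> B) (x, y) = indicator A x * (indicator B y :: real)"
    "indicator (A \<times> B) (x, x) = (indicator (A \<inter> B) x :: real)" for x y
    by (auto simp: indicator_def)
  have "(\<integral>x. indicator (A \<times> B) (x, y) \<partial>\<mu>) = measure \<mu> A * (indicator B y :: real)" for y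
    unfolding ind(1) by (subst integral_mult_left_zero) simp
  moreover have "A \<inter> B \<inter> space \<mu> = A \<inter> B"
    using sets.sets_into_space[OF \<mu>_sets(1)] by blast
  ultimately show ?thesis
    unfolding pair_integral_def ind(2) by simp
qed

definition QN :: "nat \<Rightarrow> real \<Rightarrow> real measure \<Rightarrow> (real \<Rightarrow> real) \<Rightarrow> real" where
  "QN N w \<mu> g = (LBINT r:{0..1}.
     pair_integral N \<mu> (\<lambda>x y. exchange_gain g r x y * (if x + y \<le> w then 1 else 0)))"

definition Q :: "ereal \<Rightarrow> real measure \<Rightarrow> (real \<Rightarrow> real) \<Rightarrow> real" where
  "Q w0 \<mu> g = (LBINT r:{0..1}.
     (\<integral>y. (\<integral>x. exchange_gain g r x y * (if ereal (x + y) \<le> w0 then 1 else 0) \<partial>\<mu>) \<partial>\<mu>))"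

text \<open>Integrability is part of the definition because the integral of a non-integrable function
  is 0 by convention.\<close>

definition kinetic_solution :: "ereal \<Rightarrow> real measure \<Rightarrow> (real \<Rightarrow> real measure) \<Rightarrow> bool" where
  "kinetic_solution w0 \<mu>0 \<nu> \<longleftrightarrow> (\<forall>g\<in>Cb. \<forall>t\<ge>0.
     set_integrable lborel {0..t} (\<lambda>s. Q w0 (\<nu> s) g) \<and>
     (\<integral>x. g x \<partial>\<nu> t) = (\<integral>x. g x \<partial>\<mu>0) + (LBINT s:{0..t}. Q w0 (\<nu> s) g))"

text \<open>\<open>m\<close> is a path of the empirical measure.\<close>

definition Mg :: "nat \<Rightarrow> real \<Rightarrow> (real \<Rightarrow> real) \<Rightarrow> (real \<Rightarrow> real measure) \<Rightarrow> real \<Rightarrow> real" where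
  "Mg N w g m t =
     (\<integral>x. g x \<partial>m t) - (\<integral>x. g x \<partial>m 0) - (LBINT s:{0..t}. QN N w (m s) g)"

end

theory Submission
  imports Defs
begin

text \<open>
  The proof compares the Laplace transforms of the empirical measures with those of an explicit
  solution of the kinetic equation, along the jump chain of the particle system.

  First, the total wealth has to diverge. If \<open>W N\<close> stayed bounded, the mean \<open>W N / N\<close> of the
  empirical measure would tend to 0 and the initial law would be the point mass at 0; its mean
  bounds \<open>W N / N\<close>, so that all \<open>W N\<close> would vanish, against \<open>w0 > 0\<close>
  (\<open>vanishing_wealth_density\<close>). So \<open>w0 = \<infinity>\<close>, and
  \<open>\<langle>g, Q(\<mu>)\<rangle> = 2 \<langle>g, collide \<mu> \<mu>\<rangle> - 2 \<langle>g, \<mu>\<rangle>\<close>, where \<open>collide \<mu> \<nu>\<close> is the law of \<open>r (x + y)\<close> for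
  independent \<open>r\<close>, \<open>x\<close>, \<open>y\<close>. Wild's sum solves this equation: \<open>flow \<mu>0 t\<close> is a geometric mixture of
  laws \<open>wild \<mu>0 n\<close> that are built from \<open>\<mu>0\<close> by \<open>n\<close> collisions, and the kinetic equation is the
  differentiation of a power series in \<open>1 - exp (- 2 t)\<close> (\<open>has_derivative_flow\<close>).

  On exponentials the equation closes: with \<open>\<phi>(l) = \<langle>exp (- l x), \<mu>\<rangle>\<close> the drift is
  \<open>2 \<integral> \<phi>(r l)\<^sup>2 dr - 2 \<phi>(l)\<close>, which involves only the values of \<open>\<phi>\<close> on \<open>[0, l]\<close>. The total jump
  rate is \<open>N - 1\<close> in every state. Hence one step of the jump chain moves the Laplace transform
  of the empirical measure by \<open>h = 1 / (N - 1)\<close> times the drift on average, and by at most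
  \<open>2 / N\<close> in any case, so that the largest mean square error \<open>e\<^sub>n\<close> for \<open>l \<le> L\<close> obeys
  \<open>e\<^sub>n\<^sub>+\<^sub>1 \<le> (1 + 8 h) e\<^sub>n + 140 h\<^sup>2\<close> (\<open>mean_square_error\<close>). The law of two consecutive states
  is all that this recursion uses. The jump times are sums of independent exponential times of
  mean \<open>h\<close> (\<open>jump_time_variance\<close>). Chebyshev's inequality on a grid whose size does not depend
  on \<open>N\<close>, together with the small steps of the chain and the monotonicity of the jump times,
  gives closeness that is uniform in time with high probability (\<open>good_event\<close>, \<open>close_to_flow\<close>).

  Closeness of Laplace transforms is closeness of integrals of every \<open>g \<in> Cb\<close>: by Weierstrass,
  \<open>g\<close> is a polynomial in \<open>exp (- x)\<close> up to a small error and a tail, and the tail is controlled by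
  the mean (\<open>laplace_close_integral\<close>). Finitely many hat functions turn this into closeness in
  the Prokhorov metric, hence in the Skorokhod space. Applied to \<open>collide \<mu> \<mu>\<close>, it also gives the
  convergence of the drifts, and then that of \<open>Mg\<close>, since \<open>Mg\<close> is what the kinetic equation
  leaves when the limit is replaced by the empirical measure.
\<close>

section \<open>Bounded test functions on the half-line\<close>

text \<open>Bounded Borel functions instead of \<open>Cb\<close>: the transforms of a test function that occur below
  (such as \<open>share_test\<close>) are bounded and Borel by Fubini's theorem.\<close>

definition bounded_test :: "real \<Rightarrow> (real \<Rightarrow> real) \<Rightarrow> bool" where
  "bounded_test B g \<longleftrightarrow> g \<in> borel_measurable Rplus \<and> (\<forall>x\<ge>0. \<bar>g x\<bar> \<le> B)"

lemma space_Rplus [simp]: "space Rplus = {0..}"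
  by (simp add: Rplus_def space_restrict_space)

lemma M1_D:
  assumes "\<mu> \<in> M1"
  shows "prob_space \<mu>" "sets \<mu> = sets Rplus" "space \<mu> = {0..}"
  using assms by (auto simp: M1_def dest: sets_eq_imp_space_eq)

lemma measurable_into_Rplus:
  "f \<in> borel_measurable M \<Longrightarrow> (\<And>x. x \<in> space M \<Longrightarrow> 0 \<le> f x) \<Longrightarrow> f \<in> measurable M Rplus"
  unfolding Rplus_def by (rule measurable_restrict_space2) auto

lemma measurable_from_Rplus: "f \<in> borel_measurable borel \<Longrightarrow> f \<in> borel_measurable Rplus"
  unfolding Rplus_def by (rule measurable_restrict_space1)

lemma bounded_test_nonneg: "bounded_test B g \<Longrightarrow> 0 \<le> B"
  by (force simp: bounded_test_def)

lemma bounded_test_Cb: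
  assumes "g \<in> Cb" obtains B where "bounded_test B g"
proof -
  have "g \<in> borel_measurable Rplus"
    using assms unfolding Cb_def Rplus_def
    by (intro borel_measurable_continuous_on_restrict) auto
  moreover obtain B where "\<And>x. x \<ge> 0 \<Longrightarrow> \<bar>g x\<bar> \<le> B"
    using assms unfolding Cb_def bounded_iff by (auto simp: bounded_iff)
  ultimately show ?thesis using that by (auto simp: bounded_test_def)
qed

lemma bounded_test_integrable:
  assumes \<mu>: "\<mu> \<in> M1" and g: "bounded_test B g"
  shows "integrable \<mu> g" and "\<bar>\<integral>x. g x \<partial>\<mu>\<bar> \<le> B"
proof -
  interpret prob_space \<mu> using M1_D[OF \<mu>] by simp
  note [measurable_cong] = M1_D(2)[OF \<mu>]
  have [measurable]: "g \<in> borel_measurable \<mu>"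
    using g by (simp add: bounded_test_def measurable_cong_sets[OF M1_D(2)[OF \<mu>] refl])
  have b: "AE x in \<mu>. \<bar>g x\<bar> \<le> B"
    using g by (intro AE_I2) (simp add: M1_D[OF \<mu>] bounded_test_def)
  show i: "integrable \<mu> g" by (rule integrable_const_bound[of _ B]) (use b in auto)
  have "\<bar>\<integral>x. g x \<partial>\<mu>\<bar> \<le> (\<integral>x. \<bar>g x\<bar> \<partial>\<mu>)" by (rule integral_abs_bound)
  also have "\<dots> \<le> (\<integral>x. B \<partial>\<mu>)" using b i by (intro integral_mono_AE) auto
  also have "\<dots> = B" by (simp add: prob_space)
  finally show "\<bar>\<integral>x. g x \<partial>\<mu>\<bar> \<le> B" .
qed

lemma exp_Cb: "0 \<le> l \<Longrightarrow> (\<lambda>x. exp (- l * x)) \<in> Cb"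
  unfolding Cb_def by (auto intro!: continuous_intros boundedI[of _ 1])

lemma bounded_test_exp: "0 \<le> l \<Longrightarrow> bounded_test 1 (\<lambda>x. exp (- l * x))"
  unfolding bounded_test_def by (auto intro!: measurable_from_Rplus)

section \<open>The law of a share of the pooled wealth\<close>

definition unit_law :: "real measure" where
  "unit_law = restrict_space lborel {0..1}"

lemma space_unit_law [simp]: "space unit_law = {0..1}"
  by (simp add: unit_law_def space_restrict_space)

lemma prob_space_unit_law: "prob_space unit_law"
  by (rule prob_spaceI) (simp add: unit_law_def emeasure_restrict_space space_restrict_space)

lemma measurable_unit_law: "f \<in> borel_measurable borel \<Longrightarrow> f \<in> borel_measurable unit_law"
  unfolding unit_law_def by (rule measurable_restrict_space1) simp

lemma id_unit_law [measurable]: "(\<lambda>x. x) \<in> borel_measurable unit_law"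
  by (rule measurable_unit_law) simp

lemma id_Rplus [measurable]: "(\<lambda>x. x) \<in> borel_measurable Rplus"
  by (rule measurable_from_Rplus) simp

lemma integral_unit_law: "(\<integral>r. f r \<partial>unit_law) = (LBINT r:{0..1}. f r :: real)"
  unfolding unit_law_def set_lebesgue_integral_def by (rule integral_restrict_space) simp

lemma integrable_unit_law: "integrable unit_law f \<longleftrightarrow> set_integrable lborel {0..1} (f :: real \<Rightarrow> real)"
  unfolding unit_law_def set_integrable_def by (rule integrable_restrict_space) simp

lemma unit_law_reflect: "(\<integral>r. f (1 - r) \<partial>unit_law) = (\<integral>r. (f r :: real) \<partial>unit_law)"
  unfolding integral_unit_law set_lebesgue_integral_def
  by (subst (2) lborel_integral_real_affine[where c = "-1" and t = 1])
     (auto intro!: Bochner_Integration.integral_cong split: split_indicator)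

text \<open>The gain part of the collision operator, normalised to a probability measure:
  \<open>Q(\<mu>) = 2 (collide \<mu> \<mu> - \<mu>)\<close>.\<close>

definition collide :: "real measure \<Rightarrow> real measure \<Rightarrow> real measure" where
  "collide \<mu> \<nu> = distr (unit_law \<Otimes>\<^sub>M (\<mu> \<Otimes>\<^sub>M \<nu>)) Rplus (\<lambda>(r, x, y). r * (x + y))"

context
  fixes \<mu> \<nu> :: "real measure"
  assumes \<mu>: "\<mu> \<in> M1" and \<nu>: "\<nu> \<in> M1"
begin

lemma share_measurable:
  "(\<lambda>(r, x, y). r * (x + y)) \<in> measurable (unit_law \<Otimes>\<^sub>M (\<mu> \<Otimes>\<^sub>M \<nu>)) Rplus"
proof (rule measurable_into_Rplus)
  note [measurable_cong] = M1_D(2)[OF \<mu>] M1_D(2)[OF \<nu>]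
  show "(\<lambda>(r, x, y). r * (x + y)) \<in> borel_measurable (unit_law \<Otimes>\<^sub>M (\<mu> \<Otimes>\<^sub>M \<nu>))"
    by measurable
qed (auto simp: space_pair_measure M1_D[OF \<mu>] M1_D[OF \<nu>])

lemma collide_M1: "collide \<mu> \<nu> \<in> M1"
proof -
  interpret U: prob_space unit_law by (rule prob_space_unit_law)
  interpret A: prob_space \<mu> using M1_D[OF \<mu>] by simp
  interpret B: prob_space \<nu> using M1_D[OF \<nu>] by simp
  interpret AB: pair_prob_space \<mu> \<nu> ..
  interpret UAB: pair_prob_space unit_law "\<mu> \<Otimes>\<^sub>M \<nu>" ..
  show ?thesis unfolding collide_def M1_def
    using UAB.prob_space_distr[OF share_measurable] by simp
qed

lemma share_integrable:
  assumes g: "bounded_test B g"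
  shows "integrable (unit_law \<Otimes>\<^sub>M (\<mu> \<Otimes>\<^sub>M \<nu>)) (\<lambda>(r, x, y). g (r * (x + y)))"
proof -
  interpret C: prob_space "collide \<mu> \<nu>" using M1_D[OF collide_M1] by simp
  have "integrable (collide \<mu> \<nu>) g"
    by (rule bounded_test_integrable(1)[OF collide_M1 g])
  from integrable_distr[OF share_measurable this[unfolded collide_def]]
  show ?thesis by (simp add: case_prod_beta')
qed

lemma integral_collide_product:
  assumes g: "bounded_test B g"
  shows "(\<integral>z. g z \<partial>collide \<mu> \<nu>) = (\<integral>(r, x, y). g (r * (x + y)) \<partial>(unit_law \<Otimes>\<^sub>M (\<mu> \<Otimes>\<^sub>M \<nu>)))"
  unfolding collide_def
  by (subst integral_distr[OF share_measurable]) (use g in \<open>auto simp: bounded_test_def case_prod_beta'\<close>)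

lemma
  assumes g: "bounded_test B g"
  shows integral_collide: "(\<integral>z. g z \<partial>collide \<mu> \<nu>) = (\<integral>r. \<integral>y. \<integral>x. g (r * (x + y)) \<partial>\<mu> \<partial>\<nu> \<partial>unit_law)"
    and integrable_collide: "integrable unit_law (\<lambda>r. \<integral>y. \<integral>x. g (r * (x + y)) \<partial>\<mu> \<partial>\<nu>)"
    and integral_collide_outer:
      "(\<integral>z. g z \<partial>collide \<mu> \<nu>) = (\<integral>x. \<integral>y. \<integral>r. g (r * (x + y)) \<partial>unit_law \<partial>\<nu> \<partial>\<mu>)"
    and integral_collide_outer':
      "(\<integral>z. g z \<partial>collide \<mu> \<nu>) = (\<integral>y. \<integral>x. \<integral>r. g (r * (x + y)) \<partial>unit_law \<partial>\<mu> \<partial>\<nu>)"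
proof -
  interpret U: prob_space unit_law by (rule prob_space_unit_law)
  interpret A: prob_space \<mu> using M1_D[OF \<mu>] by simp
  interpret B: prob_space \<nu> using M1_D[OF \<nu>] by simp
  interpret AB: pair_prob_space \<mu> \<nu> ..
  interpret UAB: pair_prob_space unit_law "\<mu> \<Otimes>\<^sub>M \<nu>" ..
  note [measurable_cong] = M1_D(2)[OF \<mu>] M1_D(2)[OF \<nu>]
  define G where "G = (\<lambda>r p. g (r * (fst p + snd p)))"
  have int: "integrable (unit_law \<Otimes>\<^sub>M (\<mu> \<Otimes>\<^sub>M \<nu>)) (case_prod G)"
    using share_integrable[OF g] by (simp add: G_def case_prod_beta')
  have eq: "(\<integral>z. g z \<partial>collide \<mu> \<nu>) = integral\<^sup>L (unit_law \<Otimes>\<^sub>M (\<mu> \<Otimes>\<^sub>M \<nu>)) (case_prod G)"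
    using integral_collide_product[OF g] by (simp add: G_def case_prod_beta')
  have gm: "g \<in> borel_measurable Rplus" using g by (simp add: bounded_test_def)
  have inner: "(\<integral>p. G r p \<partial>(\<mu> \<Otimes>\<^sub>M \<nu>)) = (\<integral>y. \<integral>x. g (r * (x + y)) \<partial>\<mu> \<partial>\<nu>)" if r: "r \<in> {0..1}" for r
  proof -
    have m: "(\<lambda>p. r * (fst p + snd p)) \<in> measurable (\<mu> \<Otimes>\<^sub>M \<nu>) Rplus"
      by (rule measurable_into_Rplus)
        (use r in \<open>auto simp: space_pair_measure M1_D[OF \<mu>] M1_D[OF \<nu>]\<close>)
    have "integrable (\<mu> \<Otimes>\<^sub>M \<nu>) (case_prod (\<lambda>x y. g (r * (x + y))))"
      by (rule AB.integrable_const_bound[of _ B])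
        (use measurable_compose[OF m gm] g r in
          \<open>auto simp: case_prod_beta' space_pair_measure M1_D[OF \<mu>] M1_D[OF \<nu>] bounded_test_def\<close>)
    from AB.integral_snd[OF this] show ?thesis by (simp add: G_def case_prod_beta')
  qed
  have "(\<integral>z. g z \<partial>collide \<mu> \<nu>) = (\<integral>r. \<integral>p. G r p \<partial>(\<mu> \<Otimes>\<^sub>M \<nu>) \<partial>unit_law)"
    unfolding eq by (rule UAB.integral_fst[OF int, symmetric])
  also have "\<dots> = (\<integral>r. \<integral>y. \<integral>x. g (r * (x + y)) \<partial>\<mu> \<partial>\<nu> \<partial>unit_law)"
    by (rule Bochner_Integration.integral_cong) (use inner in auto)
  finally show "(\<integral>z. g z \<partial>collide \<mu> \<nu>) = (\<integral>r. \<integral>y. \<integral>x. g (r * (x + y)) \<partial>\<mu> \<partial>\<nu> \<partial>unit_law)" .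
  have "integrable unit_law (\<lambda>r. \<integral>p. G r p \<partial>(\<mu> \<Otimes>\<^sub>M \<nu>))" by (rule UAB.integrable_fst[OF int])
  then show "integrable unit_law (\<lambda>r. \<integral>y. \<integral>x. g (r * (x + y)) \<partial>\<mu> \<partial>\<nu>)"
    by (rule Bochner_Integration.integrable_cong[THEN iffD1, rotated 2]) (use inner in auto)
  have snd: "(\<integral>z. g z \<partial>collide \<mu> \<nu>) = (\<integral>p. \<integral>r. G r p \<partial>unit_law \<partial>(\<mu> \<Otimes>\<^sub>M \<nu>))"
    unfolding eq by (rule UAB.integral_snd[OF int, symmetric])
  have int2: "integrable (\<mu> \<Otimes>\<^sub>M \<nu>) (case_prod (\<lambda>x y. \<integral>r. g (r * (x + y)) \<partial>unit_law))"
    using UAB.integrable_snd[OF int] by (simp add: G_def case_prod_beta')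
  show "(\<integral>z. g z \<partial>collide \<mu> \<nu>) = (\<integral>x. \<integral>y. \<integral>r. g (r * (x + y)) \<partial>unit_law \<partial>\<nu> \<partial>\<mu>)"
    unfolding snd using AB.integral_fst[OF int2] by (simp add: G_def case_prod_beta')
  show "(\<integral>z. g z \<partial>collide \<mu> \<nu>) = (\<integral>y. \<integral>x. \<integral>r. g (r * (x + y)) \<partial>unit_law \<partial>\<mu> \<partial>\<nu>)"
    unfolding snd using AB.integral_snd[OF int2] by (simp add: G_def case_prod_beta')
qed

text \<open>On average an agent receives half of the pooled wealth; this is the conservation of the mean.\<close>

lemma nn_integral_collide:
  "(\<integral>\<^sup>+z. ennreal z \<partial>collide \<mu> \<nu>) = ennreal (1 / 2) * ((\<integral>\<^sup>+x. ennreal x \<partial>\<mu>) + (\<integral>\<^sup>+x. ennreal x \<partial>\<nu>))"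
proof -
  interpret U: prob_space unit_law by (rule prob_space_unit_law)
  interpret A: prob_space \<mu> using M1_D[OF \<mu>] by simp
  interpret B: prob_space \<nu> using M1_D[OF \<nu>] by simp
  interpret AB: pair_prob_space \<mu> \<nu> ..
  interpret UAB: pair_prob_space unit_law "\<mu> \<Otimes>\<^sub>M \<nu>" ..
  note [measurable_cong] = M1_D(2)[OF \<mu>] M1_D(2)[OF \<nu>]
  have "(\<integral>\<^sup>+z. ennreal z \<partial>collide \<mu> \<nu>)
      = (\<integral>\<^sup>+p. ennreal (fst p) * (ennreal (fst (snd p)) + ennreal (snd (snd p))) \<partial>(unit_law \<Otimes>\<^sub>M (\<mu> \<Otimes>\<^sub>M \<nu>)))"
    unfolding collide_def
    by (subst nn_integral_distr[OF share_measurable])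
      (auto intro!: nn_integral_cong measurable_compose[OF id_Rplus]
        simp: case_prod_beta' space_pair_measure M1_D[OF \<mu>] M1_D[OF \<nu>] ennreal_mult ennreal_plus)
  also have "\<dots> = (\<integral>\<^sup>+r. \<integral>\<^sup>+p. ennreal r * (ennreal (fst p) + ennreal (snd p)) \<partial>(\<mu> \<Otimes>\<^sub>M \<nu>) \<partial>unit_law)"
    by (subst AB.nn_integral_fst[symmetric]) auto
  also have "\<dots> = (\<integral>\<^sup>+r. ennreal r \<partial>unit_law) * (\<integral>\<^sup>+p. (ennreal (fst p) + ennreal (snd p)) \<partial>(\<mu> \<Otimes>\<^sub>M \<nu>))"
    by (simp add: nn_integral_cmult nn_integral_multc)
  also have "(\<integral>\<^sup>+p. (ennreal (fst p) + ennreal (snd p)) \<partial>(\<mu> \<Otimes>\<^sub>M \<nu>))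
     = (\<integral>\<^sup>+x. ennreal x \<partial>\<mu>) + (\<integral>\<^sup>+x. ennreal x \<partial>\<nu>)"
    by (subst B.nn_integral_fst[symmetric]) (auto simp: nn_integral_add A.emeasure_space_1 B.emeasure_space_1)
  also have "(\<integral>\<^sup>+r. ennreal r \<partial>unit_law) = ennreal (1/2)"
  proof -
    have "(\<integral>\<^sup>+r. ennreal r \<partial>unit_law) = (\<integral>\<^sup>+r. ennreal r * indicator {0..1} r \<partial>lborel)"
      unfolding unit_law_def by (simp add: nn_integral_restrict_space)
    also have "\<dots> = ennreal (1\<^sup>2 / 2 - 0\<^sup>2 / 2)"
      by (rule nn_integral_FTC_Icc[where F = "\<lambda>x. x\<^sup>2 / 2"])
        (auto intro!: derivative_eq_intros)
    finally show ?thesis by simp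
  qed
  finally show ?thesis .
qed

end

lemma nn_integral_collide_le:
  assumes "\<mu> \<in> M1" "\<nu> \<in> M1" "(\<integral>\<^sup>+x. ennreal x \<partial>\<mu>) \<le> ennreal m" "(\<integral>\<^sup>+x. ennreal x \<partial>\<nu>) \<le> ennreal m" "0 \<le> m"
  shows "(\<integral>\<^sup>+x. ennreal x \<partial>collide \<mu> \<nu>) \<le> ennreal m"
proof -
  have "(\<integral>\<^sup>+x. ennreal x \<partial>collide \<mu> \<nu>) \<le> ennreal (1 / 2) * (ennreal m + ennreal m)"
    unfolding nn_integral_collide[OF assms(1,2)] by (intro mult_left_mono add_mono assms) auto
  also have "ennreal m + ennreal m = ennreal (m + m)" using assms(5) by (rule ennreal_plus[symmetric, OF _ assms(5)])
  also have "ennreal (1 / 2) * \<dots> = ennreal (1 / 2 * (m + m))"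
    using assms(5) by (intro ennreal_mult[symmetric]) auto
  finally show ?thesis by simp
qed

text \<open>For a fixed law \<open>\<nu>\<close> of the partner, \<open>g\<close> evaluated at the share becomes a test function of the
  wealth of the agent. This makes the linearity of \<open>collide\<close> in each of its arguments usable.\<close>

definition share_test :: "(real \<Rightarrow> real) \<Rightarrow> real measure \<Rightarrow> real \<Rightarrow> real" where
  "share_test g \<nu> x = (\<integral>y. \<integral>r. g (r * (x + y)) \<partial>unit_law \<partial>\<nu>)"

lemma bounded_test_share:
  assumes \<nu>: "\<nu> \<in> M1" and g: "bounded_test B g"
  shows "bounded_test B (share_test g \<nu>)"
proof -
  interpret U: prob_space unit_law by (rule prob_space_unit_law)
  interpret N: prob_space \<nu> using M1_D[OF \<nu>] by simp
  note [measurable_cong] = M1_D(2)[OF \<nu>]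
  have gm: "g \<in> borel_measurable Rplus" using g by (simp add: bounded_test_def)
  have m: "(\<lambda>p. snd p * (fst (fst p) + snd (fst p))) \<in> measurable ((Rplus \<Otimes>\<^sub>M \<nu>) \<Otimes>\<^sub>M unit_law) Rplus"
    by (rule measurable_into_Rplus) (auto simp: space_pair_measure M1_D[OF \<nu>])
  have "(\<lambda>p. g (snd p * (fst (fst p) + snd (fst p)))) \<in> borel_measurable ((Rplus \<Otimes>\<^sub>M \<nu>) \<Otimes>\<^sub>M unit_law)"
    by (rule measurable_compose[OF m gm])
  then have "(\<lambda>p. \<integral>r. g (r * (fst p + snd p)) \<partial>unit_law) \<in> borel_measurable (Rplus \<Otimes>\<^sub>M \<nu>)"
    by (intro U.borel_measurable_lebesgue_integral) (simp add: case_prod_beta')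
  then have "share_test g \<nu> \<in> borel_measurable Rplus"
    unfolding share_test_def[abs_def]
    by (intro N.borel_measurable_lebesgue_integral) (simp add: case_prod_beta')
  moreover have "\<bar>share_test g \<nu> x\<bar> \<le> B" if x: "0 \<le> x" for x
  proof -
    have in1: "\<bar>\<integral>r. g (r * (x + y)) \<partial>unit_law\<bar> \<le> B" if y: "0 \<le> y" for y
    proof -
      have "\<bar>\<integral>r. g (r * (x + y)) \<partial>unit_law\<bar> \<le> (\<integral>r. \<bar>g (r * (x + y))\<bar> \<partial>unit_law)"
        by (rule integral_abs_bound)
      also have "\<dots> \<le> (\<integral>r. B \<partial>unit_law)"
        using x y g bounded_test_nonneg[OF g]
        by (intro integral_mono') (auto simp: bounded_test_def)
      finally show ?thesis by (simp add: U.prob_space[simplified])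
    qed
    have "\<bar>share_test g \<nu> x\<bar> \<le> (\<integral>y. \<bar>\<integral>r. g (r * (x + y)) \<partial>unit_law\<bar> \<partial>\<nu>)"
      unfolding share_test_def by (rule integral_abs_bound)
    also have "\<dots> \<le> (\<integral>y. B \<partial>\<nu>)"
      using in1 bounded_test_nonneg[OF g] by (intro integral_mono') (auto simp: M1_D[OF \<nu>])
    finally show ?thesis by (simp add: N.prob_space)
  qed
  ultimately show ?thesis by (simp add: bounded_test_def)
qed

lemma integral_collide_left:
  "\<mu> \<in> M1 \<Longrightarrow> \<nu> \<in> M1 \<Longrightarrow> bounded_test B g \<Longrightarrow>
   (\<integral>z. g z \<partial>collide \<mu> \<nu>) = (\<integral>x. share_test g \<nu> x \<partial>\<mu>)"
  unfolding share_test_def by (rule integral_collide_outer)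

lemma integral_collide_right:
  "\<mu> \<in> M1 \<Longrightarrow> \<nu> \<in> M1 \<Longrightarrow> bounded_test B g \<Longrightarrow>
   (\<integral>z. g z \<partial>collide \<mu> \<nu>) = (\<integral>y. share_test g \<mu> y \<partial>\<nu>)"
  unfolding share_test_def using integral_collide_outer'[of \<mu> \<nu> B g]
  by (simp add: add.commute)

text \<open>Both agents receive the same law, because \<open>r\<close> and \<open>1 - r\<close> are equally distributed.\<close>

lemma Q_infinity:
  assumes \<mu>: "\<mu> \<in> M1" and g: "bounded_test B g"
  shows "Q \<infinity> \<mu> g = 2 * (\<integral>z. g z \<partial>collide \<mu> \<mu>) - 2 * (\<integral>x. g x \<partial>\<mu>)"
proof -
  interpret U: prob_space unit_law by (rule prob_space_unit_law)
  interpret A: prob_space \<mu> using M1_D[OF \<mu>] by simp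
  interpret AB: pair_prob_space \<mu> \<mu> ..
  note [measurable_cong] = M1_D(2)[OF \<mu>]
  have gm: "g \<in> borel_measurable Rplus" using g by (simp add: bounded_test_def)
  define J where "J r = (\<integral>y. \<integral>x. g (r * (x + y)) \<partial>\<mu> \<partial>\<mu>)" for r
  define c where "c = (\<integral>x. g x \<partial>\<mu>)"
  have gi: "integrable \<mu> g" by (rule bounded_test_integrable(1)[OF \<mu> g])
  have bt: "bounded_test B (\<lambda>x. g (r * (x + y)))" if "r \<in> {0..1}" "0 \<le> y" for r y
    unfolding bounded_test_def
    using that g by (auto simp: bounded_test_def intro!: measurable_compose[OF _ gm] measurable_into_Rplus)
  have bt2: "bounded_test B (\<lambda>y. \<integral>x. g (r * (x + y)) \<partial>\<mu>)" if r: "r \<in> {0..1}" for r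
  proof -
    have m: "(\<lambda>p. r * (snd p + fst p)) \<in> measurable (Rplus \<Otimes>\<^sub>M \<mu>) Rplus"
      by (rule measurable_into_Rplus) (use r in \<open>auto simp: space_pair_measure M1_D[OF \<mu>]\<close>)
    have "(\<lambda>y. \<integral>x. g (r * (x + y)) \<partial>\<mu>) \<in> borel_measurable Rplus"
      using measurable_compose[OF m gm]
      by (intro A.borel_measurable_lebesgue_integral) (simp add: case_prod_beta')
    with bounded_test_integrable(2)[OF \<mu> bt[OF r]] show ?thesis
      by (auto simp: bounded_test_def)
  qed
  have inner: "(\<integral>y. \<integral>x. exchange_gain g r x y * (if ereal (x + y) \<le> \<infinity> then 1 else 0) \<partial>\<mu> \<partial>\<mu>)
      = J r + J (1 - r) - 2 * c" if r: "r \<in> {0..1}" for r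
  proof -
    have r': "1 - r \<in> {0..1}" using r by auto
    have "(\<integral>x. exchange_gain g r x y * (if ereal (x + y) \<le> \<infinity> then 1 else 0) \<partial>\<mu>)
       = (\<integral>x. g (r * (x + y)) \<partial>\<mu>) + (\<integral>x. g ((1 - r) * (x + y)) \<partial>\<mu>) - c - g y" if y: "0 \<le> y" for y
      unfolding exchange_gain_def c_def
      using bounded_test_integrable(1)[OF \<mu> bt[OF r y]] bounded_test_integrable(1)[OF \<mu> bt[OF r' y]] gi
      by (simp add: A.prob_space)
    then have "(\<integral>y. \<integral>x. exchange_gain g r x y * (if ereal (x + y) \<le> \<infinity> then 1 else 0) \<partial>\<mu> \<partial>\<mu>)
       = (\<integral>y. (\<integral>x. g (r * (x + y)) \<partial>\<mu>) + (\<integral>x. g ((1 - r) * (x + y)) \<partial>\<mu>) - c - g y \<partial>\<mu>)"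
      by (intro Bochner_Integration.integral_cong) (auto simp: M1_D[OF \<mu>])
    also have "\<dots> = J r + J (1 - r) - 2 * c"
      unfolding J_def
      using bounded_test_integrable(1)[OF \<mu> bt2[OF r]] bounded_test_integrable(1)[OF \<mu> bt2[OF r']] gi
      by (simp add: A.prob_space c_def[symmetric])
    finally show ?thesis .
  qed
  have Ji: "integrable unit_law J" unfolding J_def by (rule integrable_collide[OF \<mu> \<mu> g])
  have Ji': "integrable unit_law (\<lambda>r. J (1 - r))"
  proof -
    have "integrable lborel (\<lambda>r. indicator {0..1} r *\<^sub>R J r)"
      using Ji unfolding integrable_unit_law set_integrable_def .
    from lborel_integrable_real_affine[OF this, of "-1" 1]
    show ?thesis unfolding integrable_unit_law set_integrable_def
      by (rule Bochner_Integration.integrable_cong[THEN iffD1, rotated 2]) (auto split: split_indicator)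
  qed
  have "Q \<infinity> \<mu> g = (\<integral>r. J r + J (1 - r) - 2 * c \<partial>unit_law)"
    unfolding Q_def integral_unit_law[symmetric]
    by (rule Bochner_Integration.integral_cong) (use inner in auto)
  also have "\<dots> = (\<integral>r. J r \<partial>unit_law) + (\<integral>r. J (1 - r) \<partial>unit_law) - 2 * c"
    using Ji Ji' by (simp add: U.prob_space[simplified])
  also have "\<dots> = 2 * (\<integral>r. J r \<partial>unit_law) - 2 * c"
    by (simp add: unit_law_reflect)
  also have "(\<integral>r. J r \<partial>unit_law) = (\<integral>z. g z \<partial>collide \<mu> \<mu>)"
    unfolding J_def by (rule integral_collide[OF \<mu> \<mu> g, symmetric])
  finally show ?thesis by (simp add: c_def)
qed

section \<open>Wild's sum\<close>

definition mixture :: "nat pmf \<Rightarrow> (nat \<Rightarrow> real measure) \<Rightarrow> real measure" where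
  "mixture p \<nu> = measure_pmf p \<bind> \<nu>"

lemma
  assumes \<nu>: "\<And>n. \<nu> n \<in> M1"
  shows mixture_M1: "mixture p \<nu> \<in> M1"
    and integral_mixture: "\<And>B g. bounded_test B g \<Longrightarrow>
      (\<integral>x. g x \<partial>mixture p \<nu>) = (\<integral>n. (\<integral>x. g x \<partial>\<nu> n) \<partial>measure_pmf p)"
    and nn_integral_mixture:
      "(\<integral>\<^sup>+x. ennreal x \<partial>mixture p \<nu>) = (\<integral>\<^sup>+n. (\<integral>\<^sup>+x. ennreal x \<partial>\<nu> n) \<partial>measure_pmf p)"
proof -
  have m: "\<nu> \<in> measurable (measure_pmf p) (subprob_algebra Rplus)"
    using \<nu> by (auto simp: space_subprob_algebra M1_def intro: prob_space_imp_subprob_space)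
  have sets: "sets (mixture p \<nu>) = sets Rplus"
    unfolding mixture_def using \<nu> by (intro sets_bind) (auto simp: M1_def)
  have "prob_space (mixture p \<nu>)"
    unfolding mixture_def
    by (rule measure_pmf.prob_space_bind[OF _ m]) (use \<nu> in \<open>auto simp: M1_def\<close>)
  with sets show "mixture p \<nu> \<in> M1" by (simp add: M1_def)
  show "(\<integral>x. g x \<partial>mixture p \<nu>) = (\<integral>n. (\<integral>x. g x \<partial>\<nu> n) \<partial>measure_pmf p)"
    if g: "bounded_test B g" for B g
    unfolding mixture_def
    by (rule integral_bind[where K = Rplus and B = B and B' = 1])
      (use g m \<nu> in \<open>auto simp: bounded_test_def measure_pmf.finite_measure_axioms M1_def prob_space.emeasure_space_1\<close>)
  show "(\<integral>\<^sup>+x. ennreal x \<partial>mixture p \<nu>) = (\<integral>\<^sup>+n. (\<integral>\<^sup>+x. ennreal x \<partial>\<nu> n) \<partial>measure_pmf p)"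
    unfolding mixture_def
    by (rule nn_integral_bind[OF _ m]) measurable
qed

text \<open>\<open>wild \<mu> n\<close> is the law of an agent with \<open>n\<close> collisions in its genealogy: the last collision joins
  genealogies with \<open>k\<close> and \<open>n - k\<close> collisions, all splittings being equally likely. The guard
  \<open>k \<le> n\<close> makes the recursion visibly well-founded; it holds on the support of the mixture.\<close>

fun wild :: "real measure \<Rightarrow> nat \<Rightarrow> real measure" where
  "wild \<mu> 0 = \<mu>"
| "wild \<mu> (Suc n) = mixture (pmf_of_set {..n})
     (\<lambda>k. if k \<le> n then collide (wild \<mu> k) (wild \<mu> (n - k)) else \<mu>)"

lemma wild_M1: "\<mu> \<in> M1 \<Longrightarrow> wild \<mu> n \<in> M1"
proof (induction n rule: less_induct)
  case (less n)
  then show ?case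
    by (cases n) (auto intro!: mixture_M1 collide_M1 simp: less_Suc_eq_le)
qed

lemma integral_wild_Suc:
  assumes \<mu>: "\<mu> \<in> M1" and g: "bounded_test B g"
  shows "real (Suc n) * (\<integral>x. g x \<partial>wild \<mu> (Suc n))
       = (\<Sum>k\<le>n. \<integral>x. g x \<partial>collide (wild \<mu> k) (wild \<mu> (n - k)))"
proof -
  have "(\<integral>x. g x \<partial>wild \<mu> (Suc n)) = (\<integral>k. (\<integral>x. g x \<partial>(if k \<le> n then collide (wild \<mu> k) (wild \<mu> (n - k)) else \<mu>)) \<partial>measure_pmf (pmf_of_set {..n}))"
    unfolding wild.simps
    by (rule integral_mixture[OF _ g]) (auto intro: collide_M1 wild_M1 \<mu>)
  also have "\<dots> = (\<Sum>k\<le>n. (\<integral>x. g x \<partial>(if k \<le> n then collide (wild \<mu> k) (wild \<mu> (n - k)) else \<mu>))) / real (card {..n})"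
    by (subst integral_pmf_of_set) auto
  also have "\<dots> = (\<Sum>k\<le>n. \<integral>x. g x \<partial>collide (wild \<mu> k) (wild \<mu> (n - k))) / real (Suc n)"
    by (intro arg_cong2[of _ _ _ _ "(/)"] sum.cong) auto
  finally show ?thesis by (simp add: field_simps del: of_nat_Suc wild.simps)
qed

lemma nn_integral_wild:
  assumes \<mu>: "\<mu> \<in> M1" and m: "(\<integral>\<^sup>+x. ennreal x \<partial>\<mu>) \<le> ennreal m" "0 \<le> m"
  shows "(\<integral>\<^sup>+x. ennreal x \<partial>wild \<mu> n) \<le> ennreal m"
proof (induction n rule: less_induct)
  case (less n)
  show ?case
  proof (cases n)
    case (Suc n')
    let ?\<nu> = "\<lambda>k. if k \<le> n' then collide (wild \<mu> k) (wild \<mu> (n' - k)) else \<mu>"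
    have "(\<integral>\<^sup>+x. ennreal x \<partial>wild \<mu> n) = (\<integral>\<^sup>+k. (\<integral>\<^sup>+x. ennreal x \<partial>?\<nu> k) \<partial>measure_pmf (pmf_of_set {..n'}))"
      unfolding Suc wild.simps
      by (rule nn_integral_mixture) (auto intro: collide_M1 wild_M1 \<mu>)
    also have "\<dots> \<le> (\<integral>\<^sup>+k. ennreal m \<partial>measure_pmf (pmf_of_set {..n'}))"
      using less Suc m
      by (intro nn_integral_mono) (auto intro!: nn_integral_collide_le wild_M1 \<mu>)
    finally show ?thesis by simp
  qed (use m in simp)
qed

text \<open>Up to time \<open>t\<close> the number of collisions in the genealogy is the number of splittings of a
  Yule process of rate 2, hence geometric with success probability \<open>exp (- 2 t)\<close>.\<close>

definition flow :: "real measure \<Rightarrow> real \<Rightarrow> real measure" where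
  "flow \<mu> t = mixture (geometric_pmf (exp (- 2 * t))) (wild \<mu>)"

lemma flow_M1: "\<mu> \<in> M1 \<Longrightarrow> flow \<mu> t \<in> M1"
  unfolding flow_def by (intro mixture_M1 wild_M1)

lemma nn_integral_flow:
  assumes \<mu>: "\<mu> \<in> M1" and m: "(\<integral>\<^sup>+x. ennreal x \<partial>\<mu>) \<le> ennreal m" "0 \<le> m"
  shows "(\<integral>\<^sup>+x. ennreal x \<partial>flow \<mu> t) \<le> ennreal m"
proof -
  have "(\<integral>\<^sup>+x. ennreal x \<partial>flow \<mu> t) \<le> (\<integral>\<^sup>+k. ennreal m \<partial>measure_pmf (geometric_pmf (exp (- 2 * t))))"
    unfolding flow_def nn_integral_mixture[OF wild_M1[OF \<mu>]]
    by (intro nn_integral_mono nn_integral_wild \<mu> m)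
  then show ?thesis by simp
qed

lemma integral_geometric_pmf:
  assumes p: "0 < p" "p \<le> 1" and a: "\<And>n. \<bar>a n\<bar> \<le> (B :: real)"
  shows "(\<lambda>n. (1 - p) ^ n * a n) sums ((\<integral>n. a n \<partial>measure_pmf (geometric_pmf p)) / p)"
proof -
  have s: "summable (\<lambda>n. norm ((1 - p) ^ n * a n))"
  proof (rule summable_comparison_test')
    show "summable (\<lambda>n. (1 - p) ^ n * B)" using p by (intro summable_mult2 summable_geometric) auto
    show "norm (norm ((1 - p) ^ n * a n)) \<le> (1 - p) ^ n * B" for n
      using p a[of n] by (auto simp: abs_mult intro!: mult_left_mono)
  qed
  have i: "integrable (count_space UNIV) (\<lambda>n. p * ((1 - p) ^ n * a n))"
    unfolding integrable_count_space_nat_iff using summable_mult[OF s, of p] p by (simp add: abs_mult)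
  have "(\<integral>n. a n \<partial>measure_pmf (geometric_pmf p)) = (\<integral>n. p * ((1 - p) ^ n * a n) \<partial>count_space UNIV)"
    unfolding measure_pmf_eq_density by (subst integral_density) (use p in \<open>auto simp: ac_simps pmf_nonneg\<close>)
  then have "(\<lambda>n. p * ((1 - p) ^ n * a n)) sums (\<integral>n. a n \<partial>measure_pmf (geometric_pmf p))"
    using sums_integral_count_space_nat[OF i] by simp
  from sums_divide[OF this, of p] show ?thesis using p by simp
qed

lemma bounded_test_integral_collide:
  "\<mu> \<in> M1 \<Longrightarrow> \<nu> \<in> M1 \<Longrightarrow> bounded_test B g \<Longrightarrow> \<bar>\<integral>x. g x \<partial>collide \<mu> \<nu>\<bar> \<le> B"
  by (rule bounded_test_integrable(2)[OF collide_M1])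

text \<open>A Cauchy product for an array that need not be a product of two sequences: the double series
  converges absolutely, so that it may be summed by rows or by diagonals.\<close>

lemma sums_diagonals:
  fixes b :: "nat \<Rightarrow> nat \<Rightarrow> real"
  assumes q: "0 \<le> q" "q < 1" and b: "\<And>k l. \<bar>b k l\<bar> \<le> B"
    and c: "\<And>k. (\<lambda>l. q ^ l * b k l) sums c k" and s: "(\<lambda>k. q ^ k * c k) sums s"
  shows "(\<lambda>n. (\<Sum>k\<le>n. b k (n - k)) * q ^ n) sums s"
proof -
  define f where "f = (\<lambda>(k, l). q ^ (k + l) * b k l)"
  have geo: "((\<lambda>n. q ^ n) has_sum (1 / (1 - q))) UNIV"
    using q by (intro norm_summable_imp_has_sum geometric_sums) (auto intro: summable_geometric)
  have B: "0 \<le> B" using b[of 0 0] by linarith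
  have "(\<lambda>(k, l). B * q ^ k * q ^ l) summable_on (UNIV \<times> UNIV)"
  proof (rule summable_on_SigmaI[where g = "\<lambda>k. B * q ^ k * (1 / (1 - q))"])
    show "((\<lambda>y. case (x, y) of (k, l) \<Rightarrow> B * q ^ k * q ^ l) has_sum B * q ^ x * (1 / (1 - q))) UNIV" for x
      using has_sum_cmult_right[OF geo, of "B * q ^ x"] by simp
    show "(\<lambda>k. B * q ^ k * (1 / (1 - q))) summable_on UNIV"
      using geo by (intro summable_on_cmult_left summable_on_cmult_right) (auto simp: summable_on_def)
  qed (use q B in auto)
  then have "(\<lambda>x. norm (f x)) summable_on (UNIV \<times> UNIV)"
  proof (rule summable_on_comparison_test)
    show "norm (f x) \<le> (case x of (k, l) \<Rightarrow> B * q ^ k * q ^ l)" for x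
    proof (cases x)
      case (Pair k l)
      have "(q ^ k * q ^ l) * \<bar>b k l\<bar> \<le> (q ^ k * q ^ l) * B" using q b by (intro mult_left_mono) auto
      then show ?thesis using q by (simp add: f_def Pair abs_mult power_add ac_simps)
    qed
  qed auto
  then have "f summable_on (UNIV \<times> UNIV)" by (rule abs_summable_summable)
  then obtain S where S: "(f has_sum S) (UNIV \<times> UNIV)" by (auto simp: summable_on_def)
  have inner: "((\<lambda>l. f (k, l)) has_sum (q ^ k * c k)) UNIV" for k
  proof -
    have "summable (\<lambda>l. norm (q ^ l * b k l))"
    proof (rule summable_comparison_test')
      show "summable (\<lambda>n. q ^ n * B)" using q by (intro summable_mult2 summable_geometric) auto
      show "norm (norm (q ^ n * b k n)) \<le> q ^ n * B" for n
        using q b[of k n] by (auto simp: abs_mult intro!: mult_left_mono)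
    qed
    from has_sum_cmult_right[OF norm_summable_imp_has_sum[OF this c], of "q ^ k"]
    show ?thesis by (simp add: f_def power_add mult.assoc)
  qed
  have "((\<lambda>k. q ^ k * c k) has_sum S) UNIV"
    by (rule has_sum_SigmaD[OF S]) (use inner in auto)
  from has_sum_imp_sums[OF this] s have [simp]: "S = s" by (rule sums_unique2)
  have "((\<lambda>(n, k). f (k, n - k)) has_sum s) (SIGMA n:UNIV. {..n})"
    using S by (subst has_sum_reindex_bij_witness[where S = "SIGMA n:UNIV. {..n}" and T = "UNIV \<times> UNIV"
        and j = "\<lambda>(n, k). (k, n - k)" and i = "\<lambda>(k, l). (k + l, k)" and h = f]) (auto split: prod.splits)
  then have "((\<lambda>n. \<Sum>k\<le>n. f (k, n - k)) has_sum s) UNIV"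
    by (rule has_sum_SigmaD) (auto intro: has_sum_finite)
  from has_sum_imp_sums[OF this] show ?thesis
    by (simp add: f_def sum_distrib_left mult.commute)
qed

lemma integral_flow:
  assumes \<mu>: "\<mu> \<in> M1" and g: "bounded_test B g" and t: "0 \<le> t"
  shows "(\<lambda>n. (1 - exp (- 2 * t)) ^ n * (\<integral>x. g x \<partial>wild \<mu> n)) sums ((\<integral>x. g x \<partial>flow \<mu> t) / exp (- 2 * t))"
  unfolding flow_def integral_mixture[OF wild_M1[OF \<mu>] g]
  by (rule integral_geometric_pmf) (use t bounded_test_integrable(2)[OF wild_M1[OF \<mu>] g] in auto)

text \<open>The collision of two mixtures is a double series by bilinearity. Its diagonal sums are the
  right-hand sides of the recursion for \<open>wild\<close>, which identifies the series of the derivative.\<close>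

lemma integral_collide_flow:
  assumes \<mu>: "\<mu> \<in> M1" and g: "bounded_test B g" and t: "0 \<le> t"
  shows "(\<lambda>n. real (Suc n) * (\<integral>x. g x \<partial>wild \<mu> (Suc n)) * (1 - exp (- 2 * t)) ^ n)
    sums ((\<integral>x. g x \<partial>collide (flow \<mu> t) (flow \<mu> t)) / (exp (- 2 * t))\<^sup>2)"
proof -
  note M = wild_M1[OF \<mu>] flow_M1[OF \<mu>]
  let ?q = "1 - exp (- 2 * t)"
  let ?b = "\<lambda>k l. \<integral>x. g x \<partial>collide (wild \<mu> k) (wild \<mu> l)"
  let ?c = "\<lambda>k. (\<integral>x. g x \<partial>collide (wild \<mu> k) (flow \<mu> t)) / exp (- 2 * t)"
  have "(\<lambda>n. (\<Sum>k\<le>n. ?b k (n - k)) * ?q ^ n) sums ((\<integral>x. g x \<partial>collide (flow \<mu> t) (flow \<mu> t)) / (exp (- 2 * t))\<^sup>2)"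
  proof (rule sums_diagonals)
    show "\<bar>?b k l\<bar> \<le> B" for k l by (intro bounded_test_integral_collide M g)
    show "(\<lambda>l. ?q ^ l * ?b k l) sums ?c k" for k
      unfolding integral_collide_right[OF M(1) M(1) g] integral_collide_right[OF M(1) M(2) g]
      by (rule integral_flow[OF \<mu> bounded_test_share[OF M(1) g] t])
    have "(\<lambda>k. ?q ^ k * (\<integral>x. g x \<partial>collide (wild \<mu> k) (flow \<mu> t)))
      sums ((\<integral>x. g x \<partial>collide (flow \<mu> t) (flow \<mu> t)) / exp (- 2 * t))"
      unfolding integral_collide_left[OF M(1) M(2) g] integral_collide_left[OF M(2) M(2) g]
      by (rule integral_flow[OF \<mu> bounded_test_share[OF M(2) g] t])
    from sums_divide[OF this, of "exp (- 2 * t)"]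
    show "(\<lambda>k. ?q ^ k * ?c k) sums ((\<integral>x. g x \<partial>collide (flow \<mu> t) (flow \<mu> t)) / (exp (- 2 * t))\<^sup>2)"
      by (simp add: power2_eq_square)
  qed (use t in auto)
  then show ?thesis unfolding integral_wild_Suc[OF \<mu> g] .
qed

text \<open>With \<open>q = 1 - exp (- 2 t)\<close> and \<open>S(q) = \<Sum>\<^sub>n \<langle>g, wild \<mu> n\<rangle> q\<^sup>n\<close>, the integral of \<open>g\<close> is \<open>(1 - q) S(q)\<close>,
  and \<open>(1 - q)\<^sup>2 S'(q)\<close> is the integral of \<open>g\<close> against \<open>collide (flow \<mu> t) (flow \<mu> t)\<close>.\<close>

lemma has_derivative_flow:
  assumes \<mu>: "\<mu> \<in> M1" and g: "bounded_test B g" and t: "0 \<le> t"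
  shows "((\<lambda>t. \<integral>x. g x \<partial>flow \<mu> t) has_real_derivative Q \<infinity> (flow \<mu> t) g) (at t within {0..})"
proof -
  let ?a = "\<lambda>n. \<integral>x. g x \<partial>wild \<mu> n"
  define S where "S q = (\<Sum>n. ?a n * q ^ n)" for q
  define p where "p = exp (- 2 * t)"
  have p: "0 < p" "p \<le> 1" using t by (auto simp: p_def)
  have ab: "\<bar>?a n\<bar> \<le> B" for n by (rule bounded_test_integrable(2)[OF wild_M1[OF \<mu>] g])
  have flow_S: "(\<integral>x. g x \<partial>flow \<mu> s) = exp (- 2 * s) * S (1 - exp (- 2 * s))" if "0 \<le> s" for s
    using sums_unique[OF integral_flow[OF \<mu> g that]] by (simp add: S_def mult.commute field_simps)
  \<comment> \<open>A radius between \<open>1 - p\<close> and the radius of convergence 1.\<close>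
  define K where "K = 1 - p / 2"
  have K: "0 < K" "K < 1" "1 - p < K" using p by (auto simp: K_def)
  have "summable (\<lambda>n. ?a n * K ^ n)"
  proof (rule summable_comparison_test')
    show "summable (\<lambda>n. B * K ^ n)" using K by (intro summable_mult summable_geometric) auto
    show "norm (?a n * K ^ n) \<le> B * K ^ n" for n
      using K ab[of n] by (auto simp: abs_mult intro!: mult_right_mono)
  qed
  then have "DERIV S (1 - p) :> (\<Sum>n. diffs ?a n * (1 - p) ^ n)"
    unfolding S_def[abs_def] by (rule termdiffs_strong) (use p K in auto)
  also have "(\<Sum>n. diffs ?a n * (1 - p) ^ n) = (\<integral>x. g x \<partial>collide (flow \<mu> t) (flow \<mu> t)) / p\<^sup>2"
    using sums_unique[OF integral_collide_flow[OF \<mu> g t]] unfolding diffs_def p_def by simp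
  finally have dS: "DERIV S (1 - exp (- 2 * t)) :> (\<integral>x. g x \<partial>collide (flow \<mu> t) (flow \<mu> t)) / p\<^sup>2"
    by (simp add: p_def)
  have "DERIV (\<lambda>s. exp (- 2 * s) * S (1 - exp (- 2 * s))) t :>
      exp (- 2 * t) * ((\<integral>x. g x \<partial>collide (flow \<mu> t) (flow \<mu> t)) / p\<^sup>2 * (2 * exp (- 2 * t)))
      + (- 2) * exp (- 2 * t) * S (1 - exp (- 2 * t))"
  proof -
    have d: "DERIV (\<lambda>s. 1 - exp (- 2 * s)) t :> 2 * exp (- 2 * t)" "DERIV (\<lambda>s. exp (- 2 * s)) t :> (- 2) * exp (- 2 * t)"
      by (auto intro!: derivative_eq_intros)
    show ?thesis
      using DERIV_mult'[OF d(2) DERIV_chain2[where f = S and g = "\<lambda>s. 1 - exp (- 2 * s)", OF dS d(1)]] by simp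
  qed
  also have "exp (- 2 * t) * ((\<integral>x. g x \<partial>collide (flow \<mu> t) (flow \<mu> t)) / p\<^sup>2 * (2 * exp (- 2 * t)))
      + (- 2) * exp (- 2 * t) * S (1 - exp (- 2 * t)) = Q \<infinity> (flow \<mu> t) g"
    using flow_S[OF t] p unfolding Q_infinity[OF flow_M1[OF \<mu>] g] p_def[symmetric]
    by (simp add: power2_eq_square field_simps)
  finally have "((\<lambda>s. exp (- 2 * s) * S (1 - exp (- 2 * s))) has_real_derivative Q \<infinity> (flow \<mu> t) g) (at t within {0..})"
    by (rule has_field_derivative_at_within)
  then show ?thesis
    by (rule has_field_derivative_transform_within[where d = 1]) (use t flow_S in auto)
qed

lemma Q_infinity_bound:
  assumes "\<mu> \<in> M1" "bounded_test B g"
  shows "\<bar>Q \<infinity> \<mu> g\<bar> \<le> 4 * B"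
  using bounded_test_integral_collide[OF assms(1,1,2)] bounded_test_integrable(2)[OF assms]
  unfolding Q_infinity[OF assms] by linarith

lemma flow_Lipschitz:
  assumes \<mu>: "\<mu> \<in> M1" and g: "bounded_test B g" and s: "0 \<le> s" and t: "0 \<le> t"
  shows "\<bar>(\<integral>x. g x \<partial>flow \<mu> t) - (\<integral>x. g x \<partial>flow \<mu> s)\<bar> \<le> 4 * B * \<bar>t - s\<bar>"
proof -
  have "norm ((\<integral>x. g x \<partial>flow \<mu> t) - (\<integral>x. g x \<partial>flow \<mu> s)) \<le> 4 * B * norm (t - s)"
    by (rule field_differentiable_bound[where S = "{0..}" and f' = "\<lambda>t. Q \<infinity> (flow \<mu> t) g"])
      (use s t has_derivative_flow[OF \<mu> g] Q_infinity_bound[OF flow_M1[OF \<mu>] g] in auto)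
  then show ?thesis by simp
qed

text \<open>By bilinearity the gain term changes by two increments of \<open>flow\<close>, each tested against a
  bounded function.\<close>

lemma Q_flow_Lipschitz:
  assumes \<mu>: "\<mu> \<in> M1" and g: "bounded_test B g" and s: "0 \<le> s" and t: "0 \<le> t"
  shows "\<bar>Q \<infinity> (flow \<mu> t) g - Q \<infinity> (flow \<mu> s) g\<bar> \<le> 24 * B * \<bar>t - s\<bar>"
proof -
  note M = flow_M1[OF \<mu>]
  have "\<bar>(\<integral>x. g x \<partial>collide (flow \<mu> t) (flow \<mu> t)) - (\<integral>x. g x \<partial>collide (flow \<mu> s) (flow \<mu> t))\<bar> \<le> 4 * B * \<bar>t - s\<bar>"
    unfolding integral_collide_left[OF M M g]
    by (rule flow_Lipschitz[OF \<mu> bounded_test_share[OF M g] s t])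
  moreover have "\<bar>(\<integral>x. g x \<partial>collide (flow \<mu> s) (flow \<mu> t)) - (\<integral>x. g x \<partial>collide (flow \<mu> s) (flow \<mu> s))\<bar> \<le> 4 * B * \<bar>t - s\<bar>"
    unfolding integral_collide_right[OF M M g]
    by (rule flow_Lipschitz[OF \<mu> bounded_test_share[OF M g] s t])
  ultimately show ?thesis
    using flow_Lipschitz[OF \<mu> g s t] unfolding Q_infinity[OF M g] by linarith
qed

lemma continuous_on_Q_flow:
  assumes \<mu>: "\<mu> \<in> M1" and g: "bounded_test B g"
  shows "continuous_on {0..} (\<lambda>t. Q \<infinity> (flow \<mu> t) g)"
proof -
  have "(24 * B)-lipschitz_on {0..} (\<lambda>t. Q \<infinity> (flow \<mu> t) g)"
    by (rule lipschitz_onI) (use Q_flow_Lipschitz[OF \<mu> g] bounded_test_nonneg[OF g] in \<open>auto simp: dist_real_def\<close>)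
  then show ?thesis by (rule lipschitz_on_continuous_on)
qed

lemma integral_flow_0:
  assumes \<mu>: "\<mu> \<in> M1" and g: "bounded_test B g"
  shows "(\<integral>x. g x \<partial>flow \<mu> 0) = (\<integral>x. g x \<partial>\<mu>)"
  unfolding flow_def integral_mixture[OF wild_M1[OF \<mu>] g] by simp

lemma kinetic_solution_flow:
  assumes \<mu>: "\<mu> \<in> M1"
  shows "kinetic_solution \<infinity> \<mu> (flow \<mu>)"
  unfolding kinetic_solution_def
proof (intro ballI allI impI conjI)
  fix g and t :: real assume "g \<in> Cb" and t: "0 \<le> t"
  then obtain B where g: "bounded_test B g" using bounded_test_Cb by blast
  have c: "continuous_on {0..t} (\<lambda>t. Q \<infinity> (flow \<mu> t) g)"
    by (rule continuous_on_subset[OF continuous_on_Q_flow[OF \<mu> g]]) auto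
  show "set_integrable lborel {0..t} (\<lambda>s. Q \<infinity> (flow \<mu> s) g)"
    by (rule borel_integrable_atLeastAtMost'[OF c])
  have "(LBINT s:{0..t}. Q \<infinity> (flow \<mu> s) g) = (\<integral>x. g x \<partial>flow \<mu> t) - (\<integral>x. g x \<partial>flow \<mu> 0)"
    unfolding set_lebesgue_integral_def
    by (rule integral_FTC_atLeastAtMost[OF t _ c])
      (auto simp: has_real_derivative_iff_has_vector_derivative[symmetric]
        intro: DERIV_subset[OF has_derivative_flow[OF \<mu> g]])
  then show "(\<integral>x. g x \<partial>flow \<mu> t) = (\<integral>x. g x \<partial>\<mu>) + (LBINT s:{0..t}. Q \<infinity> (flow \<mu> s) g)"
    using integral_flow_0[OF \<mu> g] by simp
qed

lemma topspace_weak_topology: "topspace weak_topology = M1"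
proof -
  have "{\<mu> \<in> M1. (\<integral>x. g x \<partial>\<mu>) \<in> U} \<subseteq> M1" for g :: "real \<Rightarrow> real" and U by auto
  moreover have "M1 \<in> {{\<mu> \<in> M1. (\<integral>x. g x \<partial>\<mu>) \<in> U} | g U. g \<in> Cb \<and> open U}"
    by (rule CollectI, rule exI[of _ "\<lambda>_. 0"], rule exI[of _ UNIV]) (auto simp: Cb_def bounded_iff)
  ultimately show ?thesis
    unfolding weak_topology_def topology_generated_by_topspace by blast
qed

lemma continuous_map_flow:
  assumes \<mu>: "\<mu> \<in> M1"
  shows "continuous_map (top_of_set {0..}) weak_topology (flow \<mu>)"
  unfolding weak_topology_def
proof (rule continuous_on_generated_topo)
  fix V assume "V \<in> {{\<mu> \<in> M1. (\<integral>x. g x \<partial>\<mu>) \<in> U} | g U. g \<in> Cb \<and> open U}"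
  then obtain g U where V: "V = {\<mu> \<in> M1. (\<integral>x. g x \<partial>\<mu>) \<in> U}" and gU: "g \<in> Cb" "open U" by auto
  obtain B where g: "bounded_test B g" using bounded_test_Cb gU by blast
  have "continuous_on {0..} (\<lambda>t. \<integral>x. g x \<partial>flow \<mu> t)"
    by (rule DERIV_continuous_on) (use has_derivative_flow[OF \<mu> g] in auto)
  then have "openin (top_of_set {0..}) ({0..} \<inter> (\<lambda>t. \<integral>x. g x \<partial>flow \<mu> t) -` U)"
    using gU(2) by (rule continuous_openin_preimage_gen)
  moreover have "{0..} \<inter> (\<lambda>t. \<integral>x. g x \<partial>flow \<mu> t) -` U = flow \<mu> -` V \<inter> topspace (top_of_set {0..})"
    using flow_M1[OF \<mu>] by (auto simp: V)
  ultimately show "openin (top_of_set {0..}) (flow \<mu> -` V \<inter> topspace (top_of_set {0..}))" by simp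
next
  show "flow \<mu> ` topspace (top_of_set {0..}) \<subseteq> \<Union> {{\<mu> \<in> M1. (\<integral>x. g x \<partial>\<mu>) \<in> U} | g U. g \<in> Cb \<and> open U}"
    using flow_M1[OF \<mu>] topspace_weak_topology
    unfolding weak_topology_def topology_generated_by_topspace by auto
qed

section \<open>Laplace transforms control the weak topology\<close>

definition laplace :: "real measure \<Rightarrow> real \<Rightarrow> real" where
  "laplace \<mu> l = (\<integral>x. exp (- l * x) \<partial>\<mu>)"

text \<open>A bound on the mean is all that is kept of tightness: it is shared by the empirical measures and
  the limit and preserved by collisions. The Lebesgue integral with values in \<open>[0, \<infinity>]\<close> makes
  integrability part of the bound.\<close>

definition mean_le :: "real \<Rightarrow> real measure \<Rightarrow> bool" where
  "mean_le m \<mu> \<longleftrightarrow> 0 \<le> m \<and> (\<integral>\<^sup>+x. ennreal x \<partial>\<mu>) \<le> ennreal m"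

lemma mean_leD:
  assumes \<mu>: "\<mu> \<in> M1" and m: "mean_le m \<mu>"
  shows "integrable \<mu> (\<lambda>x. x)" "(\<integral>x. x \<partial>\<mu>) \<le> m" "0 \<le> m"
proof -
  note [measurable_cong] = M1_D(2)[OF \<mu>]
  show m0: "0 \<le> m" using m by (simp add: mean_le_def)
  have *: "(\<integral>\<^sup>+x. ennreal (norm x) \<partial>\<mu>) = (\<integral>\<^sup>+x. ennreal x \<partial>\<mu>)"
    by (rule nn_integral_cong) (simp add: M1_D[OF \<mu>])
  have "(\<integral>\<^sup>+x. ennreal (norm x) \<partial>\<mu>) < \<infinity>"
    unfolding * using m by (auto simp: mean_le_def intro: le_less_trans[of _ "ennreal m"])
  then show i: "integrable \<mu> (\<lambda>x. x)" by (rule integrableI_bounded[rotated]) measurable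
  have "ennreal (\<integral>x. x \<partial>\<mu>) = (\<integral>\<^sup>+x. ennreal x \<partial>\<mu>)"
    by (rule nn_integral_eq_integral[symmetric, OF i]) (auto intro!: AE_I2 simp: M1_D[OF \<mu>])
  then have "ennreal (\<integral>x. x \<partial>\<mu>) \<le> ennreal m" using m by (simp add: mean_le_def)
  then show "(\<integral>x. x \<partial>\<mu>) \<le> m" by (simp only: ennreal_le_iff[OF m0])
qed

lemma mean_le_collide: "\<mu> \<in> M1 \<Longrightarrow> mean_le m \<mu> \<Longrightarrow> mean_le m (collide \<mu> \<mu>)"
  unfolding mean_le_def by (auto intro!: nn_integral_collide_le)

lemma mean_le_flow: "\<mu> \<in> M1 \<Longrightarrow> mean_le m \<mu> \<Longrightarrow> mean_le m (flow \<mu> t)"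
  unfolding mean_le_def by (auto intro!: nn_integral_flow)

lemma mean_le_scaled_bound:
  assumes \<mu>: "\<mu> \<in> M1" and m: "mean_le m \<mu>" and f: "integrable \<mu> f" and c: "0 \<le> c"
    and b: "\<And>x. 0 \<le> x \<Longrightarrow> \<bar>f x\<bar> \<le> a + c * x"
  shows "\<bar>\<integral>x. f x \<partial>\<mu>\<bar> \<le> a + c * m"
proof -
  interpret prob_space \<mu> using M1_D[OF \<mu>] by simp
  note i = mean_leD[OF \<mu> m]
  have "\<bar>\<integral>x. f x \<partial>\<mu>\<bar> \<le> (\<integral>x. \<bar>f x\<bar> \<partial>\<mu>)" by (rule integral_abs_bound)
  also have "\<dots> \<le> (\<integral>x. a + c * x \<partial>\<mu>)"
    using f i(1) b by (intro integral_mono) (auto simp: M1_D[OF \<mu>])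
  also have "\<dots> = a + c * (\<integral>x. x \<partial>\<mu>)"
    using i(1) prob_space by simp
  also have "\<dots> \<le> a + c * m" using i c by (intro add_left_mono mult_left_mono) auto
  finally show ?thesis .
qed

lemma laplace_bounds: "\<mu> \<in> M1 \<Longrightarrow> 0 \<le> l \<Longrightarrow> 0 \<le> laplace \<mu> l \<and> laplace \<mu> l \<le> 1"
  using bounded_test_integrable(2)[OF _ bounded_test_exp, of \<mu> l]
  unfolding laplace_def by (auto intro!: integral_nonneg_AE)

lemma laplace_flow_0: "\<mu> \<in> M1 \<Longrightarrow> 0 \<le> l \<Longrightarrow> laplace (flow \<mu> 0) l = laplace \<mu> l"
  unfolding laplace_def by (rule integral_flow_0[OF _ bounded_test_exp])

text \<open>The derivative of the Laplace transform is bounded by the mean.\<close>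

lemma laplace_Lipschitz:
  assumes \<mu>: "\<mu> \<in> M1" and m: "mean_le m \<mu>" and l: "0 \<le> l" "0 \<le> l'"
  shows "\<bar>laplace \<mu> l - laplace \<mu> l'\<bar> \<le> m * \<bar>l - l'\<bar>"
proof -
  have e: "\<bar>exp (- a) - exp (- b)\<bar> \<le> \<bar>a - b\<bar>" if "0 \<le> a" "0 \<le> b" for a b :: real
  proof -
    have "norm (exp (- a) - exp (- b)) \<le> 1 * norm (a - b)"
      by (rule field_differentiable_bound[where S = "{0..}" and f' = "\<lambda>x. - exp (- x)"])
        (use that in \<open>auto intro!: derivative_eq_intros\<close>)
    then show ?thesis by simp
  qed
  have i: "integrable \<mu> (\<lambda>x. exp (- l * x))" if "0 \<le> l" for l
    using bounded_test_integrable(1)[OF \<mu> bounded_test_exp[OF that]] .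
  have "\<bar>\<integral>x. exp (- l * x) - exp (- l' * x) \<partial>\<mu>\<bar> \<le> 0 + \<bar>l - l'\<bar> * m"
  proof (rule mean_le_scaled_bound[OF \<mu> m])
    fix x :: real assume x: "0 \<le> x"
    have "\<bar>exp (- (l * x)) - exp (- (l' * x))\<bar> \<le> \<bar>l * x - l' * x\<bar>" using l x by (intro e) auto
    also have "\<dots> = \<bar>l - l'\<bar> * x" using x by (simp add: left_diff_distrib[symmetric] abs_mult)
    finally show "\<bar>exp (- l * x) - exp (- l' * x)\<bar> \<le> 0 + \<bar>l - l'\<bar> * x" by simp
  qed (use i l in auto)
  then show ?thesis unfolding laplace_def using i[OF l(1)] i[OF l(2)] by (simp add: mult.commute[of m])
qed

text \<open>In the variable \<open>z = exp (- x)\<close> the half-line becomes \<open>(0, 1]\<close>. After a cutoff beyond \<open>K\<close> the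
  function extends continuously by 0 to \<open>z = 0\<close>, and Weierstrass's theorem applies on \<open>[0, 1]\<close>. The
  cutoff costs at most \<open>B\<close> where \<open>x \<ge> K\<close>, hence at most \<open>B x / K\<close>.\<close>

lemma exp_polynomial_approximation:
  assumes g: "g \<in> Cb" and B: "\<And>x. 0 \<le> x \<Longrightarrow> \<bar>g x\<bar> \<le> B" and K: "0 < K" and e: "0 < e"
  obtains a :: "nat \<Rightarrow> real" and n :: nat
  where "\<And>x. 0 \<le> x \<Longrightarrow> \<bar>g x - (\<Sum>i\<le>n. a i * exp (- real i * x))\<bar> \<le> e + B / K * x"
proof -
  define f where "f x = g x * max 0 (min 1 (K + 1 - x))" for x
  define c where "c = exp (- (K + 1))"
  define h where "h z = (if z \<le> c then 0 else f (- ln z))" for z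
  have c: "0 < c" by (simp add: c_def)
  have B0: "0 \<le> B" using B[of 0] by auto
  have fc: "continuous_on {0..} f"
    unfolding f_def using g by (intro continuous_intros) (auto simp: Cb_def)
  have "continuous_on {0..1} h"
    unfolding h_def
  proof (rule continuous_on_cases_le)
    show "continuous_on {z \<in> {0..1}. c \<le> z} (\<lambda>z. f (- ln z))"
      by (rule continuous_on_compose2[OF fc]) (use c in \<open>auto intro!: continuous_intros\<close>)
    show "0 = f (- ln z)" if "z \<in> {0..1}" "z = c" for z using that by (simp add: c_def f_def)
  qed (auto intro!: continuous_intros)
  then obtain p where p: "real_polynomial_function p" "\<And>z. z \<in> {0..1} \<Longrightarrow> \<bar>h z - p z\<bar> < e"
    using Stone_Weierstrass_real_polynomial_function[of "{0..1}" h e] e by auto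
  obtain a n where an: "p = (\<lambda>z. \<Sum>i\<le>n. a i * z ^ i)"
    using p(1) unfolding real_polynomial_function_iff_sum by auto
  show ?thesis
  proof (rule that)
    fix x :: real assume x: "0 \<le> x"
    have 1: "h (exp (- x)) = f x"
      by (auto simp: h_def c_def f_def)
    have 2: "p (exp (- x)) = (\<Sum>i\<le>n. a i * exp (- real i * x))"
      unfolding an by (simp add: exp_of_nat_mult[symmetric])
    have 3: "\<bar>f x - (\<Sum>i\<le>n. a i * exp (- real i * x))\<bar> < e"
      using p(2)[of "exp (- x)"] x unfolding 1 2 by simp
    have "\<bar>g x - f x\<bar> \<le> B / K * x"
    proof (cases "x \<le> K")
      case True then show ?thesis using x K B0 by (simp add: f_def)
    next
      case False
      have "\<bar>g x - f x\<bar> = \<bar>g x\<bar> * \<bar>1 - max 0 (min 1 (K + 1 - x))\<bar>"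
        unfolding abs_mult[symmetric] by (simp add: f_def right_diff_distrib)
      also have "\<dots> \<le> B * 1" using B[OF x] by (intro mult_mono) auto
      also have "\<dots> \<le> B * (x / K)" using False K B0 by (intro mult_left_mono) auto
      finally show ?thesis by simp
    qed
    with 3 show "\<bar>g x - (\<Sum>i\<le>n. a i * exp (- real i * x))\<bar> \<le> e + B / K * x" by linarith
  qed
qed

text \<open>The basic notion of proximity. It ranges over an interval of parameters because the collision
  operator mixes all parameters below the given one.\<close>

definition laplace_close :: "real \<Rightarrow> real \<Rightarrow> real measure \<Rightarrow> real measure \<Rightarrow> bool" where
  "laplace_close D \<delta> \<mu> \<nu> \<longleftrightarrow> (\<forall>l\<in>{0..D}. \<bar>laplace \<mu> l - laplace \<nu> l\<bar> \<le> \<delta>)"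

lemma laplace_close_mono:
  "laplace_close D \<delta> \<mu> \<nu> \<Longrightarrow> D' \<le> D \<Longrightarrow> \<delta> \<le> \<delta>' \<Longrightarrow> laplace_close D' \<delta>' \<mu> \<nu>"
  unfolding laplace_close_def by force

text \<open>By the Lipschitz bound, finitely many parameters decide.\<close>

lemma laplace_close_grid:
  assumes \<mu>: "\<mu> \<in> M1" "mean_le m \<mu>" and \<nu>: "\<nu> \<in> M1" "mean_le m \<nu>" and d: "0 < \<sigma>"
    and node: "\<And>j. j \<le> J \<Longrightarrow> \<bar>laplace \<mu> (real j * \<sigma>) - laplace \<nu> (real j * \<sigma>)\<bar> \<le> a"
  shows "laplace_close (real J * \<sigma>) (a + 2 * m * \<sigma>) \<mu> \<nu>"
  unfolding laplace_close_def
proof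
  have m0: "0 \<le> m" using \<mu>(2) by (simp add: mean_le_def)
  fix l assume l: "l \<in> {0..real J * \<sigma>}"
  define j where "j = nat \<lfloor>l / \<sigma>\<rfloor>"
  have "0 \<le> l / \<sigma>" using l d by simp
  then have j1: "real j \<le> l / \<sigma>" "l / \<sigma> < real j + 1" unfolding j_def by linarith+
  have "l / \<sigma> \<le> real J" using l d by (simp add: pos_divide_le_eq)
  with j1 have jJ: "j \<le> J" by linarith
  have j2: "\<bar>l - real j * \<sigma>\<bar> \<le> \<sigma>" using j1 d by (simp add: pos_le_divide_eq pos_divide_less_eq abs_le_iff algebra_simps)
  have lip: "\<bar>laplace \<rho> l - laplace \<rho> (real j * \<sigma>)\<bar> \<le> m * \<sigma>" if "\<rho> \<in> M1" "mean_le m \<rho>" for \<rho>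
    using laplace_Lipschitz[OF that, of l "real j * \<sigma>"] l d mult_left_mono[OF j2 m0] by auto
  show "\<bar>laplace \<mu> l - laplace \<nu> l\<bar> \<le> a + 2 * m * \<sigma>"
    using node[OF jJ] lip[OF \<mu>] lip[OF \<nu>] by (simp add: algebra_simps)
qed

lemma laplace_close_integral:
  assumes g: "g \<in> Cb" and m: "0 \<le> m" and e: "0 < e"
  obtains D \<delta> where "0 < \<delta>" "0 \<le> D"
    "\<And>\<mu> \<nu>. \<mu> \<in> M1 \<Longrightarrow> \<nu> \<in> M1 \<Longrightarrow> mean_le m \<mu> \<Longrightarrow> mean_le m \<nu> \<Longrightarrow> laplace_close D \<delta> \<mu> \<nu> \<Longrightarrow>
       \<bar>(\<integral>x. g x \<partial>\<mu>) - (\<integral>x. g x \<partial>\<nu>)\<bar> \<le> e"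
proof -
  obtain B where B: "bounded_test B g" using bounded_test_Cb[OF g] by blast
  have B0: "0 \<le> B" by (rule bounded_test_nonneg[OF B])
  \<comment> \<open>The cutoff is so large that the tail costs at most \<open>e / 8\<close>.\<close>
  define K where "K = 8 * (B * m + 1) / e"
  have Bm: "0 \<le> B * m" using B0 m by simp
  have K: "0 < K" unfolding K_def using Bm e by (intro divide_pos_pos) auto
  have tail: "B / K * m \<le> e / 8"
    using e Bm by (simp add: K_def divide_simps)
  obtain a n where an: "\<And>x. 0 \<le> x \<Longrightarrow> \<bar>g x - (\<Sum>i\<le>n. a i * exp (- real i * x))\<bar> \<le> e / 8 + B / K * x"
    using exp_polynomial_approximation[OF g _ K, of B "e / 8"] B e by (auto simp: bounded_test_def)
  define A where "A = (\<Sum>i\<le>n. \<bar>a i\<bar>)"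
  have A: "0 \<le> A" unfolding A_def by (intro sum_nonneg) auto
  define \<delta> where "\<delta> = e / (4 * (1 + A))"
  have approx: "\<bar>(\<integral>x. g x \<partial>\<mu>) - (\<Sum>i\<le>n. a i * laplace \<mu> (real i))\<bar> \<le> e / 4"
    if \<mu>: "\<mu> \<in> M1" and mean: "mean_le m \<mu>" for \<mu>
  proof -
    have i: "integrable \<mu> (\<lambda>x. exp (- real i * x))" for i
      by (rule bounded_test_integrable(1)[OF \<mu> bounded_test_exp]) simp
    have gi: "integrable \<mu> g" by (rule bounded_test_integrable(1)[OF \<mu> B])
    have "\<bar>\<integral>x. g x - (\<Sum>i\<le>n. a i * exp (- real i * x)) \<partial>\<mu>\<bar> \<le> e / 8 + B / K * m"
      by (rule mean_le_scaled_bound[OF \<mu> mean _ _ an]) (use i gi B0 K in auto)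
    also have "(\<integral>x. g x - (\<Sum>i\<le>n. a i * exp (- real i * x)) \<partial>\<mu>) = (\<integral>x. g x \<partial>\<mu>) - (\<Sum>i\<le>n. a i * laplace \<mu> (real i))"
      unfolding laplace_def using i gi by simp
    finally show ?thesis using tail by linarith
  qed
  show ?thesis
  proof (rule that)
    show "0 < \<delta>" using e A by (auto simp: \<delta>_def)
    show "0 \<le> real n" by simp
    fix \<mu> \<nu> assume \<mu>: "\<mu> \<in> M1" "mean_le m \<mu>" and \<nu>: "\<nu> \<in> M1" "mean_le m \<nu>" and close: "laplace_close (real n) \<delta> \<mu> \<nu>"
    have "\<bar>(\<Sum>i\<le>n. a i * laplace \<mu> (real i)) - (\<Sum>i\<le>n. a i * laplace \<nu> (real i))\<bar>
        = \<bar>\<Sum>i\<le>n. a i * (laplace \<mu> (real i) - laplace \<nu> (real i))\<bar>"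
      by (simp add: sum_subtractf[symmetric] right_diff_distrib)
    also have "\<dots> \<le> (\<Sum>i\<le>n. \<bar>a i\<bar> * \<delta>)"
      using close by (intro order_trans[OF sum_abs] sum_mono)
        (auto simp: abs_mult laplace_close_def intro!: mult_left_mono)
    also have "\<dots> = A * \<delta>" by (simp add: A_def sum_distrib_right)
    also have "\<dots> \<le> e / 4" using e A by (simp add: \<delta>_def divide_simps)
    finally show "\<bar>(\<integral>x. g x \<partial>\<mu>) - (\<integral>x. g x \<partial>\<nu>)\<bar> \<le> e"
      using approx[OF \<mu>] approx[OF \<nu>] e by linarith
  qed
qed

text \<open>Finitely many test functions at once, since the conditions for them can be intersected.\<close>

lemma laplace_close_integral_family:
  assumes g: "\<And>k::nat. g k \<in> Cb" and m: "0 \<le> m" and e: "0 < e"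
  obtains D \<delta> where "0 < \<delta>" "0 \<le> D"
    "\<And>\<mu> \<nu> k. \<mu> \<in> M1 \<Longrightarrow> \<nu> \<in> M1 \<Longrightarrow> mean_le m \<mu> \<Longrightarrow> mean_le m \<nu> \<Longrightarrow> laplace_close D \<delta> \<mu> \<nu> \<Longrightarrow> k \<le> n \<Longrightarrow>
       \<bar>(\<integral>x. g k x \<partial>\<mu>) - (\<integral>x. g k x \<partial>\<nu>)\<bar> \<le> e"
proof -
  have "\<exists>D \<delta>. 0 < \<delta> \<and> 0 \<le> D \<and> (\<forall>\<mu>\<in>M1. \<forall>\<nu>\<in>M1. mean_le m \<mu> \<longrightarrow> mean_le m \<nu> \<longrightarrow> laplace_close D \<delta> \<mu> \<nu> \<longrightarrow>
      (\<forall>k\<le>n. \<bar>(\<integral>x. g k x \<partial>\<mu>) - (\<integral>x. g k x \<partial>\<nu>)\<bar> \<le> e))"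
  proof (induction n)
    case 0
    show ?case by (rule laplace_close_integral[OF g[of 0] m e]) auto
  next
    case (Suc n)
    then obtain D \<delta> where IH: "0 < \<delta>" "0 \<le> D" "\<forall>\<mu>\<in>M1. \<forall>\<nu>\<in>M1. mean_le m \<mu> \<longrightarrow> mean_le m \<nu> \<longrightarrow> laplace_close D \<delta> \<mu> \<nu> \<longrightarrow>
      (\<forall>k\<le>n. \<bar>(\<integral>x. g k x \<partial>\<mu>) - (\<integral>x. g k x \<partial>\<nu>)\<bar> \<le> e)" by blast
    obtain D' \<delta>' where new: "0 < \<delta>'" "0 \<le> D'"
      "\<And>\<mu> \<nu>. \<mu> \<in> M1 \<Longrightarrow> \<nu> \<in> M1 \<Longrightarrow> mean_le m \<mu> \<Longrightarrow> mean_le m \<nu> \<Longrightarrow> laplace_close D' \<delta>' \<mu> \<nu> \<Longrightarrow>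
       \<bar>(\<integral>x. g (Suc n) x \<partial>\<mu>) - (\<integral>x. g (Suc n) x \<partial>\<nu>)\<bar> \<le> e"
      by (rule laplace_close_integral[OF g[of "Suc n"] m e]) auto
    have "laplace_close D \<delta> \<mu> \<nu> \<and> laplace_close D' \<delta>' \<mu> \<nu>" if "laplace_close (max D D') (min \<delta> \<delta>') \<mu> \<nu>" for \<mu> \<nu>
      using laplace_close_mono[OF that] by auto
    then show ?case
      using IH new by (intro exI[of _ "max D D'"] exI[of _ "min \<delta> \<delta>'"]) (auto simp: le_Suc_eq)
  qed
  then show ?thesis using that by blast
qed

section \<open>The Prokhorov distance\<close>

lemma prokhorov_leI:
  assumes "0 < e" and "\<And>A. A \<in> sets Rplus \<Longrightarrow> measure \<mu> A \<le> measure \<nu> (thickening e A) + e"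
    and "\<And>A. A \<in> sets Rplus \<Longrightarrow> measure \<nu> A \<le> measure \<mu> (thickening e A) + e"
  shows "prokhorov \<mu> \<nu> \<le> e"
  unfolding prokhorov_def
  by (rule cInf_lower) (use assms in \<open>auto intro!: bdd_belowI[of _ 0]\<close>)

lemma prokhorov_le_1:
  assumes "\<mu> \<in> M1" "\<nu> \<in> M1"
  shows "prokhorov \<mu> \<nu> \<le> 1"
proof -
  interpret A: prob_space \<mu> using M1_D[OF assms(1)] by simp
  interpret B: prob_space \<nu> using M1_D[OF assms(2)] by simp
  show ?thesis
    by (rule prokhorov_leI) (auto intro: order_trans[OF A.prob_le_1] order_trans[OF B.prob_le_1])
qed

lemma thickening_sets: "thickening e A \<in> sets Rplus"
proof -
  have "thickening e A = {0..} \<inter> (\<Union>a\<in>A. ball a e)"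
    by (auto simp: thickening_def dist_commute)
  moreover have "open (\<Union>a\<in>A. ball a e)" by auto
  ultimately show ?thesis unfolding Rplus_def sets_restrict_space by auto
qed

text \<open>The hat functions are differences of consecutive ramps, which makes their sum telescope.\<close>

definition ramp :: "real \<Rightarrow> nat \<Rightarrow> real \<Rightarrow> real" where
  "ramp \<eta> k x = max 0 (min 1 (x / \<eta> - real k + 1))"

definition hat :: "real \<Rightarrow> nat \<Rightarrow> real \<Rightarrow> real" where
  "hat \<eta> k x = ramp \<eta> k x - ramp \<eta> (Suc k) x"

lemma hat_Cb: "0 < \<eta> \<Longrightarrow> hat \<eta> k \<in> Cb"
  unfolding Cb_def hat_def ramp_def
  by (auto intro!: continuous_intros boundedI[of _ 1])

lemma hat_nonneg: "0 \<le> hat \<eta> k x"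
  by (auto simp: hat_def ramp_def)

lemma hat_support: "0 < \<eta> \<Longrightarrow> 0 < hat \<eta> k x \<Longrightarrow> \<bar>x - real k * \<eta>\<bar> < \<eta>"
  by (auto simp: hat_def ramp_def min_def max_def field_simps abs_less_iff split: if_splits)

lemma sum_hat:
  assumes "0 \<le> x" "0 < \<eta>"
  shows "(\<Sum>k\<le>n. hat \<eta> k x) = 1 - ramp \<eta> (Suc n) x"
proof -
  have "(\<Sum>k\<le>n. hat \<eta> k x) = ramp \<eta> 0 x - ramp \<eta> (Suc n) x"
    unfolding hat_def by (rule sum_telescope)
  then show ?thesis using assms by (simp add: ramp_def)
qed

text \<open>Up to \<open>n \<eta>\<close>, a set is covered by the supports of the hats that meet it. Two points in the support of
  one hat are less than \<open>2 \<eta>\<close> apart, so these supports lie in the thickening. The hats do not depend on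
  the set. Markov's inequality bounds the mass beyond \<open>n \<eta>\<close>.\<close>

lemma measure_le_thickening:
  assumes \<mu>: "\<mu> \<in> M1" and \<nu>: "\<nu> \<in> M1" and m: "mean_le m \<mu>" and e: "0 < \<eta>" "2 * \<eta> \<le> e"
    and A: "A \<in> sets Rplus" and n: "0 < n"
    and close: "\<And>k. k \<le> n \<Longrightarrow> \<bar>(\<integral>x. hat \<eta> k x \<partial>\<mu>) - (\<integral>x. hat \<eta> k x \<partial>\<nu>)\<bar> \<le> d"
  shows "measure \<mu> A \<le> measure \<nu> (thickening e A) + (real (Suc n) * d + m / (real n * \<eta>))"
proof -
  interpret M: prob_space \<mu> using M1_D[OF \<mu>] by simp
  interpret N: prob_space \<nu> using M1_D[OF \<nu>] by simp
  define S where "S = {k. k \<le> n \<and> (\<exists>a\<in>A. 0 < hat \<eta> k a)}"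
  define K where "K = real n * \<eta>"
  have K: "0 < K" using n e by (simp add: K_def)
  have Sfin: "finite S" and Sn: "S \<subseteq> {..n}" by (auto simp: S_def)
  have hi: "integrable \<rho> (hat \<eta> k)" if "\<rho> \<in> M1" for \<rho> k
  proof -
    obtain B where "bounded_test B (hat \<eta> k)" using bounded_test_Cb[OF hat_Cb[OF e(1)]] by blast
    then show ?thesis using bounded_test_integrable(1) that by blast
  qed
  have A': "A \<in> sets \<mu>" "A \<subseteq> {0..}" using A M1_D[OF \<mu>] sets.sets_into_space[OF A] by auto
  have T: "thickening e A \<in> sets \<nu>" using thickening_sets M1_D[OF \<nu>] by simp
  have d0: "0 \<le> d" using close[of 0] by linarith
  have lower: "indicator A x \<le> (\<Sum>k\<in>S. hat \<eta> k x) + x / K" if x: "0 \<le> x" for x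
  proof (cases "x \<in> A")
    case True
    show ?thesis
    proof (cases "x \<le> K")
      case le: True
      then have "ramp \<eta> (Suc n) x = 0" using e by (simp add: ramp_def K_def field_simps)
      then have "1 = (\<Sum>k\<le>n. hat \<eta> k x)" using sum_hat[OF x e(1), of n] by simp
      also have "\<dots> = (\<Sum>k\<in>S. hat \<eta> k x)"
        by (rule sum.mono_neutral_right) (use True hat_nonneg[of \<eta> _ x] in \<open>auto simp: S_def intro: antisym not_less[THEN iffD1]\<close>)
      finally show ?thesis using True x K by simp
    next
      case False
      then have "1 \<le> x / K" using K by simp
      moreover have "0 \<le> (\<Sum>k\<in>S. hat \<eta> k x)" by (intro sum_nonneg hat_nonneg)
      ultimately show ?thesis using True by simp
    qed
  qed (use x K in \<open>auto intro!: add_nonneg_nonneg sum_nonneg hat_nonneg\<close>)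
  have upper: "(\<Sum>k\<in>S. hat \<eta> k x) \<le> indicator (thickening e A) x" if x: "0 \<le> x" for x
  proof (cases "x \<in> thickening e A")
    case True
    have "(\<Sum>k\<in>S. hat \<eta> k x) \<le> (\<Sum>k\<le>n. hat \<eta> k x)"
      by (rule sum_mono2) (use Sn hat_nonneg in auto)
    also have "\<dots> \<le> 1" using sum_hat[OF x e(1), of n] by (simp add: ramp_def)
    finally show ?thesis using True by simp
  next
    case False
    have "hat \<eta> k x = 0" if k: "k \<in> S" for k
    proof (rule ccontr)
      assume "hat \<eta> k x \<noteq> 0"
      then have "\<bar>x - real k * \<eta>\<bar> < \<eta>" using hat_support[OF e(1), of k x] hat_nonneg[of \<eta> k x] by simp
      moreover obtain a where a: "a \<in> A" "\<bar>a - real k * \<eta>\<bar> < \<eta>"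
        using k hat_support[OF e(1)] by (auto simp: S_def)
      ultimately have "dist x a < e" using e by (simp add: dist_real_def)
      with a x False show False by (auto simp: thickening_def)
    qed
    then show ?thesis by (simp add: indicator_def)
  qed
  note mi = mean_leD[OF \<mu> m]
  have "measure \<mu> A = (\<integral>x. indicator A x \<partial>\<mu>)" using A' by simp
  also have "\<dots> \<le> (\<integral>x. (\<Sum>k\<in>S. hat \<eta> k x) + x / K \<partial>\<mu>)"
    by (rule integral_mono) (use A' lower hi[OF \<mu>] mi in \<open>auto simp: M1_D[OF \<mu>] less_top[symmetric]\<close>)
  also have "\<dots> = (\<Sum>k\<in>S. \<integral>x. hat \<eta> k x \<partial>\<mu>) + (\<integral>x. x \<partial>\<mu>) / K"
    using hi[OF \<mu>] mi by simp
  also have "\<dots> \<le> (\<Sum>k\<in>S. (\<integral>x. hat \<eta> k x \<partial>\<nu>) + d) + m / K"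
  proof (intro add_mono sum_mono divide_right_mono mi)
    show "(\<integral>x. hat \<eta> k x \<partial>\<mu>) \<le> (\<integral>x. hat \<eta> k x \<partial>\<nu>) + d" if "k \<in> S" for k
      using close[of k] that Sn by auto
  qed (use K in auto)
  also have "\<dots> = (\<integral>x. (\<Sum>k\<in>S. hat \<eta> k x) \<partial>\<nu>) + real (card S) * d + m / K"
    using hi[OF \<nu>] by (simp add: sum.distrib)
  also have "\<dots> \<le> (\<integral>x. indicator (thickening e A) x \<partial>\<nu>) + real (Suc n) * d + m / K"
  proof (intro add_mono mult_right_mono d0 order.refl)
    show "(\<integral>x. (\<Sum>k\<in>S. hat \<eta> k x) \<partial>\<nu>) \<le> (\<integral>x. indicator (thickening e A) x \<partial>\<nu>)"
      by (rule integral_mono) (use T upper hi[OF \<nu>] in \<open>auto simp: M1_D[OF \<nu>] less_top[symmetric]\<close>)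
    have "card S \<le> card {..n}" by (rule card_mono) (use Sn in auto)
    then show "real (card S) \<le> real (Suc n)" by simp
  qed
  finally show ?thesis using T by (simp add: K_def)
qed

lemma laplace_close_prokhorov:
  assumes m: "0 \<le> m" and e: "0 < e"
  obtains D \<delta> where "0 < \<delta>" "0 \<le> D"
    "\<And>\<mu> \<nu>. \<mu> \<in> M1 \<Longrightarrow> \<nu> \<in> M1 \<Longrightarrow> mean_le m \<mu> \<Longrightarrow> mean_le m \<nu> \<Longrightarrow> laplace_close D \<delta> \<mu> \<nu> \<Longrightarrow>
       prokhorov \<mu> \<nu> \<le> e"
proof -
  \<comment> \<open>Half of \<open>e\<close> pays for the \<open>n + 1\<close> hats, the other half for the mass beyond \<open>n \<eta>\<close>.\<close>
  define \<eta> where "\<eta> = e / 2"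
  have \<eta>: "0 < \<eta>" "2 * \<eta> \<le> e" using e by (auto simp: \<eta>_def)
  define n where "n = Suc (nat \<lceil>2 * m / (e * \<eta>)\<rceil>)"
  define d where "d = e / (2 * real (Suc n))"
  have n: "0 < n" "2 * m / (e * \<eta>) \<le> real n" unfolding n_def by linarith+
  have small: "real (Suc n) * d + m / (real n * \<eta>) \<le> e"
  proof -
    have "m / (real n * \<eta>) \<le> e / 2"
      using n(1) n(2) \<eta>(1) e by (simp add: field_simps)
    moreover have "real (Suc n) * d = e / 2" unfolding d_def by (simp only: times_divide_eq_right) (simp add: divide_simps)
    ultimately show ?thesis by linarith
  qed
  have d: "0 < d" using e by (simp add: d_def)
  obtain D \<delta> where D: "0 < \<delta>" "0 \<le> D"
    "\<And>\<mu> \<nu> k. \<mu> \<in> M1 \<Longrightarrow> \<nu> \<in> M1 \<Longrightarrow> mean_le m \<mu> \<Longrightarrow> mean_le m \<nu> \<Longrightarrow> laplace_close D \<delta> \<mu> \<nu> \<Longrightarrow> k \<le> n \<Longrightarrow>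
       \<bar>(\<integral>x. hat \<eta> k x \<partial>\<mu>) - (\<integral>x. hat \<eta> k x \<partial>\<nu>)\<bar> \<le> d"
    by (rule laplace_close_integral_family[where g = "hat \<eta>" and n = n, OF hat_Cb[OF \<eta>(1)] m d]) auto
  show ?thesis
  proof (rule that[OF D(1,2)])
    fix \<mu> \<nu> assume h: "\<mu> \<in> M1" "\<nu> \<in> M1" "mean_le m \<mu>" "mean_le m \<nu>" "laplace_close D \<delta> \<mu> \<nu>"
    show "prokhorov \<mu> \<nu> \<le> e"
    proof (rule prokhorov_leI[OF e])
      fix A assume A: "A \<in> sets Rplus"
      show "measure \<mu> A \<le> measure \<nu> (thickening e A) + e"
        using measure_le_thickening[OF h(1,2,3) \<eta> A n(1) D(3)[OF h]] small by linarith
      show "measure \<nu> A \<le> measure \<mu> (thickening e A) + e"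
        using measure_le_thickening[OF h(2,1,4) \<eta> A n(1), of d] D(3)[OF h] small by (force simp: abs_minus_commute)
    qed
  qed
qed

section \<open>One exchange among finitely many agents\<close>

definition agent_pairs :: "nat \<Rightarrow> (nat \<times> nat) set" where
  "agent_pairs N = {(i, j). i < N \<and> j < N \<and> i \<noteq> j}"

lemma finite_agent_pairs [simp]: "finite (agent_pairs N)"
  by (rule finite_subset[of _ "{..<N} \<times> {..<N}"]) (auto simp: agent_pairs_def)

text \<open>Sums over ordered pairs of distinct agents are double sums minus the diagonal, which is the
  correction term in \<open>pair_integral\<close>.\<close>

lemma sum_agent_pairs:
  fixes f :: "nat \<Rightarrow> nat \<Rightarrow> 'a::ab_group_add"
  shows "(\<Sum>(i, j)\<in>agent_pairs N. f i j) = (\<Sum>i<N. \<Sum>j<N. f i j) - (\<Sum>i<N. f i i)"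
proof -
  let ?D = "(\<lambda>i. (i, i)) ` {..<N}"
  have split: "{..<N} \<times> {..<N} = agent_pairs N \<union> ?D" and disj: "agent_pairs N \<inter> ?D = {}"
    by (auto simp: agent_pairs_def)
  have "sum (case_prod f) (agent_pairs N \<union> ?D) = sum (case_prod f) (agent_pairs N) + sum (case_prod f) ?D"
    by (rule sum.union_disjoint) (use disj in auto)
  moreover have "sum (case_prod f) ?D = (\<Sum>i<N. f i i)"
    by (subst sum.reindex) (auto simp: inj_on_def)
  moreover have "(\<Sum>i<N. \<Sum>j<N. f i j) = sum (case_prod f) ({..<N} \<times> {..<N})"
    by (rule sum.cartesian_product)
  ultimately show ?thesis unfolding split by (simp add: algebra_simps)
qed

lemma card_agent_pairs: "card (agent_pairs N) = N * (N - 1)"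
proof -
  have "int (card (agent_pairs N)) = (\<Sum>(i, j)\<in>agent_pairs N. 1)" by (simp add: case_prod_unfold)
  also have "\<dots> = int N * int N - int N"
    unfolding sum_agent_pairs by simp
  also have "\<dots> = int (N * (N - 1))" by (cases N) (simp_all add: algebra_simps)
  finally show ?thesis by (simp only: of_nat_eq_iff)
qed

lemma space_wealth:
  "x \<in> space (wealth_space N w) \<longleftrightarrow> x \<in> extensional {..<N} \<and> (\<forall>i<N. 0 \<le> x i) \<and> (\<Sum>i<N. x i) = w"
  by (auto simp: wealth_space_def space_restrict_space space_PiM PiE_def)

lemma measurable_wealth_component [measurable]:
  "i < N \<Longrightarrow> (\<lambda>x. x i) \<in> borel_measurable (wealth_space N w)"
  unfolding wealth_space_def by (rule measurable_restrict_space1) simp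

lemma sum_exchange:
  fixes f :: "real \<Rightarrow> real"
  assumes "i < N" "j < N" "i \<noteq> j"
  shows "(\<Sum>k<N. f (exchange i j r x k)) = (\<Sum>k<N. f (x k)) + exchange_gain f r (x i) (x j)"
proof -
  have split: "(\<Sum>k<N. h k) = h i + (h j + (\<Sum>k\<in>{..<N} - {i} - {j}. h k))" for h :: "nat \<Rightarrow> real"
    using assms by (simp add: sum.remove[of "{..<N}" i] sum.remove[of "{..<N} - {i}" j])
  have "(\<Sum>k\<in>{..<N} - {i} - {j}. f (exchange i j r x k)) = (\<Sum>k\<in>{..<N} - {i} - {j}. f (x k))"
    by (rule sum.cong) (auto simp: exchange_def)
  then show ?thesis
    unfolding split[of "\<lambda>k. f (exchange i j r x k)"] split[of "\<lambda>k. f (x k)"]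
    using assms(3) by (simp add: exchange_def exchange_gain_def)
qed

lemma exchange_in_space:
  assumes "(i, j) \<in> agent_pairs N" "r \<in> {0..1}" "x \<in> space (wealth_space N w)"
  shows "exchange i j r x \<in> space (wealth_space N w)"
proof -
  have ij: "i < N" "j < N" "i \<noteq> j" using assms by (auto simp: agent_pairs_def)
  have "(\<Sum>k<N. exchange i j r x k) = (\<Sum>k<N. x k)"
    using sum_exchange[OF ij, of "\<lambda>x. x" r x] by (simp add: exchange_gain_def algebra_simps)
  with assms ij show ?thesis
    unfolding space_wealth by (auto simp: exchange_def extensional_def)
qed

lemma measurable_exchange:
  assumes p: "(i, j) \<in> agent_pairs N"
  shows "(\<lambda>(r, x). exchange i j r x) \<in> measurable (unit_law \<Otimes>\<^sub>M wealth_space N w) (wealth_space N w)"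
proof -
  have ij: "i < N" "j < N" using p by (auto simp: agent_pairs_def)
  let ?M = "unit_law \<Otimes>\<^sub>M wealth_space N w"
  let ?f = "\<lambda>z. exchange i j (fst z) (snd z)"
  have sp: "?f z \<in> space (wealth_space N w)" if "z \<in> space ?M" for z
    using that by (intro exchange_in_space[OF p]) (auto simp: space_pair_measure)
  have c: "(\<lambda>z. snd z l) \<in> borel_measurable ?M" if "l < N" for l
    by (rule measurable_compose[OF measurable_snd measurable_wealth_component[OF that]])
  have f: "(\<lambda>z. fst z) \<in> borel_measurable ?M"
    using measurable_compose[OF measurable_fst id_unit_law] by simp
  have "?f \<in> measurable ?M (\<Pi>\<^sub>M i\<in>{..<N}. borel)"
  proof (rule measurable_PiM_single')
    fix k assume "k \<in> {..<N}"
    then have ck: "(\<lambda>z. snd z k) \<in> borel_measurable ?M" using c[of k] by simp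
    have s: "(\<lambda>z. snd z i + snd z j) \<in> borel_measurable ?M"
      by (rule borel_measurable_add[OF c[OF ij(1)] c[OF ij(2)]])
    consider "k = j" | "k \<noteq> j" "k = i" | "k \<noteq> j" "k \<noteq> i" by blast
    then show "(\<lambda>z. ?f z k) \<in> borel_measurable ?M"
    proof cases
      case 1
      have "(\<lambda>z. (1 - fst z) * (snd z i + snd z j)) \<in> borel_measurable ?M"
        by (intro borel_measurable_times borel_measurable_diff f s borel_measurable_const)
      then show ?thesis using 1 by (simp add: exchange_def)
    next
      case 2
      have "(\<lambda>z. fst z * (snd z i + snd z j)) \<in> borel_measurable ?M"
        by (intro borel_measurable_times f s)
      then show ?thesis using 2 by (simp add: exchange_def)
    next
      case 3
      then show ?thesis using ck by (simp add: exchange_def)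
    qed
  next
    show "?f \<in> space ?M \<rightarrow> (\<Pi>\<^sub>E i\<in>{..<N}. space borel)"
      using sp by (auto simp: space_wealth PiE_def)
  qed
  moreover have "?f \<in> space ?M \<rightarrow> {x. (\<forall>i<N. 0 \<le> x i) \<and> (\<Sum>i<N. x i) = w}"
    using sp by (auto simp: space_wealth)
  ultimately have "?f \<in> measurable ?M (wealth_space N w)"
    by (subst wealth_space_def[of N w]) (rule measurable_restrict_space2)
  then show ?thesis by (simp add: case_prod_unfold)
qed

lemma measurable_agents:
  "(\<And>i. i < N \<Longrightarrow> 0 \<le> x i) \<Longrightarrow> x \<in> measurable (uniform_count_measure {..<N}) Rplus"
  by (simp add: measurable_cong_sets[OF sets_uniform_count_measure_count_space refl])

lemma empirical_M1:
  assumes N: "0 < N" and x: "\<And>i. i < N \<Longrightarrow> 0 \<le> x i"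
  shows "empirical N x \<in> M1"
proof -
  interpret U: prob_space "uniform_count_measure {..<N}"
    by (rule prob_space_uniform_count_measure) (use N in auto)
  have "x \<in> measurable (uniform_count_measure {..<N}) Rplus"
    by (rule measurable_agents[OF x])
  then show ?thesis unfolding empirical_def M1_def by (simp add: U.prob_space_distr)
qed

lemma integral_empirical:
  fixes g :: "real \<Rightarrow> real"
  assumes x: "\<And>i. i < N \<Longrightarrow> 0 \<le> x i" and g: "g \<in> borel_measurable Rplus"
  shows "(\<integral>y. g y \<partial>empirical N x) = (\<Sum>i<N. g (x i)) / real N"
proof -
  have m: "x \<in> measurable (uniform_count_measure {..<N}) Rplus"
    by (rule measurable_agents[OF x])
  show ?thesis unfolding empirical_def
    by (subst integral_distr[OF m g]) (simp add: integral_uniform_count_measure)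
qed

lemma mean_le_empirical:
  assumes N: "0 < N" and x: "\<And>i. i < N \<Longrightarrow> 0 \<le> x i" and m: "(\<Sum>i<N. x i) / real N \<le> m"
  shows "mean_le m (empirical N x)"
proof -
  have mx: "x \<in> measurable (uniform_count_measure {..<N}) Rplus"
    by (rule measurable_agents[OF x])
  interpret U: prob_space "uniform_count_measure {..<N}"
    by (rule prob_space_uniform_count_measure) (use N in auto)
  have fin: "integrable (uniform_count_measure {..<N}) x"
    unfolding uniform_count_measure_def by (rule integrable_point_measure_finite) simp
  have "(\<integral>\<^sup>+y. ennreal y \<partial>empirical N x) = (\<integral>\<^sup>+i. ennreal (x i) \<partial>uniform_count_measure {..<N})"
    unfolding empirical_def by (rule nn_integral_distr[OF mx]) measurable
  also have "\<dots> = ennreal (\<integral>i. x i \<partial>uniform_count_measure {..<N})"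
    by (rule nn_integral_eq_integral[OF fin]) (auto intro!: AE_I2 x simp: space_uniform_count_measure)
  also have "\<dots> = ennreal ((\<Sum>i<N. x i) / real N)"
    by (simp add: integral_uniform_count_measure)
  finally have "(\<integral>\<^sup>+y. ennreal y \<partial>empirical N x) \<le> ennreal m" using m by (simp add: ennreal_leI)
  moreover have "0 \<le> m" by (rule order_trans[OF _ m]) (auto intro!: divide_nonneg_nonneg sum_nonneg x)
  ultimately show ?thesis by (simp add: mean_le_def)
qed

lemma measurable_share:
  assumes s: "0 \<le> s" and g: "g \<in> borel_measurable Rplus"
  shows "(\<lambda>r. g (r * s)) \<in> borel_measurable unit_law"
    "(\<lambda>r. g ((1 - r) * s)) \<in> borel_measurable unit_law"
proof -
  have "(\<lambda>r. r * s) \<in> measurable unit_law Rplus" "(\<lambda>r. (1 - r) * s) \<in> measurable unit_law Rplus"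
    by (rule measurable_into_Rplus; use s in simp)+
  from this[THEN measurable_compose, OF g]
  show "(\<lambda>r. g (r * s)) \<in> borel_measurable unit_law"
    "(\<lambda>r. g ((1 - r) * s)) \<in> borel_measurable unit_law" .
qed

lemma exchange_gain_bound:
  assumes g: "bounded_test B g" and "r \<in> {0..1}" "0 \<le> x" "0 \<le> y"
  shows "\<bar>exchange_gain g r x y\<bar> \<le> 4 * B"
proof -
  have b: "\<bar>g z\<bar> \<le> B" if "0 \<le> z" for z using g that by (simp add: bounded_test_def)
  have "\<bar>g (r * (x + y))\<bar> \<le> B" "\<bar>g ((1 - r) * (x + y))\<bar> \<le> B" "\<bar>g x\<bar> \<le> B" "\<bar>g y\<bar> \<le> B"
    using assms by (auto intro!: b)
  then show ?thesis unfolding exchange_gain_def by linarith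
qed

lemma exchange_gain_integrable:
  assumes g: "bounded_test B g" and "0 \<le> x" "0 \<le> y"
  shows "integrable unit_law (\<lambda>r. exchange_gain g r x y)"
proof -
  interpret prob_space unit_law by (rule prob_space_unit_law)
  have gm: "g \<in> borel_measurable Rplus" using g by (simp add: bounded_test_def)
  show ?thesis
  proof (rule integrable_const_bound[of _ "4 * B"])
    show "(\<lambda>r. exchange_gain g r x y) \<in> borel_measurable unit_law"
      unfolding exchange_gain_def
      using measurable_share[of "x + y" g] gm assms
      by (intro borel_measurable_add borel_measurable_diff) auto
    show "AE r in unit_law. norm (exchange_gain g r x y) \<le> 4 * B"
      using exchange_gain_bound[OF g] assms by (intro AE_I2) auto
  qed
qed

lemma exchange_gain_measurable:
  assumes g: "g \<in> borel_measurable Rplus" and "r \<in> {0..1}" "0 \<le> y"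
  shows "(\<lambda>x. exchange_gain g r x y) \<in> borel_measurable Rplus"
    "(\<lambda>x. exchange_gain g r x x) \<in> borel_measurable Rplus"
proof -
  have "(\<lambda>x. g (a * (x + y))) \<in> borel_measurable Rplus" "(\<lambda>x. g (a * (x + x))) \<in> borel_measurable Rplus" if "0 \<le> a" for a
    using that assms by (auto intro!: measurable_compose[OF _ g] measurable_into_Rplus)
  then show "(\<lambda>x. exchange_gain g r x y) \<in> borel_measurable Rplus"
    "(\<lambda>x. exchange_gain g r x x) \<in> borel_measurable Rplus"
    using assms unfolding exchange_gain_def by auto
qed

lemma wealth_pair_le:
  assumes x: "x \<in> space (wealth_space N w)" and p: "i < N" "j < N" "i \<noteq> j"
  shows "x i + x j \<le> w"
proof -
  have "x i + x j = (\<Sum>k\<in>{i, j}. x k)" using p by simp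
  also have "\<dots> \<le> (\<Sum>k<N. x k)" by (rule sum_mono2) (use x p in \<open>auto simp: space_wealth\<close>)
  finally show ?thesis using x by (simp add: space_wealth)
qed

text \<open>Two distinct agents never own more than \<open>w\<close> together, so the indicator equals 1 off the diagonal;
  the diagonal, where it may be 0, cancels.\<close>

lemma QN_empirical:
  assumes x: "x \<in> space (wealth_space N w)" and g: "bounded_test B g" and N: "0 < N"
  shows "QN N w (empirical N x) g
    = (\<Sum>(i, j)\<in>agent_pairs N. \<integral>r. exchange_gain g r (x i) (x j) \<partial>unit_law) / (real N)\<^sup>2"
proof -
  have x0: "0 \<le> x i" if "i < N" for i using x that by (simp add: space_wealth)
  have gm: "g \<in> borel_measurable Rplus" using g by (simp add: bounded_test_def)
  have "pair_integral N (empirical N x) (\<lambda>x y. exchange_gain g r x y * (if x + y \<le> w then 1 else 0))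
     = (\<Sum>(i, j)\<in>agent_pairs N. exchange_gain g r (x i) (x j)) / (real N)\<^sup>2" if r: "r \<in> {0..1}" for r
  proof -
    define F where "F = (\<lambda>x y. exchange_gain g r x y * (if x + y \<le> w then 1 else 0))"
    have m1: "(\<lambda>x. F x y) \<in> borel_measurable Rplus" if "0 \<le> y" for y
      unfolding F_def using exchange_gain_measurable(1)[OF gm r that]
      by (auto intro!: borel_measurable_times measurable_from_Rplus)
    have m2: "(\<lambda>x. F x x) \<in> borel_measurable Rplus"
      unfolding F_def using exchange_gain_measurable(2)[OF gm r, of 0]
      by (auto intro!: borel_measurable_times measurable_from_Rplus)
    have i1: "(\<integral>x'. F x' y \<partial>empirical N x) = (\<Sum>i<N. F (x i) y) / real N" if "0 \<le> y" for y
      by (rule integral_empirical[OF x0 m1[OF that]])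
    have sp: "space (empirical N x) = {0..}" by (simp add: empirical_def)
    have "(\<integral>y. \<integral>x'. F x' y \<partial>empirical N x \<partial>empirical N x) = (\<integral>y. (\<Sum>i<N. F (x i) y) / real N \<partial>empirical N x)"
      by (rule Bochner_Integration.integral_cong) (auto simp: sp i1)
    also have "\<dots> = (\<Sum>j<N. (\<Sum>i<N. F (x i) (x j)) / real N) / real N"
    proof (rule integral_empirical[OF x0])
      have "(\<lambda>y. F a y) \<in> borel_measurable Rplus" if "0 \<le> a" for a
      proof -
        have "(\<lambda>y. F a y) = (\<lambda>y. exchange_gain g r y a * (if y + a \<le> w then 1 else 0))"
          by (auto simp: F_def exchange_gain_def add.commute)
        then show ?thesis using exchange_gain_measurable(1)[OF gm r that]
          by (auto intro!: borel_measurable_times measurable_from_Rplus)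
      qed
      then show "(\<lambda>y. (\<Sum>i<N. F (x i) y) / real N) \<in> borel_measurable Rplus"
        using x0 by (intro borel_measurable_divide borel_measurable_sum) auto
    qed
    finally have "pair_integral N (empirical N x) F
      = (\<Sum>j<N. (\<Sum>i<N. F (x i) (x j)) / real N) / real N - 1 / real N * ((\<Sum>i<N. F (x i) (x i)) / real N)"
      using integral_empirical[OF x0 m2] by (simp add: pair_integral_def)
    also have "\<dots> = ((\<Sum>i<N. \<Sum>j<N. F (x i) (x j)) - (\<Sum>i<N. F (x i) (x i))) / (real N)\<^sup>2"
      by (subst sum.swap) (simp add: sum_divide_distrib[symmetric] power2_eq_square diff_divide_distrib)
    also have "(\<Sum>i<N. \<Sum>j<N. F (x i) (x j)) - (\<Sum>i<N. F (x i) (x i)) = (\<Sum>(i, j)\<in>agent_pairs N. F (x i) (x j))"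
      by (rule sum_agent_pairs[symmetric])
    also have "\<dots> = (\<Sum>(i, j)\<in>agent_pairs N. exchange_gain g r (x i) (x j))"
      by (rule sum.cong) (use wealth_pair_le[OF x] in \<open>auto simp: agent_pairs_def F_def\<close>)
    finally show ?thesis by (simp add: F_def)
  qed
  then have "QN N w (empirical N x) g = (\<integral>r. (\<Sum>(i, j)\<in>agent_pairs N. exchange_gain g r (x i) (x j)) / (real N)\<^sup>2 \<partial>unit_law)"
    unfolding QN_def integral_unit_law[symmetric] by (intro Bochner_Integration.integral_cong) auto
  also have "\<dots> = (\<Sum>(i, j)\<in>agent_pairs N. \<integral>r. exchange_gain g r (x i) (x j) \<partial>unit_law) / (real N)\<^sup>2"
    using exchange_gain_integrable[OF g x0 x0]
    by (simp add: case_prod_beta', subst Bochner_Integration.integral_sum) (auto simp: agent_pairs_def)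
  finally show ?thesis .
qed

text \<open>The two operators differ in the diagonal terms only, of which there are \<open>N\<close> with weight \<open>1 / N\<^sup>2\<close>.\<close>

lemma QN_close_Q:
  assumes x: "x \<in> space (wealth_space N w)" and g: "bounded_test B g" and N: "0 < N"
  shows "\<bar>QN N w (empirical N x) g - Q \<infinity> (empirical N x) g\<bar> \<le> 4 * B / real N"
proof -
  interpret U: prob_space unit_law by (rule prob_space_unit_law)
  have x0: "0 \<le> x i" if "i < N" for i using x that by (simp add: space_wealth)
  have gm: "g \<in> borel_measurable Rplus" using g by (simp add: bounded_test_def)
  define I where "I i j = (\<integral>r. exchange_gain g r (x i) (x j) \<partial>unit_law)" for i j
  have Ib: "\<bar>I i i\<bar> \<le> 4 * B" if "i < N" for i
  proof -
    have "\<bar>I i i\<bar> \<le> (\<integral>r. \<bar>exchange_gain g r (x i) (x i)\<bar> \<partial>unit_law)" unfolding I_def by (rule integral_abs_bound)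
    also have "\<dots> \<le> (\<integral>r. 4 * B \<partial>unit_law)"
      using exchange_gain_bound[OF g _ x0[OF that] x0[OF that]] exchange_gain_integrable[OF g x0[OF that] x0[OF that]]
      by (intro integral_mono) auto
    finally show ?thesis by (simp add: U.prob_space[simplified])
  qed
  have "(\<integral>y. \<integral>x'. exchange_gain g r x' y * (if ereal (x' + y) \<le> \<infinity> then 1 else 0) \<partial>empirical N x \<partial>empirical N x)
     = (\<Sum>i<N. \<Sum>j<N. exchange_gain g r (x i) (x j)) / (real N)\<^sup>2" if r: "r \<in> {0..1}" for r
  proof -
    have sp: "space (empirical N x) = {0..}" by (simp add: empirical_def)
    have "(\<integral>y. \<integral>x'. exchange_gain g r x' y \<partial>empirical N x \<partial>empirical N x) = (\<integral>y. (\<Sum>i<N. exchange_gain g r (x i) y) / real N \<partial>empirical N x)"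
      by (rule Bochner_Integration.integral_cong) (auto simp: sp integral_empirical[OF x0 exchange_gain_measurable(1)[OF gm r]])
    also have "\<dots> = (\<Sum>j<N. (\<Sum>i<N. exchange_gain g r (x i) (x j)) / real N) / real N"
    proof (rule integral_empirical[OF x0])
      have "(\<lambda>y. exchange_gain g r a y) \<in> borel_measurable Rplus" if "0 \<le> a" for a
        using exchange_gain_measurable(1)[OF gm r that]
        by (simp add: exchange_gain_def add.commute diff_diff_eq)
      then show "(\<lambda>y. (\<Sum>i<N. exchange_gain g r (x i) y) / real N) \<in> borel_measurable Rplus"
        using x0 by (intro borel_measurable_divide borel_measurable_sum) auto
    qed
    also have "\<dots> = (\<Sum>i<N. \<Sum>j<N. exchange_gain g r (x i) (x j)) / (real N)\<^sup>2"
      by (subst sum.swap) (simp add: sum_divide_distrib[symmetric] power2_eq_square)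
    finally show ?thesis by simp
  qed
  then have "Q \<infinity> (empirical N x) g = (\<integral>r. (\<Sum>i<N. \<Sum>j<N. exchange_gain g r (x i) (x j)) / (real N)\<^sup>2 \<partial>unit_law)"
    unfolding Q_def integral_unit_law[symmetric] by (intro Bochner_Integration.integral_cong) auto
  also have "\<dots> = (\<integral>r. (\<Sum>i<N. \<Sum>j<N. exchange_gain g r (x i) (x j)) \<partial>unit_law) / (real N)\<^sup>2"
    by simp
  also have "(\<integral>r. (\<Sum>i<N. \<Sum>j<N. exchange_gain g r (x i) (x j)) \<partial>unit_law)
      = (\<Sum>i<N. \<integral>r. (\<Sum>j<N. exchange_gain g r (x i) (x j)) \<partial>unit_law)"
    by (rule Bochner_Integration.integral_sum)
      (intro Bochner_Integration.integrable_sum exchange_gain_integrable[OF g] x0, auto)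
  also have "\<dots> = (\<Sum>i<N. \<Sum>j<N. I i j)"
    unfolding I_def
    by (intro sum.cong refl Bochner_Integration.integral_sum exchange_gain_integrable[OF g] x0) auto
  finally have Q: "Q \<infinity> (empirical N x) g = (\<Sum>i<N. \<Sum>j<N. I i j) / (real N)\<^sup>2" .
  have "QN N w (empirical N x) g = ((\<Sum>i<N. \<Sum>j<N. I i j) - (\<Sum>i<N. I i i)) / (real N)\<^sup>2"
    unfolding QN_empirical[OF x g N] I_def[symmetric] by (simp add: sum_agent_pairs)
  then have "QN N w (empirical N x) g - Q \<infinity> (empirical N x) g = - (\<Sum>i<N. I i i) / (real N)\<^sup>2"
    unfolding Q by (simp add: diff_divide_distrib)
  also have "\<bar>\<dots>\<bar> \<le> (\<Sum>i<N. \<bar>I i i\<bar>) / (real N)\<^sup>2"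
    by (simp add: divide_right_mono)
  also have "\<dots> \<le> (\<Sum>i<N. 4 * B) / (real N)\<^sup>2"
    by (intro divide_right_mono sum_mono Ib) auto
  also have "\<dots> = 4 * B / real N" using N by (simp add: power2_eq_square)
  finally show ?thesis .
qed

section \<open>The effect of one exchange on the Laplace transform\<close>

lemma laplace_empirical:
  assumes x: "x \<in> space (wealth_space N w)"
  shows "laplace (empirical N x) l = (\<Sum>i<N. exp (- l * x i)) / real N"
  unfolding laplace_def
  by (rule integral_empirical) (use x in \<open>auto simp: space_wealth intro!: measurable_from_Rplus\<close>)

lemma laplace_exchange:
  assumes x: "x \<in> space (wealth_space N w)" and p: "(i, j) \<in> agent_pairs N" and r: "r \<in> {0..1}"
  shows "laplace (empirical N (exchange i j r x)) l
       = laplace (empirical N x) l + exchange_gain (\<lambda>z. exp (- l * z)) r (x i) (x j) / real N"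
  unfolding laplace_empirical[OF x] laplace_empirical[OF exchange_in_space[OF p r x]]
  using p by (subst sum_exchange) (auto simp: agent_pairs_def add_divide_distrib)

lemma exp_gain_bound:
  assumes "0 \<le> l" "r \<in> {0..1}" "0 \<le> x" "0 \<le> y"
  shows "\<bar>exchange_gain (\<lambda>z. exp (- l * z)) r x y\<bar> \<le> 2"
proof -
  have "0 < exp (- l * z) \<and> exp (- l * z) \<le> 1" if "0 \<le> z" for z using assms that by simp
  moreover have "0 \<le> r * (x + y)" "0 \<le> (1 - r) * (x + y)" using assms by auto
  ultimately show ?thesis using assms unfolding exchange_gain_def abs_le_iff by (smt (verit))
qed

lemma laplace_exchange_close:
  assumes x: "x \<in> space (wealth_space N w)" and p: "(i, j) \<in> agent_pairs N" and r: "r \<in> {0..1}" and l: "0 \<le> l"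
  shows "\<bar>laplace (empirical N (exchange i j r x)) l - laplace (empirical N x) l\<bar> \<le> 2 / real N"
proof -
  have "0 \<le> x i" "0 \<le> x j" using x p by (auto simp: space_wealth agent_pairs_def)
  from exp_gain_bound[OF l r this] show ?thesis
    unfolding laplace_exchange[OF x p r] by (simp add: divide_right_mono)
qed

text \<open>The transition operator of the jump chain: average over the pair of agents and over \<open>r\<close>.\<close>

definition exchange_mean :: "nat \<Rightarrow> ((nat \<Rightarrow> real) \<Rightarrow> real) \<Rightarrow> (nat \<Rightarrow> real) \<Rightarrow> real" where
  "exchange_mean N F x = (\<Sum>(i, j)\<in>agent_pairs N. \<integral>r. F (exchange i j r x) \<partial>unit_law) / real (card (agent_pairs N))"

text \<open>Expand the square after one exchange: the linear term averages to the drift \<open>QN\<close> divided by the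
  total jump rate, and the quadratic term is of order \<open>1 / N\<^sup>2\<close> because a single exchange changes the
  transform by at most \<open>2 / N\<close>.\<close>

lemma exchange_mean_square:
  assumes N: "2 \<le> N" and x: "x \<in> space (wealth_space N w)" and l: "0 \<le> l"
  shows "exchange_mean N (\<lambda>y. (laplace (empirical N y) l - a)\<^sup>2) x
    \<le> (laplace (empirical N x) l - a)\<^sup>2
       + 2 * (laplace (empirical N x) l - a) * (QN N w (empirical N x) (\<lambda>z. exp (- l * z)) / real (N - 1))
       + 4 / (real N)\<^sup>2"
proof -
  interpret U: prob_space unit_law by (rule prob_space_unit_law)
  define u where "u = laplace (empirical N x) l - a"
  define G where "G r i j = exchange_gain (\<lambda>z. exp (- l * z)) r (x i) (x j)" for r i j
  have x0: "0 \<le> x i" if "i < N" for i using x that by (simp add: space_wealth)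
  note g = bounded_test_exp[OF l]
  have Gi: "integrable unit_law (\<lambda>r. G r i j)" if "(i, j) \<in> agent_pairs N" for i j
    unfolding G_def using that by (intro exchange_gain_integrable[OF g] x0) (auto simp: agent_pairs_def)
  have Gb: "\<bar>G r i j\<bar> \<le> 2" if "(i, j) \<in> agent_pairs N" "r \<in> {0..1}" for r i j
    unfolding G_def using that by (intro exp_gain_bound l x0) (auto simp: agent_pairs_def)
  have one: "(\<integral>r. (laplace (empirical N (exchange i j r x)) l - a)\<^sup>2 \<partial>unit_law)
      \<le> u\<^sup>2 + 2 * u / real N * (\<integral>r. G r i j \<partial>unit_law) + 4 / (real N)\<^sup>2" if p: "(i, j) \<in> agent_pairs N" for i j
  proof -
    have "(\<integral>r. (laplace (empirical N (exchange i j r x)) l - a)\<^sup>2 \<partial>unit_law)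
      = (\<integral>r. (u + G r i j / real N)\<^sup>2 \<partial>unit_law)"
      by (rule Bochner_Integration.integral_cong)
        (auto simp: laplace_exchange[OF x p] u_def G_def algebra_simps)
    also have "\<dots> \<le> (\<integral>r. u\<^sup>2 + 2 * u / real N * G r i j + 4 / (real N)\<^sup>2 \<partial>unit_law)"
    proof (rule integral_mono)
      show "integrable unit_law (\<lambda>r. u\<^sup>2 + 2 * u / real N * G r i j + 4 / (real N)\<^sup>2)" using Gi[OF p] by simp
      have "integrable unit_law (\<lambda>r. (G r i j)\<^sup>2)"
        by (rule U.integrable_const_bound[of _ 4])
          (use Gi[OF p] power_mono[OF Gb[OF p], of _ 2] in \<open>auto intro!: AE_I2\<close>)
      then show "integrable unit_law (\<lambda>r. (u + G r i j / real N)\<^sup>2)"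
        using Gi[OF p] by (simp add: power2_sum power_divide)
      show "(u + G r i j / real N)\<^sup>2 \<le> u\<^sup>2 + 2 * u / real N * G r i j + 4 / (real N)\<^sup>2" if "r \<in> space unit_law" for r
      proof -
        have "(G r i j)\<^sup>2 \<le> 4" using power_mono[OF Gb[OF p, of r], of 2] that by simp
        then have "(G r i j)\<^sup>2 / (real N)\<^sup>2 \<le> 4 / (real N)\<^sup>2" by (intro divide_right_mono) auto
        then show ?thesis by (simp add: power2_sum power_divide)
      qed
    qed
    also have "\<dots> = u\<^sup>2 + 2 * u / real N * (\<integral>r. G r i j \<partial>unit_law) + 4 / (real N)\<^sup>2"
      using Gi[OF p] by (simp add: U.prob_space[simplified])
    finally show ?thesis .
  qed
  have c: "real (card (agent_pairs N)) = real N * real (N - 1)" by (simp add: card_agent_pairs)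
  have cpos: "0 < real N * real (N - 1)" using N by simp
  have "(\<Sum>(i, j)\<in>agent_pairs N. \<integral>r. (laplace (empirical N (exchange i j r x)) l - a)\<^sup>2 \<partial>unit_law)
     \<le> (\<Sum>(i, j)\<in>agent_pairs N. u\<^sup>2 + 2 * u / real N * (\<integral>r. G r i j \<partial>unit_law) + 4 / (real N)\<^sup>2)"
    by (rule sum_mono) (use one in auto)
  also have "\<dots> = real N * real (N - 1) * (u\<^sup>2 + 4 / (real N)\<^sup>2)
      + 2 * u / real N * (\<Sum>(i, j)\<in>agent_pairs N. \<integral>r. G r i j \<partial>unit_law)"
  proof -
    have "(\<Sum>(i, j)\<in>agent_pairs N. d + k * J i j + e) = real (card (agent_pairs N)) * (d + e) + k * (\<Sum>(i, j)\<in>agent_pairs N. J i j)"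
      for d e k :: real and J
      by (simp add: case_prod_unfold sum.distrib sum_distrib_left algebra_simps)
    then show ?thesis unfolding c .
  qed
  also have "(\<Sum>(i, j)\<in>agent_pairs N. \<integral>r. G r i j \<partial>unit_law) = QN N w (empirical N x) (\<lambda>z. exp (- l * z)) * (real N)\<^sup>2"
    unfolding G_def QN_empirical[OF x g, of, simplified] using N by (subst QN_empirical[OF x g]) auto
  finally have "exchange_mean N (\<lambda>y. (laplace (empirical N y) l - a)\<^sup>2) x
     \<le> (real N * real (N - 1) * (u\<^sup>2 + 4 / (real N)\<^sup>2)
      + 2 * u / real N * (QN N w (empirical N x) (\<lambda>z. exp (- l * z)) * (real N)\<^sup>2)) / (real N * real (N - 1))"
    unfolding exchange_mean_def c using cpos by (intro divide_right_mono) auto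
  also have "\<dots> = u\<^sup>2 + 2 * u * (QN N w (empirical N x) (\<lambda>z. exp (- l * z)) / real (N - 1)) + 4 / (real N)\<^sup>2"
  proof -
    have "(n * k * (u\<^sup>2 + 4 / n\<^sup>2) + 2 * u / n * (q * n\<^sup>2)) / (n * k) = u\<^sup>2 + 2 * u * (q / k) + 4 / n\<^sup>2"
      if "0 < n" "0 < k" for n k q :: real
      using that by (simp add: field_simps power2_eq_square)
    then show ?thesis using N by simp
  qed
  finally show ?thesis unfolding u_def .
qed

text \<open>Exponentials turn the law of a sum into a product; this is what closes the equation.\<close>

lemma laplace_collide:
  assumes \<mu>: "\<mu> \<in> M1" and l: "0 \<le> l"
  shows "(\<integral>z. exp (- l * z) \<partial>collide \<mu> \<mu>) = (\<integral>r. (laplace \<mu> (r * l))\<^sup>2 \<partial>unit_law)"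
    and "integrable unit_law (\<lambda>r. (laplace \<mu> (r * l))\<^sup>2)"
proof -
  have *: "(\<integral>y. \<integral>x. exp (- l * (r * (x + y))) \<partial>\<mu> \<partial>\<mu>) = (laplace \<mu> (r * l))\<^sup>2" for r
  proof -
    have "exp (- l * (r * (x + y))) = exp (- (r * l) * y) * exp (- (r * l) * x)" for x y
      by (simp add: exp_add[symmetric] algebra_simps)
    then show ?thesis by (simp add: laplace_def power2_eq_square)
  qed
  show "(\<integral>z. exp (- l * z) \<partial>collide \<mu> \<mu>) = (\<integral>r. (laplace \<mu> (r * l))\<^sup>2 \<partial>unit_law)"
    unfolding integral_collide[OF \<mu> \<mu> bounded_test_exp[OF l]] * ..
  show "integrable unit_law (\<lambda>r. (laplace \<mu> (r * l))\<^sup>2)"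
    using integrable_collide[OF \<mu> \<mu> bounded_test_exp[OF l]] unfolding * .
qed

lemma laplace_measurable:
  assumes \<mu>: "\<mu> \<in> M1" shows "laplace \<mu> \<in> borel_measurable borel"
proof -
  interpret prob_space \<mu> using M1_D[OF \<mu>] by simp
  note [measurable_cong] = M1_D(2)[OF \<mu>]
  show ?thesis unfolding laplace_def[abs_def] by measurable
qed

text \<open>The loss terms contribute \<open>- 4 u\<^sup>2\<close>, where \<open>u\<close> is the difference of the transforms at \<open>l\<close>, and are
  dropped; the gain terms are differences of squares of numbers in \<open>[0, 1]\<close>, split by
  \<open>2 a b \<le> a\<^sup>2 + b\<^sup>2\<close>.\<close>

lemma Q_laplace_difference:
  assumes \<mu>: "\<mu> \<in> M1" and \<nu>: "\<nu> \<in> M1" and l: "0 \<le> l"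
  shows "2 * (laplace \<mu> l - laplace \<nu> l) * (Q \<infinity> \<mu> (\<lambda>z. exp (- l * z)) - Q \<infinity> \<nu> (\<lambda>z. exp (- l * z)))
     \<le> 4 * (laplace \<mu> l - laplace \<nu> l)\<^sup>2 + 4 * (\<integral>r. (laplace \<mu> (r * l) - laplace \<nu> (r * l))\<^sup>2 \<partial>unit_law)"
proof -
  interpret U: prob_space unit_law by (rule prob_space_unit_law)
  let ?u = "laplace \<mu> l - laplace \<nu> l"
  let ?D = "\<lambda>r. laplace \<mu> (r * l) - laplace \<nu> (r * l)"
  note g = bounded_test_exp[OF l]
  have m: "(\<lambda>r. laplace \<rho> (r * l)) \<in> borel_measurable unit_law" if "\<rho> \<in> M1" for \<rho>
    by (rule measurable_unit_law, rule measurable_compose[OF _ laplace_measurable[OF that]]) simp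
  have b: "0 \<le> laplace \<rho> (r * l)" "laplace \<rho> (r * l) \<le> 1" if "\<rho> \<in> M1" "r \<in> {0..1}" for \<rho> r
    using laplace_bounds[OF that(1), of "r * l"] that l by auto
  have D2: "integrable unit_law (\<lambda>r. (?D r)\<^sup>2)"
  proof (rule U.integrable_const_bound[of _ 1])
    have "\<bar>?D r\<bar> \<le> 1" if "r \<in> {0..1}" for r using b[OF \<mu> that] b[OF \<nu> that] by linarith
    then show "AE r in unit_law. norm ((?D r)\<^sup>2) \<le> 1" by (intro AE_I2) (simp add: abs_square_le_1)
  qed (use m[OF \<mu>] m[OF \<nu>] in auto)
  have "2 * ?u * (2 * (\<integral>r. (laplace \<mu> (r * l))\<^sup>2 - (laplace \<nu> (r * l))\<^sup>2 \<partial>unit_law))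
     = (\<integral>r. 4 * ?u * ((laplace \<mu> (r * l))\<^sup>2 - (laplace \<nu> (r * l))\<^sup>2) \<partial>unit_law)" by simp
  also have "\<dots> \<le> (\<integral>r. 4 * ?u\<^sup>2 + 4 * (?D r)\<^sup>2 \<partial>unit_law)"
  proof (rule integral_mono)
    fix r assume "r \<in> space unit_law" then have r: "r \<in> {0..1}" by simp
    let ?s = "laplace \<mu> (r * l) + laplace \<nu> (r * l)"
    have s: "0 \<le> ?s" "?s \<le> 2" using b[OF \<mu> r] b[OF \<nu> r] by auto
    have "4 * ?u * ((laplace \<mu> (r * l))\<^sup>2 - (laplace \<nu> (r * l))\<^sup>2) = 4 * (?u * ?D r) * ?s"
      by (simp add: power2_eq_square algebra_simps)
    also have "\<dots> \<le> 4 * \<bar>?u * ?D r\<bar> * ?s" using s by (intro mult_right_mono mult_left_mono) auto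
    also have "\<dots> \<le> 4 * \<bar>?u * ?D r\<bar> * 2" using s by (intro mult_left_mono) auto
    also have "\<dots> = 8 * (\<bar>?u\<bar> * \<bar>?D r\<bar>)" by (simp add: abs_mult)
    also have "\<dots> \<le> 4 * ?u\<^sup>2 + 4 * (?D r)\<^sup>2"
      using sum_squares_bound[of "\<bar>?u\<bar>" "\<bar>?D r\<bar>"] by simp
    finally show "4 * ?u * ((laplace \<mu> (r * l))\<^sup>2 - (laplace \<nu> (r * l))\<^sup>2) \<le> 4 * ?u\<^sup>2 + 4 * (?D r)\<^sup>2" .
  qed (use D2 laplace_collide(2)[OF \<mu> l] laplace_collide(2)[OF \<nu> l] in auto)
  also have "\<dots> = 4 * ?u\<^sup>2 + 4 * (\<integral>r. (?D r)\<^sup>2 \<partial>unit_law)"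
    using D2 by (simp add: U.prob_space[simplified])
  finally have main: "2 * ?u * (2 * (\<integral>r. (laplace \<mu> (r * l))\<^sup>2 - (laplace \<nu> (r * l))\<^sup>2 \<partial>unit_law))
    \<le> 4 * ?u\<^sup>2 + 4 * (\<integral>r. (?D r)\<^sup>2 \<partial>unit_law)" .
  have Qd: "Q \<infinity> \<mu> (\<lambda>z. exp (- l * z)) - Q \<infinity> \<nu> (\<lambda>z. exp (- l * z))
     = 2 * (\<integral>r. (laplace \<mu> (r * l))\<^sup>2 - (laplace \<nu> (r * l))\<^sup>2 \<partial>unit_law) - 2 * ?u"
    unfolding Q_infinity[OF \<mu> g] Q_infinity[OF \<nu> g] laplace_collide(1)[OF \<mu> l] laplace_collide(1)[OF \<nu> l]
    using laplace_collide(2)[OF \<mu> l] laplace_collide(2)[OF \<nu> l] by (simp add: laplace_def)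
  have "2 * ?u * (Q \<infinity> \<mu> (\<lambda>z. exp (- l * z)) - Q \<infinity> \<nu> (\<lambda>z. exp (- l * z)))
     = 2 * ?u * (2 * (\<integral>r. (laplace \<mu> (r * l))\<^sup>2 - (laplace \<nu> (r * l))\<^sup>2 \<partial>unit_law)) - 4 * ?u\<^sup>2"
  proof -
    have "2 * u * A = 2 * u * (2 * I) - 4 * u\<^sup>2" if "A = 2 * I - 2 * u" for u A I :: real
      unfolding that by (simp add: power2_eq_square algebra_simps)
    from this[OF Qd] show ?thesis .
  qed
  with main show ?thesis using zero_le_power2[of ?u] by linarith
qed

text \<open>The transform of \<open>collide \<mu> \<mu>\<close> at \<open>l\<close> averages the squares of the transform of \<open>\<mu>\<close> at \<open>r l \<le> l\<close>.\<close>

lemma laplace_close_collide: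
  assumes \<mu>: "\<mu> \<in> M1" and \<nu>: "\<nu> \<in> M1" and close: "laplace_close D \<delta> \<mu> \<nu>"
  shows "laplace_close D (2 * \<delta>) (collide \<mu> \<mu>) (collide \<nu> \<nu>)"
  unfolding laplace_close_def
proof
  interpret U: prob_space unit_law by (rule prob_space_unit_law)
  fix l assume l: "l \<in> {0..D}"
  then have l0: "0 \<le> l" by simp
  have d0: "0 \<le> \<delta>" using close l unfolding laplace_close_def by (meson abs_ge_zero order_trans)
  note L = laplace_collide[OF \<mu> l0] laplace_collide[OF \<nu> l0]
  have "\<bar>laplace (collide \<mu> \<mu>) l - laplace (collide \<nu> \<nu>) l\<bar>
     = \<bar>\<integral>r. (laplace \<mu> (r * l))\<^sup>2 - (laplace \<nu> (r * l))\<^sup>2 \<partial>unit_law\<bar>"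
    unfolding laplace_def[of "collide _ _"] L(1,3) using L(2,4) by simp
  also have "\<dots> \<le> (\<integral>r. \<bar>(laplace \<mu> (r * l))\<^sup>2 - (laplace \<nu> (r * l))\<^sup>2\<bar> \<partial>unit_law)"
    by (rule integral_abs_bound)
  also have "\<dots> \<le> (\<integral>r. 2 * \<delta> \<partial>unit_law)"
  proof (rule integral_mono)
    fix r assume "r \<in> space unit_law"
    then have r: "0 \<le> r" "r \<le> 1" by auto
    have rl: "0 \<le> r * l" "r * l \<le> D" using r l mult_right_mono[OF r(2), of l] by auto
    have "\<bar>(laplace \<mu> (r * l))\<^sup>2 - (laplace \<nu> (r * l))\<^sup>2\<bar>
      = (laplace \<mu> (r * l) + laplace \<nu> (r * l)) * \<bar>laplace \<mu> (r * l) - laplace \<nu> (r * l)\<bar>"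
      using laplace_bounds[OF \<mu> rl(1)] laplace_bounds[OF \<nu> rl(1)]
      by (simp add: power2_eq_square square_diff_square_factored abs_mult)
    also have "\<dots> \<le> 2 * \<delta>"
      using laplace_bounds[OF \<mu> rl(1)] laplace_bounds[OF \<nu> rl(1)] close rl
      by (intro mult_mono) (auto simp: laplace_close_def)
    finally show "\<bar>(laplace \<mu> (r * l))\<^sup>2 - (laplace \<nu> (r * l))\<^sup>2\<bar> \<le> 2 * \<delta>" .
  qed (use L in auto)
  finally show "\<bar>laplace (collide \<mu> \<mu>) l - laplace (collide \<nu> \<nu>) l\<bar> \<le> 2 * \<delta>"
    by (simp add: U.prob_space[simplified])
qed

lemma flow_Taylor:
  assumes \<mu>: "\<mu> \<in> M1" and g: "bounded_test B g" and s: "0 \<le> s" and h: "0 \<le> h"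
  shows "\<bar>(\<integral>x. g x \<partial>flow \<mu> (s + h)) - (\<integral>x. g x \<partial>flow \<mu> s) - h * Q \<infinity> (flow \<mu> s) g\<bar> \<le> 24 * B * h\<^sup>2"
proof -
  let ?q = "Q \<infinity> (flow \<mu> s) g"
  let ?f = "\<lambda>t. (\<integral>x. g x \<partial>flow \<mu> t) - t * ?q"
  have B: "0 \<le> B" by (rule bounded_test_nonneg[OF g])
  have "norm (?f (s + h) - ?f s) \<le> (24 * B * h) * norm ((s + h) - s)"
  proof (rule field_differentiable_bound[where S = "{s..s + h}" and f' = "\<lambda>t. Q \<infinity> (flow \<mu> t) g - ?q"])
    fix t assume t: "t \<in> {s..s + h}"
    have "((\<lambda>t. \<integral>x. g x \<partial>flow \<mu> t) has_real_derivative Q \<infinity> (flow \<mu> t) g) (at t within {s..s + h})"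
      by (rule DERIV_subset[OF has_derivative_flow[OF \<mu> g]]) (use s t in auto)
    then show "(?f has_real_derivative Q \<infinity> (flow \<mu> t) g - ?q) (at t within {s..s + h})"
      by (auto intro!: derivative_eq_intros)
    have "\<bar>Q \<infinity> (flow \<mu> t) g - ?q\<bar> \<le> 24 * B * \<bar>t - s\<bar>" by (rule Q_flow_Lipschitz[OF \<mu> g s]) (use s t in auto)
    also have "\<dots> \<le> 24 * B * h" using t B by (intro mult_left_mono) auto
    finally show "norm (Q \<infinity> (flow \<mu> t) g - ?q) \<le> 24 * B * h" by simp
  qed (use h in auto)
  then show ?thesis using h by (simp add: algebra_simps power2_eq_square)
qed

text \<open>One step of the chain against one time step \<open>h\<close> of the flow. To first order both move by \<open>h\<close>
  times their drift; all remaining terms are of order \<open>h\<^sup>2\<close>, the bias \<open>1 / N\<close> of \<open>QN\<close> included.\<close>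

lemma exchange_mean_flow_error:
  assumes N: "2 \<le> N" and x: "x \<in> space (wealth_space N w)" and l: "0 \<le> l" and \<mu>: "\<mu> \<in> M1" and s: "0 \<le> s"
    and h: "h = 1 / real (N - 1)"
  shows "exchange_mean N (\<lambda>y. (laplace (empirical N y) l - laplace (flow \<mu> (s + h)) l)\<^sup>2) x
    \<le> (1 + 4 * h) * (laplace (empirical N x) l - laplace (flow \<mu> s) l)\<^sup>2
      + 4 * h * (\<integral>r. (laplace (empirical N x) (r * l) - laplace (flow \<mu> s) (r * l))\<^sup>2 \<partial>unit_law)
      + 140 * h\<^sup>2"
proof -
  have h0: "0 < h" "1 / real N \<le> h" using N by (auto simp: h frac_le)
  let ?g = "\<lambda>z. exp (- l * z)"
  note g = bounded_test_exp[OF l] and F = flow_M1[OF \<mu>]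
  have E: "empirical N x \<in> M1" using N x by (intro empirical_M1) (auto simp: space_wealth)
  define a where "a = laplace (flow \<mu> (s + h)) l"
  define b where "b = laplace (flow \<mu> s) l"
  define q where "q = Q \<infinity> (flow \<mu> s) ?g"
  define D where "D = QN N w (empirical N x) ?g"
  define QE where "QE = Q \<infinity> (empirical N x) ?g"
  define u where "u = laplace (empirical N x) l - b"
  define I where "I = (\<integral>r. (laplace (empirical N x) (r * l) - laplace (flow \<mu> s) (r * l))\<^sup>2 \<partial>unit_law)"
  have ab: "\<bar>a - b\<bar> \<le> 4 * h"
    using flow_Lipschitz[OF \<mu> g s, of "s + h"] s h0 by (simp add: a_def b_def laplace_def)
  have T: "\<bar>a - b - h * q\<bar> \<le> 24 * h\<^sup>2"
    using flow_Taylor[OF \<mu> g s, of h] h0 by (simp add: a_def b_def laplace_def q_def)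
  have u1: "\<bar>u\<bar> \<le> 1" using laplace_bounds[OF E l] laplace_bounds[OF F l, of s] unfolding u_def b_def by linarith
  have DQ: "\<bar>D - QE\<bar> \<le> 4 * h"
    using QN_close_Q[OF x g] N h0 unfolding D_def QE_def by simp
  have QE4: "\<bar>QE\<bar> \<le> 4" using Q_infinity_bound[OF E g] by (simp add: QE_def)
  have h1: "h \<le> 1" using N by (simp add: h)
  have D8: "\<bar>D\<bar> \<le> 8" using DQ QE4 h1 by linarith
  have key: "2 * u * (QE - q) \<le> 4 * u\<^sup>2 + 4 * I"
    unfolding u_def b_def QE_def q_def I_def by (rule Q_laplace_difference[OF E F l])
  have "exchange_mean N (\<lambda>y. (laplace (empirical N y) l - a)\<^sup>2) x
    \<le> (u - (a - b))\<^sup>2 + 2 * (u - (a - b)) * (D * h) + 4 / (real N)\<^sup>2"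
    using exchange_mean_square[OF N x l, of a] unfolding u_def b_def D_def h by simp
  moreover have "4 / (real N)\<^sup>2 \<le> 4 * h\<^sup>2"
    using power_mono[OF h0(2), of 2] N by (simp add: power_divide)
  ultimately have "exchange_mean N (\<lambda>y. (laplace (empirical N y) l - a)\<^sup>2) x
    \<le> (u - (a - b))\<^sup>2 + 2 * (u - (a - b)) * (D * h) + 4 * h\<^sup>2" by linarith
  \<comment> \<open>Split off the main term \<open>u (QE - q)\<close>; the other five terms add up to \<open>(8 + 48 + 16 + 64 + 4) h\<^sup>2\<close>.\<close>
  also have "(u - (a - b))\<^sup>2 + 2 * (u - (a - b)) * (D * h) + 4 * h\<^sup>2
     = u\<^sup>2 + h * (2 * u * (QE - q)) + 2 * h * (u * (D - QE)) + 2 * (u * (h * q - (a - b)))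
        + (a - b)\<^sup>2 + 2 * h * ((b - a) * D) + 4 * h\<^sup>2"
    by (simp add: power2_eq_square algebra_simps)
  also have "\<dots> \<le> u\<^sup>2 + h * (4 * u\<^sup>2 + 4 * I) + 2 * h * (4 * h) + 2 * (24 * h\<^sup>2)
        + (4 * h)\<^sup>2 + 2 * h * (4 * h * 8) + 4 * h\<^sup>2"
  proof (intro add_mono mult_left_mono order.refl key)
    have p: "y * z \<le> A * C" if "\<bar>y\<bar> \<le> A" "\<bar>z\<bar> \<le> C" for y z A C :: real
    proof -
      have "y * z \<le> \<bar>y\<bar> * \<bar>z\<bar>" by (metis abs_ge_self abs_mult)
      also have "\<dots> \<le> A * C" using that by (intro mult_mono) auto
      finally show ?thesis .
    qed
    show "u * (D - QE) \<le> 4 * h" using p[OF u1 DQ] by simp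
    show "u * (h * q - (a - b)) \<le> 24 * h\<^sup>2"
      using p[OF u1, of "h * q - (a - b)" "24 * h\<^sup>2"] T by (simp add: abs_minus_commute)
    show "(a - b)\<^sup>2 \<le> (4 * h)\<^sup>2" using ab h0 by (intro abs_le_square_iff[THEN iffD1]) simp
    show "(b - a) * D \<le> 4 * h * 8" using p[OF _ D8, of "b - a" "4 * h"] ab by (simp add: abs_minus_commute)
  qed (use h0 in auto)
  also have "\<dots> = (1 + 4 * h) * u\<^sup>2 + 4 * h * I + 140 * h\<^sup>2"
    by (simp add: power2_eq_square algebra_simps)
  finally show ?thesis unfolding a_def u_def b_def I_def .
qed

section \<open>The law of the jump chain\<close>

lemma agent_pairs_nonempty: "2 \<le> N \<Longrightarrow> agent_pairs N \<noteq> {}"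
proof -
  assume "2 \<le> N"
  then have "(0, 1) \<in> agent_pairs N" by (simp add: agent_pairs_def)
  then show ?thesis by blast
qed

lemma exchange_mean_const: "2 \<le> N \<Longrightarrow> exchange_mean N (\<lambda>_. c) x = c"
proof -
  assume N: "2 \<le> N"
  interpret U: prob_space unit_law by (rule prob_space_unit_law)
  show ?thesis using N by (simp add: exchange_mean_def case_prod_unfold card_agent_pairs U.prob_space[simplified])
qed

lemma exchange_measurable_share:
  assumes p: "(i, j) \<in> agent_pairs N" and x: "x \<in> space (wealth_space N w)"
  shows "(\<lambda>r. exchange i j r x) \<in> measurable unit_law (wealth_space N w)"
  using measurable_compose[OF measurable_Pair2'[OF x] measurable_exchange[OF p]]
  by (simp add: case_prod_unfold measurable_Pair2')

lemma exchange_rate_eq: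
  assumes N: "2 \<le> N" and x: "x \<in> space (wealth_space N w)" and A: "A \<in> sets (wealth_space N w)"
  shows "exchange_rate N x A = real (N - 1) * exchange_mean N (indicator A) x"
proof -
  have 1: "measure lborel {r \<in> {0..1}. exchange i j r x \<in> A} = (\<integral>r. indicator A (exchange i j r x) \<partial>unit_law)"
    if p: "(i, j) \<in> agent_pairs N" for i j
  proof -
    let ?R = "{r \<in> {0..1}. exchange i j r x \<in> A}"
    have "?R = (\<lambda>r. exchange i j r x) -` A \<inter> space unit_law" by auto
    then have R: "?R \<in> sets unit_law"
      using measurable_sets[OF exchange_measurable_share[OF p x] A] by simp
    have "measure lborel ?R = measure unit_law ?R"
      unfolding unit_law_def by (rule measure_restrict_space[symmetric]) auto
    also have "\<dots> = (\<integral>r. indicator ?R r \<partial>unit_law)"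
      using sets.sets_into_space[OF R] by (simp only: Bochner_Integration.integral_indicator Int_absorb2)
    also have "\<dots> = (\<integral>r. indicator A (exchange i j r x) \<partial>unit_law)"
      by (rule Bochner_Integration.integral_cong) (auto simp: indicator_def)
    finally show ?thesis .
  qed
  have "exchange_rate N x A = (\<Sum>(i, j)\<in>agent_pairs N. 1 / real N * (\<integral>r. indicator A (exchange i j r x) \<partial>unit_law))"
    unfolding exchange_rate_def agent_pairs_def[symmetric] by (rule sum.cong) (use 1 in auto)
  also have "\<dots> = (\<Sum>(i, j)\<in>agent_pairs N. \<integral>r. indicator A (exchange i j r x) \<partial>unit_law) / real N"
    by (simp add: case_prod_unfold sum_divide_distrib)
  also have "\<dots> = real (N - 1) * exchange_mean N (indicator A) x"
    using N by (simp add: exchange_mean_def card_agent_pairs)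
  finally show ?thesis .
qed

text \<open>The total rate does not depend on the state; this decouples the jump times from the chain.\<close>

lemma exchange_rate_total:
  assumes N: "2 \<le> N" and x: "x \<in> space (wealth_space N w)"
  shows "exchange_rate N x (space (wealth_space N w)) = real (N - 1)"
proof -
  have "exchange_mean N (indicator (space (wealth_space N w))) x = exchange_mean N (\<lambda>_. 1) x"
  proof -
    have "(\<integral>r. indicator (space (wealth_space N w)) (exchange i j r x) \<partial>unit_law) = (\<integral>r. (1::real) \<partial>unit_law)"
      if "(i, j) \<in> agent_pairs N" for i j
      by (rule Bochner_Integration.integral_cong) (use exchange_in_space[OF that _ x] in auto)
    then show ?thesis unfolding exchange_mean_def
      by (intro arg_cong2[of _ _ _ _ "(/)"] sum.cong refl) auto
  qed
  then show ?thesis using exchange_rate_eq[OF N x sets.top] exchange_mean_const[OF N] by simp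
qed

lemma laplace_empirical_measurable:
  "(\<lambda>(l, x). laplace (empirical N x) l) \<in> borel_measurable (borel \<Otimes>\<^sub>M wealth_space N w)"
proof -
  have "(\<lambda>p. (\<Sum>i<N. exp (- fst p * snd p i)) / real N) \<in> borel_measurable (borel \<Otimes>\<^sub>M wealth_space N w)"
  proof (intro borel_measurable_divide borel_measurable_sum borel_measurable_const)
    fix i assume "i \<in> {..<N}"
    then have "(\<lambda>p. snd p i) \<in> borel_measurable (borel \<Otimes>\<^sub>M wealth_space N w)"
      by (intro measurable_compose[OF measurable_snd measurable_wealth_component]) simp
    then show "(\<lambda>p. exp (- fst p * snd p i)) \<in> borel_measurable (borel \<Otimes>\<^sub>M wealth_space N w)"
      by measurable
  qed
  then show ?thesis
    by (rule measurable_cong[THEN iffD1, rotated]) (auto simp: space_pair_measure laplace_empirical)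
qed

lemma empirical_in_M1: "2 \<le> N \<Longrightarrow> x \<in> space (wealth_space N w) \<Longrightarrow> empirical N x \<in> M1"
  by (rule empirical_M1) (auto simp: space_wealth)

text \<open>The structure behind a particle system: jump times \<open>T\<close> and visited states \<open>Y\<close>.\<close>

locale exchange_process = prob_space P for P :: "'w measure" +
  fixes N :: nat and w :: real and T :: "nat \<Rightarrow> 'w \<Rightarrow> real" and Y :: "nat \<Rightarrow> 'w \<Rightarrow> nat \<Rightarrow> real"
  assumes N2: "2 \<le> N"
    and T_measurable [measurable]: "\<And>n. T n \<in> borel_measurable P"
    and Y_measurable [measurable]: "\<And>n. Y n \<in> measurable P (wealth_space N w)"
    and T_0: "\<And>\<omega>. \<omega> \<in> space P \<Longrightarrow> T 0 \<omega> = 0"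
    and T_less: "\<And>\<omega> n. \<omega> \<in> space P \<Longrightarrow> T n \<omega> < T (Suc n) \<omega>"
    and transition: "\<And>n C u A. C \<in> sets (\<Pi>\<^sub>M k\<in>{..n}. borel \<Otimes>\<^sub>M wealth_space N w) \<Longrightarrow> 0 \<le> u \<Longrightarrow>
      A \<in> sets (wealth_space N w) \<Longrightarrow>
           measure P {\<omega> \<in> space P. (\<lambda>k\<in>{..n}. (T k \<omega>, Y k \<omega>)) \<in> C
                        \<and> u < T (Suc n) \<omega> - T n \<omega> \<and> Y (Suc n) \<omega> \<in> A}
           = (\<integral>\<omega>\<in>{\<omega> \<in> space P. (\<lambda>k\<in>{..n}. (T k \<omega>, Y k \<omega>)) \<in> C}.
                exp (- exchange_rate N (Y n \<omega>) (space (wealth_space N w)) * u)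
                * (exchange_rate N (Y n \<omega>) A / exchange_rate N (Y n \<omega>) (space (wealth_space N w))) \<partial>P)"
begin

abbreviation "S \<equiv> wealth_space N w"

definition h :: real where "h = 1 / real (N - 1)"

lemma h: "0 < h" "1 / real N \<le> h"
  using N2 by (auto simp: h_def frac_le)

lemma Y_space: "\<omega> \<in> space P \<Longrightarrow> Y n \<omega> \<in> space S"
  by (rule measurable_space[OF Y_measurable])

lemma history_measurable: "(\<lambda>\<omega>. \<lambda>k\<in>{..n}. (T k \<omega>, Y k \<omega>)) \<in> measurable P (\<Pi>\<^sub>M k\<in>{..n}. borel \<Otimes>\<^sub>M S)"
  by measurable

text \<open>Only the present state and the present jump time are kept from the history.\<close>

lemma transition_simple:
  assumes B: "B \<in> sets borel" and D: "D \<in> sets S" and u: "0 \<le> u" and A: "A \<in> sets S"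
  shows "prob {\<omega> \<in> space P. T n \<omega> \<in> B \<and> Y n \<omega> \<in> D \<and> u < T (Suc n) \<omega> - T n \<omega> \<and> Y (Suc n) \<omega> \<in> A}
    = exp (- real (N - 1) * u) * (\<integral>\<omega>. indicator B (T n \<omega>) * (indicator D (Y n \<omega>) * exchange_mean N (indicator A) (Y n \<omega>)) \<partial>P)"
proof -
  let ?PM = "\<Pi>\<^sub>M k\<in>{..n}. (borel :: real measure) \<Otimes>\<^sub>M S"
  define C where "C = (\<lambda>z. z n) -` (B \<times> D) \<inter> space ?PM"
  have C: "C \<in> sets ?PM" unfolding C_def
    by (rule measurable_sets[OF measurable_component_singleton]) (use B D in auto)
  have inC: "(\<lambda>k\<in>{..n}. (T k \<omega>, Y k \<omega>)) \<in> C \<longleftrightarrow> T n \<omega> \<in> B \<and> Y n \<omega> \<in> D" if "\<omega> \<in> space P" for \<omega>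
    using measurable_space[OF history_measurable that] by (auto simp: C_def)
  have "prob {\<omega> \<in> space P. T n \<omega> \<in> B \<and> Y n \<omega> \<in> D \<and> u < T (Suc n) \<omega> - T n \<omega> \<and> Y (Suc n) \<omega> \<in> A}
     = prob {\<omega> \<in> space P. (\<lambda>k\<in>{..n}. (T k \<omega>, Y k \<omega>)) \<in> C
                        \<and> u < T (Suc n) \<omega> - T n \<omega> \<and> Y (Suc n) \<omega> \<in> A}"
    by (rule arg_cong[of _ _ prob]) (use inC in blast)
  also have "\<dots> = (\<integral>\<omega>. exp (- real (N - 1) * u) * (indicator B (T n \<omega>) * (indicator D (Y n \<omega>) * exchange_mean N (indicator A) (Y n \<omega>))) \<partial>P)"
    unfolding transition[OF C u A] set_lebesgue_integral_def
  proof (rule Bochner_Integration.integral_cong[OF refl])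
    fix \<omega> assume w: "\<omega> \<in> space P"
    show "indicator {\<omega> \<in> space P. (\<lambda>k\<in>{..n}. (T k \<omega>, Y k \<omega>)) \<in> C} \<omega> *\<^sub>R
        (exp (- exchange_rate N (Y n \<omega>) (space S) * u) * (exchange_rate N (Y n \<omega>) A / exchange_rate N (Y n \<omega>) (space S)))
      = exp (- real (N - 1) * u) * (indicator B (T n \<omega>) * (indicator D (Y n \<omega>) * exchange_mean N (indicator A) (Y n \<omega>)))"
      unfolding exchange_rate_total[OF N2 Y_space[OF w]] exchange_rate_eq[OF N2 Y_space[OF w] A]
      using inC[OF w] w N2 by (simp add: indicator_def)
  qed
  finally show ?thesis by simp
qed

abbreviation "choices \<equiv> P \<Otimes>\<^sub>M (uniform_count_measure (agent_pairs N) \<Otimes>\<^sub>M unit_law)"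

lemma integral_choices:
  fixes F :: "'w \<times> (nat \<times> nat) \<times> real \<Rightarrow> real"
  assumes F: "F \<in> borel_measurable choices"
    and b: "\<And>v. \<bar>F v\<bar> \<le> B"
  shows "(\<integral>v. F v \<partial>choices)
    = (\<integral>\<omega>. (\<Sum>p\<in>agent_pairs N. \<integral>r. F (\<omega>, p, r) \<partial>unit_law) / real (card (agent_pairs N)) \<partial>P)"
proof -
  have ne: "agent_pairs N \<noteq> {}" by (rule agent_pairs_nonempty[OF N2])
  interpret A: prob_space "uniform_count_measure (agent_pairs N)"
    by (rule prob_space_uniform_count_measure) (use ne in auto)
  interpret U: prob_space unit_law by (rule prob_space_unit_law)
  interpret AU: pair_prob_space "uniform_count_measure (agent_pairs N)" unit_law ..
  interpret V: pair_prob_space P "uniform_count_measure (agent_pairs N) \<Otimes>\<^sub>M unit_law" ..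
  have int: "integrable choices F"
    by (rule V.integrable_const_bound[of _ B]) (use b F in auto)
  have "(\<integral>z. F (\<omega>, z) \<partial>(uniform_count_measure (agent_pairs N) \<Otimes>\<^sub>M unit_law))
      = (\<Sum>p\<in>agent_pairs N. \<integral>r. F (\<omega>, p, r) \<partial>unit_law) / real (card (agent_pairs N))" if w: "\<omega> \<in> space P" for \<omega>
  proof -
    have "(\<lambda>z. F (\<omega>, z)) \<in> borel_measurable (uniform_count_measure (agent_pairs N) \<Otimes>\<^sub>M unit_law)"
      using measurable_compose[OF measurable_Pair1'[OF w] F] .
    then have i: "integrable (uniform_count_measure (agent_pairs N) \<Otimes>\<^sub>M unit_law) (\<lambda>z. F (\<omega>, z))"
      by (intro AU.integrable_const_bound[of _ B]) (use b in auto)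
    show ?thesis using AU.integral_fst'[OF i] by (simp add: integral_uniform_count_measure)
  qed
  then show ?thesis
    unfolding V.integral_fst'[OF int, symmetric] by (intro Bochner_Integration.integral_cong) auto
qed

definition next_pair :: "nat \<Rightarrow> 'w \<times> (nat \<times> nat) \<times> real \<Rightarrow> (nat \<Rightarrow> real) \<times> (nat \<Rightarrow> real)" where
  "next_pair n v = (Y n (fst v), exchange (fst (fst (snd v))) (snd (fst (snd v))) (snd (snd v)) (Y n (fst v)))"

lemma next_pair_measurable:
  "next_pair n \<in> measurable choices (S \<Otimes>\<^sub>M S)"
proof -
  have 1: "(\<lambda>v. Y n (fst v)) \<in> measurable choices S"
    by (rule measurable_compose[OF measurable_fst Y_measurable])
  have 2: "(\<lambda>v. exchange (fst p) (snd p) (snd (snd v)) (Y n (fst v))) \<in> measurable choices S"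
    if p: "p \<in> agent_pairs N" for p
  proof -
    have e: "(\<lambda>(r, x). exchange (fst p) (snd p) r x) \<in> measurable (unit_law \<Otimes>\<^sub>M S) S"
      by (rule measurable_exchange) (use p in simp)
    have "(\<lambda>v. (snd (snd v), Y n (fst v))) \<in> measurable choices (unit_law \<Otimes>\<^sub>M S)"
      by (rule measurable_Pair[OF measurable_compose[OF measurable_snd measurable_snd] 1])
    from measurable_compose[OF this e] show ?thesis by simp
  qed
  have 3: "(\<lambda>v. fst (snd v)) \<in> measurable choices (count_space (agent_pairs N))"
    using measurable_compose[OF measurable_snd measurable_fst, of P "uniform_count_measure (agent_pairs N)" unit_law]
    by (simp add: measurable_cong_sets[OF refl sets_uniform_count_measure_count_space])
  have "(\<lambda>v. exchange (fst (fst (snd v))) (snd (fst (snd v))) (snd (snd v)) (Y n (fst v))) \<in> measurable choices S"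
    by (rule measurable_compose_countable'[OF 2 3]) (auto intro: countable_finite)
  then show ?thesis unfolding next_pair_def[abs_def] by (intro measurable_Pair 1)
qed

text \<open>The transition law is given on events, hence on rectangles, which determine a measure on the
  product. Representing the successor by an independent choice of the pair and of \<open>r\<close> makes Fubini's
  theorem available.\<close>

lemma joint_law:
  "distr P (S \<Otimes>\<^sub>M S) (\<lambda>\<omega>. (Y n \<omega>, Y (Suc n) \<omega>))
   = distr choices (S \<Otimes>\<^sub>M S) (next_pair n)"
  (is "?L = ?R")
proof -
  have ne: "agent_pairs N \<noteq> {}" by (rule agent_pairs_nonempty[OF N2])
  interpret A: prob_space "uniform_count_measure (agent_pairs N)"
    by (rule prob_space_uniform_count_measure) (use ne in auto)
  interpret U: prob_space unit_law by (rule prob_space_unit_law)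
  interpret AU: pair_prob_space "uniform_count_measure (agent_pairs N)" unit_law ..
  interpret V: pair_prob_space P "uniform_count_measure (agent_pairs N) \<Otimes>\<^sub>M unit_law" ..
  have YY: "(\<lambda>\<omega>. (Y n \<omega>, Y (Suc n) \<omega>)) \<in> measurable P (S \<Otimes>\<^sub>M S)" by measurable
  interpret L: prob_space ?L by (rule prob_space_distr[OF YY])
  show ?thesis
  proof (rule measure_eqI_generator_eq[OF Int_stable_pair_measure_generator[of S S]])
    show "{a \<times> b |a b. a \<in> sets S \<and> b \<in> sets S} \<subseteq> Pow (space S \<times> space S)"
      by (auto dest: sets.sets_into_space)
    show "sets ?L = sigma_sets (space S \<times> space S) {a \<times> b |a b. a \<in> sets S \<and> b \<in> sets S}"
      "sets ?R = sigma_sets (space S \<times> space S) {a \<times> b |a b. a \<in> sets S \<and> b \<in> sets S}"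
      by (simp_all add: sets_pair_measure)
    show "range (\<lambda>_::nat. space S \<times> space S) \<subseteq> {a \<times> b |a b. a \<in> sets S \<and> b \<in> sets S}" by auto
    show "(\<Union>i::nat. space S \<times> space S) = space S \<times> space S" by auto
    show "emeasure ?L (space S \<times> space S) \<noteq> \<infinity>" by simp
    fix X assume "X \<in> {a \<times> b |a b. a \<in> sets S \<and> b \<in> sets S}"
    then obtain D E where X: "X = D \<times> E" and D: "D \<in> sets S" and E: "E \<in> sets S" by auto
    have XS: "X \<in> sets (S \<Otimes>\<^sub>M S)" using D E by (simp add: X)
    have "measure ?L X = prob {\<omega> \<in> space P. T n \<omega> \<in> UNIV \<and> Y n \<omega> \<in> D \<and> 0 < T (Suc n) \<omega> - T n \<omega> \<and> Y (Suc n) \<omega> \<in> E}"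
      unfolding measure_distr[OF YY XS]
      by (rule arg_cong[of _ _ prob]) (use T_less in \<open>auto simp: X\<close>)
    also have "\<dots> = (\<integral>\<omega>. indicator D (Y n \<omega>) * exchange_mean N (indicator E) (Y n \<omega>) \<partial>P)"
      by (subst transition_simple[OF _ D _ E]) auto
    also have "\<dots> = (\<integral>\<omega>. (\<Sum>p\<in>agent_pairs N. \<integral>r. indicator X (next_pair n (\<omega>, p, r)) \<partial>unit_law) / real (card (agent_pairs N)) \<partial>P)"
      by (rule Bochner_Integration.integral_cong)
        (auto simp: exchange_mean_def X next_pair_def indicator_times sum_distrib_left case_prod_unfold)
    also have "\<dots> = (\<integral>v. indicator X (next_pair n v) \<partial>choices)"
      by (rule integral_choices[symmetric, where B = 1])
        (rule measurable_compose[OF next_pair_measurable borel_measurable_indicator[OF XS]],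
          simp add: indicator_def)
    also have "\<dots> = (\<integral>v. indicator (next_pair n -` X \<inter> space choices) v \<partial>choices)"
      by (rule Bochner_Integration.integral_cong) (auto simp: indicator_def)
    also have "\<dots> = measure ?R X"
      using measurable_sets[OF next_pair_measurable XS] by (simp add: measure_distr[OF next_pair_measurable XS])
    finally have eq: "measure ?L X = measure ?R X" .
    interpret R: prob_space ?R by (rule V.prob_space_distr[OF next_pair_measurable])
    from eq show "emeasure ?L X = emeasure ?R X"
      by (simp add: L.emeasure_eq_measure R.emeasure_eq_measure)
  qed
qed

lemma expectation_step:
  fixes H :: "(nat \<Rightarrow> real) \<times> (nat \<Rightarrow> real) \<Rightarrow> real"
  assumes H: "H \<in> borel_measurable (S \<Otimes>\<^sub>M S)" and b: "\<And>x y. x \<in> space S \<Longrightarrow> y \<in> space S \<Longrightarrow> \<bar>H (x, y)\<bar> \<le> B"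
  shows "expectation (\<lambda>\<omega>. H (Y n \<omega>, Y (Suc n) \<omega>)) = expectation (\<lambda>\<omega>. exchange_mean N (\<lambda>y. H (Y n \<omega>, y)) (Y n \<omega>))"
proof -
  define B' where "B' = max 0 B"
  \<comment> \<open>Outside the state space the integrand is replaced by 0, so that it is bounded everywhere.\<close>
  define F where "F v = (if v \<in> space choices then H (next_pair n v) else 0)" for v
  have YY: "(\<lambda>\<omega>. (Y n \<omega>, Y (Suc n) \<omega>)) \<in> measurable P (S \<Otimes>\<^sub>M S)" by measurable
  have m: "(\<lambda>v. H (next_pair n v)) \<in> borel_measurable choices"
    by (rule measurable_compose[OF next_pair_measurable H])
  have F: "F \<in> borel_measurable choices"
    by (rule measurable_cong[THEN iffD1, OF _ m]) (simp add: F_def)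
  have Fb: "\<bar>F v\<bar> \<le> B'" for v
    using measurable_space[OF next_pair_measurable, of v n] b
    by (auto simp: F_def B'_def space_pair_measure next_pair_def intro!: max.coboundedI2)
  have "expectation (\<lambda>\<omega>. H (Y n \<omega>, Y (Suc n) \<omega>)) = (\<integral>z. H z \<partial>distr P (S \<Otimes>\<^sub>M S) (\<lambda>\<omega>. (Y n \<omega>, Y (Suc n) \<omega>)))"
    by (rule integral_distr[OF YY H, symmetric])
  also have "\<dots> = (\<integral>v. H (next_pair n v) \<partial>choices)"
    unfolding joint_law by (rule integral_distr[OF next_pair_measurable H])
  also have "\<dots> = (\<integral>v. F v \<partial>choices)" by (rule Bochner_Integration.integral_cong) (auto simp: F_def)
  also have "\<dots> = expectation (\<lambda>\<omega>. exchange_mean N (\<lambda>y. H (Y n \<omega>, y)) (Y n \<omega>))"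
    unfolding integral_choices[OF F Fb] exchange_mean_def case_prod_unfold
    by (intro Bochner_Integration.integral_cong arg_cong2[of _ _ _ _ "(/)"] sum.cong refl)
      (auto simp: F_def next_pair_def space_pair_measure space_uniform_count_measure)
  finally show ?thesis .
qed

lemma laplace_Y_measurable [measurable]:
  "(\<lambda>\<omega>. laplace (empirical N (Y n \<omega>)) l) \<in> borel_measurable P"
proof -
  have "(\<lambda>\<omega>. (l, Y n \<omega>)) \<in> measurable P (borel \<Otimes>\<^sub>M S)" by measurable
  from measurable_compose[OF this laplace_empirical_measurable] show ?thesis by simp
qed

text \<open>The deterministic bound for an exchange holds only almost surely for the chain, whose steps are
  prescribed in law.\<close>

lemma laplace_step_close:
  assumes l: "0 \<le> l"
  shows "AE \<omega> in P. \<bar>laplace (empirical N (Y (Suc n) \<omega>)) l - laplace (empirical N (Y n \<omega>)) l\<bar> \<le> 2 / real N"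
proof -
  define D where "D = {z \<in> space (S \<Otimes>\<^sub>M S). 2 / real N < \<bar>laplace (empirical N (snd z)) l - laplace (empirical N (fst z)) l\<bar>}"
  have m: "(\<lambda>x. laplace (empirical N x) l) \<in> borel_measurable S"
    using measurable_compose[OF measurable_Pair1'[of l borel S] laplace_empirical_measurable] by simp
  have [measurable]: "(\<lambda>z. laplace (empirical N (fst z)) l) \<in> borel_measurable (S \<Otimes>\<^sub>M S)"
    "(\<lambda>z. laplace (empirical N (snd z)) l) \<in> borel_measurable (S \<Otimes>\<^sub>M S)"
    by (rule measurable_compose[OF measurable_fst m] measurable_compose[OF measurable_snd m])+
  have D: "D \<in> sets (S \<Otimes>\<^sub>M S)" unfolding D_def by measurable
  let ?E = "{\<omega> \<in> space P. 2 / real N < \<bar>laplace (empirical N (Y (Suc n) \<omega>)) l - laplace (empirical N (Y n \<omega>)) l\<bar>}"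
  have E: "?E \<in> events" by measurable
  have "prob ?E = expectation (indicator ?E)" using E by simp
  also have "\<dots> = expectation (\<lambda>\<omega>. indicator D (Y n \<omega>, Y (Suc n) \<omega>))"
    by (rule Bochner_Integration.integral_cong) (auto simp: D_def indicator_def space_pair_measure Y_space)
  also have "\<dots> = expectation (\<lambda>\<omega>. exchange_mean N (\<lambda>y. indicator D (Y n \<omega>, y)) (Y n \<omega>))"
    by (rule expectation_step[where B = 1]) (use D in \<open>auto simp: indicator_def\<close>)
  also have "\<dots> = expectation (\<lambda>\<omega>. 0)"
  proof (rule Bochner_Integration.integral_cong[OF refl])
    fix \<omega> assume w: "\<omega> \<in> space P"
    have "(\<integral>r. indicator D (Y n \<omega>, exchange i j r (Y n \<omega>)) \<partial>unit_law) = (\<integral>r. (0::real) \<partial>unit_law)"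
      if "(i, j) \<in> agent_pairs N" for i j
      using laplace_exchange_close[OF Y_space[OF w] that _ l, of _ n]
      by (intro Bochner_Integration.integral_cong) (auto simp: D_def indicator_def not_less)
    then have "(\<Sum>(i, j)\<in>agent_pairs N. \<integral>r. indicator D (Y n \<omega>, exchange i j r (Y n \<omega>)) \<partial>unit_law) = (0 :: real)"
      by (intro sum.neutral) auto
    then show "exchange_mean N (\<lambda>y. indicator D (Y n \<omega>, y)) (Y n \<omega>) = 0"
      unfolding exchange_mean_def by simp
  qed
  finally have "emeasure P ?E = 0" using E by (simp add: emeasure_eq_measure)
  then show ?thesis by (intro AE_I[OF _ _ E]) (auto simp: not_le)
qed

end

context exchange_process
begin

section \<open>Mean square error along the jump chain\<close>

text \<open>The chain after \<open>n\<close> jumps is compared with the flow at time \<open>n h\<close>, the mean of the \<open>n\<close>-th jump time.\<close>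

definition err :: "real measure \<Rightarrow> nat \<Rightarrow> real \<Rightarrow> 'w \<Rightarrow> real" where
  "err \<mu> n l \<omega> = laplace (empirical N (Y n \<omega>)) l - laplace (flow \<mu> (real n * h)) l"

lemma err_measurable [measurable]: "err \<mu> n l \<in> borel_measurable P"
  unfolding err_def[abs_def] by measurable

lemma err_bound:
  assumes \<mu>: "\<mu> \<in> M1" and l: "0 \<le> l" and w: "\<omega> \<in> space P"
  shows "(err \<mu> n l \<omega>)\<^sup>2 \<le> 1"
proof -
  have "\<bar>err \<mu> n l \<omega>\<bar> \<le> 1"
    using laplace_bounds[OF empirical_in_M1[OF N2 Y_space[OF w]] l, of n] laplace_bounds[OF flow_M1[OF \<mu>] l, of "real n * h"]
    unfolding err_def by linarith
  then show ?thesis by (simp add: abs_square_le_1)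
qed

lemma err_integrable:
  assumes "\<mu> \<in> M1" "0 \<le> l" shows "integrable P (\<lambda>\<omega>. (err \<mu> n l \<omega>)\<^sup>2)"
  by (rule integrable_const_bound[of _ 1]) (use err_bound[OF assms] in \<open>auto intro!: AE_I2\<close>)

text \<open>The error at the random parameter \<open>r l\<close> is averaged over \<open>r\<close>; exchanging the integrals bounds it
  by the worst error at a parameter below \<open>l\<close>.\<close>

lemma err_share:
  assumes \<mu>: "\<mu> \<in> M1" and l: "0 \<le> l"
    and e: "\<And>l'. 0 \<le> l' \<Longrightarrow> l' \<le> l \<Longrightarrow> expectation (\<lambda>\<omega>. (err \<mu> n l' \<omega>)\<^sup>2) \<le> e"
  shows "integrable P (\<lambda>\<omega>. \<integral>r. (err \<mu> n (r * l) \<omega>)\<^sup>2 \<partial>unit_law)"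
    and "expectation (\<lambda>\<omega>. \<integral>r. (err \<mu> n (r * l) \<omega>)\<^sup>2 \<partial>unit_law) \<le> e"
proof -
  interpret U: prob_space unit_law by (rule prob_space_unit_law)
  interpret UP: pair_prob_space unit_law P ..
  have 1: "(\<lambda>z. (fst z * l, Y n (snd z))) \<in> measurable (unit_law \<Otimes>\<^sub>M P) (borel \<Otimes>\<^sub>M S)"
  proof (rule measurable_Pair)
    have "fst \<in> borel_measurable (unit_law \<Otimes>\<^sub>M P)"
      using measurable_compose[OF measurable_fst id_unit_law] by simp
    then show "(\<lambda>z. fst z * l) \<in> borel_measurable (unit_law \<Otimes>\<^sub>M P)" by simp
    show "(\<lambda>z. Y n (snd z)) \<in> measurable (unit_law \<Otimes>\<^sub>M P) S"
      by (rule measurable_compose[OF measurable_snd Y_measurable])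
  qed
  have 2: "(\<lambda>z. laplace (flow \<mu> (real n * h)) (fst z * l)) \<in> borel_measurable (unit_law \<Otimes>\<^sub>M P)"
    using measurable_compose[OF measurable_compose[OF 1 measurable_fst] laplace_measurable[OF flow_M1[OF \<mu>]]] by simp
  have m: "(\<lambda>z. (err \<mu> n (fst z * l) (snd z))\<^sup>2) \<in> borel_measurable (unit_law \<Otimes>\<^sub>M P)"
    using measurable_compose[OF 1 laplace_empirical_measurable] 2 unfolding err_def by simp
  have i: "integrable (unit_law \<Otimes>\<^sub>M P) (\<lambda>(r, \<omega>). (err \<mu> n (r * l) \<omega>)\<^sup>2)"
    by (rule UP.integrable_const_bound[of _ 1])
      (use m err_bound[OF \<mu>] l in \<open>auto simp: case_prod_unfold space_pair_measure intro!: AE_I2\<close>)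
  show "integrable P (\<lambda>\<omega>. \<integral>r. (err \<mu> n (r * l) \<omega>)\<^sup>2 \<partial>unit_law)"
    by (rule UP.integrable_snd[OF i])
  have "expectation (\<lambda>\<omega>. \<integral>r. (err \<mu> n (r * l) \<omega>)\<^sup>2 \<partial>unit_law)
     = (\<integral>r. expectation (\<lambda>\<omega>. (err \<mu> n (r * l) \<omega>)\<^sup>2) \<partial>unit_law)"
    by (rule UP.Fubini_integral[OF i])
  also have "\<dots> \<le> (\<integral>r. e \<partial>unit_law)"
  proof (rule integral_mono)
    show "integrable unit_law (\<lambda>r. expectation (\<lambda>\<omega>. (err \<mu> n (r * l) \<omega>)\<^sup>2))"
      by (rule UP.integrable_fst[OF i])
    show "expectation (\<lambda>\<omega>. (err \<mu> n (r * l) \<omega>)\<^sup>2) \<le> e" if "r \<in> space unit_law" for r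
      using that l by (intro e) (auto intro: mult_left_le_one_le)
  qed auto
  finally show "expectation (\<lambda>\<omega>. \<integral>r. (err \<mu> n (r * l) \<omega>)\<^sup>2 \<partial>unit_law) \<le> e"
    by (simp add: U.prob_space[simplified])
qed

text \<open>Discrete Gronwall inequality, for all parameters up to \<open>L\<close> simultaneously. The supremum over the
  parameter is taken outside the expectation, where the induction can carry it.\<close>

lemma mean_square_error:
  assumes \<mu>: "\<mu> \<in> M1" and e0: "0 \<le> e0"
    and init: "\<And>l. 0 \<le> l \<Longrightarrow> l \<le> L \<Longrightarrow> expectation (\<lambda>\<omega>. (err \<mu> 0 l \<omega>)\<^sup>2) \<le> e0"
    and l: "0 \<le> l" "l \<le> L"
  shows "expectation (\<lambda>\<omega>. (err \<mu> n l \<omega>)\<^sup>2) \<le> exp (8 * (real n * h)) * (e0 + 140 * real n * h\<^sup>2)"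
  using l
proof (induction n arbitrary: l)
  case 0 then show ?case using init by simp
next
  case (Suc n)
  define e where "e = exp (8 * (real n * h)) * (e0 + 140 * real n * h\<^sup>2)"
  have e: "0 \<le> e" using e0 by (simp add: e_def)
  have IH: "expectation (\<lambda>\<omega>. (err \<mu> n l' \<omega>)\<^sup>2) \<le> e" if "0 \<le> l'" "l' \<le> l" for l'
    unfolding e_def using that Suc.prems by (intro Suc.IH) auto
  note sh = err_share[OF \<mu> Suc.prems(1) IH]
  define a where "a = laplace (flow \<mu> (real n * h + h)) l"
  define F where "F y = (laplace (empirical N y) l - a)\<^sup>2" for y
  have m: "(\<lambda>x. laplace (empirical N x) l) \<in> borel_measurable S"
    using measurable_compose[OF measurable_Pair1'[of l borel S] laplace_empirical_measurable] by simp
  have a: "0 \<le> a" "a \<le> 1" using laplace_bounds[OF flow_M1[OF \<mu>] Suc.prems(1), of "real n * h + h"] by (auto simp: a_def)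
  have Fb: "\<bar>F y\<bar> \<le> 1" if "y \<in> space S" for y
  proof -
    have "\<bar>laplace (empirical N y) l - a\<bar> \<le> 1"
      using laplace_bounds[OF empirical_in_M1[OF N2 that] Suc.prems(1)] a by auto
    then show ?thesis unfolding F_def by (simp add: abs_square_le_1)
  qed
  have "expectation (\<lambda>\<omega>. (err \<mu> (Suc n) l \<omega>)\<^sup>2) = expectation (\<lambda>\<omega>. F (snd (Y n \<omega>, Y (Suc n) \<omega>)))"
    by (simp add: err_def F_def a_def algebra_simps)
  also have "\<dots> = expectation (\<lambda>\<omega>. exchange_mean N (\<lambda>y. F (snd (Y n \<omega>, y))) (Y n \<omega>))"
    by (rule expectation_step[where H = "\<lambda>z. F (snd z)" and B = 1])
      (use Fb m in \<open>auto simp: F_def[abs_def] intro!: measurable_compose[OF measurable_snd]\<close>)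
  also have "\<dots> = expectation (\<lambda>\<omega>. exchange_mean N F (Y n \<omega>))" by simp
  also have "\<dots> \<le> expectation (\<lambda>\<omega>. (1 + 4 * h) * (err \<mu> n l \<omega>)\<^sup>2
      + 4 * h * (\<integral>r. (err \<mu> n (r * l) \<omega>)\<^sup>2 \<partial>unit_law) + 140 * h\<^sup>2)"
  proof (rule integral_mono')
    show "integrable P (\<lambda>\<omega>. (1 + 4 * h) * (err \<mu> n l \<omega>)\<^sup>2
      + 4 * h * (\<integral>r. (err \<mu> n (r * l) \<omega>)\<^sup>2 \<partial>unit_law) + 140 * h\<^sup>2)"
      using err_integrable[OF \<mu> Suc.prems(1)] sh(1) by auto
    show "exchange_mean N F (Y n \<omega>) \<le> (1 + 4 * h) * (err \<mu> n l \<omega>)\<^sup>2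
      + 4 * h * (\<integral>r. (err \<mu> n (r * l) \<omega>)\<^sup>2 \<partial>unit_law) + 140 * h\<^sup>2" if "\<omega> \<in> space P" for \<omega>
      unfolding F_def a_def err_def
      by (rule exchange_mean_flow_error[OF N2 Y_space[OF that] Suc.prems(1) \<mu>]) (use h in \<open>auto simp: h_def\<close>)
    show "0 \<le> (1 + 4 * h) * (err \<mu> n l \<omega>)\<^sup>2
      + 4 * h * (\<integral>r. (err \<mu> n (r * l) \<omega>)\<^sup>2 \<partial>unit_law) + 140 * h\<^sup>2" for \<omega>
      using h by (intro add_nonneg_nonneg mult_nonneg_nonneg integral_nonneg_AE) auto
  qed
  also have "\<dots> = (1 + 4 * h) * expectation (\<lambda>\<omega>. (err \<mu> n l \<omega>)\<^sup>2)
      + 4 * h * expectation (\<lambda>\<omega>. \<integral>r. (err \<mu> n (r * l) \<omega>)\<^sup>2 \<partial>unit_law) + 140 * h\<^sup>2"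
    using err_integrable[OF \<mu> Suc.prems(1)] sh(1) by (simp add: prob_space)
  also have "\<dots> \<le> (1 + 4 * h) * e + 4 * h * e + 140 * h\<^sup>2"
    using h sh(2) IH[of l] Suc.prems by (intro add_mono mult_left_mono) auto
  also have "\<dots> = (1 + 8 * h) * e + 1 * (140 * h\<^sup>2)" by (simp add: algebra_simps)
  also have "\<dots> \<le> exp (8 * h) * e + exp (8 * (real (Suc n) * h)) * (140 * h\<^sup>2)"
    using h e by (intro add_mono mult_right_mono exp_ge_add_one_self) auto
  also have "\<dots> = exp (8 * (real (Suc n) * h)) * (e0 + 140 * real (Suc n) * h\<^sup>2)"
    by (simp add: e_def algebra_simps exp_add)
  finally show ?case .
qed

section \<open>The law of large numbers for the jump times\<close>

lemma holding_time_law: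
  assumes u: "0 \<le> u" and B: "B \<in> sets borel"
  shows "prob {\<omega> \<in> space P. T n \<omega> \<in> B \<and> u < T (Suc n) \<omega> - T n \<omega>}
    = exp (- real (N - 1) * u) * prob {\<omega> \<in> space P. T n \<omega> \<in> B}"
proof -
  have E: "{\<omega> \<in> space P. T n \<omega> \<in> B} \<in> events" using B by measurable
  have "prob {\<omega> \<in> space P. T n \<omega> \<in> B \<and> u < T (Suc n) \<omega> - T n \<omega>}
    = prob {\<omega> \<in> space P. T n \<omega> \<in> B \<and> Y n \<omega> \<in> space S \<and> u < T (Suc n) \<omega> - T n \<omega> \<and> Y (Suc n) \<omega> \<in> space S}"
    by (rule arg_cong[of _ _ prob]) (use Y_space in auto)
  also have "\<dots> = exp (- real (N - 1) * u) * (\<integral>\<omega>. indicator B (T n \<omega>) * (indicator (space S) (Y n \<omega>) * exchange_mean N (indicator (space S)) (Y n \<omega>)) \<partial>P)"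
    by (rule transition_simple[OF B _ u]) auto
  also have "(\<integral>\<omega>. indicator B (T n \<omega>) * (indicator (space S) (Y n \<omega>) * exchange_mean N (indicator (space S)) (Y n \<omega>)) \<partial>P)
    = (\<integral>\<omega>. indicator {\<omega> \<in> space P. T n \<omega> \<in> B} \<omega> \<partial>P)"
  proof (rule Bochner_Integration.integral_cong[OF refl])
    fix \<omega> assume w: "\<omega> \<in> space P"
    have "real (N - 1) * exchange_mean N (indicator (space S)) (Y n \<omega>) = real (N - 1)"
      using exchange_rate_total[OF N2 Y_space[OF w]] exchange_rate_eq[OF N2 Y_space[OF w] sets.top] by simp
    then have "exchange_mean N (indicator (space S)) (Y n \<omega>) = 1" using N2 by simp
    then show "indicator B (T n \<omega>) * (indicator (space S) (Y n \<omega>) * exchange_mean N (indicator (space S)) (Y n \<omega>))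
      = (indicator {\<omega> \<in> space P. T n \<omega> \<in> B} \<omega> :: real)"
      using w Y_space[OF w] by (simp add: indicator_def)
  qed
  also have "\<dots> = prob {\<omega> \<in> space P. T n \<omega> \<in> B}" using E by simp
  finally show ?thesis .
qed

abbreviation "hold n \<omega> \<equiv> T (Suc n) \<omega> - T n \<omega>"

lemma hold_exponential: "distributed P lborel (hold n) (exponential_density (real (N - 1)))"
proof -
  have pos: "0 < real (N - 1)" using N2 by simp
  show ?thesis
    unfolding exponential_distributed_iff[OF pos]
  proof (intro conjI allI impI)
    show "hold n \<in> borel_measurable P" by measurable
    fix a :: real assume a: "0 \<le> a"
    have "prob {\<omega> \<in> space P. a < hold n \<omega>} = exp (- real (N - 1) * a)"
      using holding_time_law[OF a, of UNIV n] by (simp add: prob_space)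
    moreover have "prob {\<omega> \<in> space P. hold n \<omega> \<le> a} = 1 - prob {\<omega> \<in> space P. a < hold n \<omega>}"
      by (subst prob_compl[symmetric]) (auto intro!: arg_cong[of _ _ prob])
    ultimately show "prob {\<omega> \<in> space P. hold n \<omega> \<le> a} = 1 - exp (- a * real (N - 1))"
      by (simp add: mult.commute)
  qed
qed

text \<open>The tails of the holding time generate its sigma-algebra and are closed under intersection.\<close>

lemma hold_indep: "indep_var borel (T n) borel (hold n)"
proof -
  have tail: "prob {\<omega> \<in> space P. T n \<omega> \<in> B \<and> u < hold n \<omega>} = prob {\<omega> \<in> space P. T n \<omega> \<in> B} * prob {\<omega> \<in> space P. u < hold n \<omega>}"
    if B: "B \<in> sets borel" for B u
  proof (cases "0 \<le> u")
    case True
    then show ?thesis using holding_time_law[OF True B] holding_time_law[OF True, of UNIV] by (simp add: prob_space)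
  next
    case False
    have pos: "u < hold n \<omega>" if "\<omega> \<in> space P" for \<omega> using T_less[OF that, of n] False by simp
    have "{\<omega> \<in> space P. T n \<omega> \<in> B \<and> u < hold n \<omega>} = {\<omega> \<in> space P. T n \<omega> \<in> B}"
      "{\<omega> \<in> space P. u < hold n \<omega>} = space P" using pos by auto
    then show ?thesis by (simp add: prob_space)
  qed
  let ?A = "{T n -` A \<inter> space P |A. A \<in> sets borel}"
  let ?B = "{hold n -` A \<inter> space P |A. A \<in> range (\<lambda>a. {a<..})}"
  have "indep_set ?A ?B"
  proof (rule indep_setI)
    show "?A \<subseteq> events" by (auto intro: measurable_sets[OF T_measurable])
    have "hold n \<in> borel_measurable P" by measurable
    then have "hold n -` A \<inter> space P \<in> events" if "A \<in> sets borel" for A using that by (rule measurable_sets)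
    then show "?B \<subseteq> events" by auto
    fix a b assume "a \<in> ?A" "b \<in> ?B"
    then obtain B u where "B \<in> sets borel" "a = T n -` B \<inter> space P" "b = hold n -` {u<..} \<inter> space P" by auto
    moreover have "T n -` B \<inter> space P = {\<omega> \<in> space P. T n \<omega> \<in> B}" "hold n -` {u<..} \<inter> space P = {\<omega> \<in> space P. u < hold n \<omega>}"
      "{\<omega> \<in> space P. T n \<omega> \<in> B} \<inter> {\<omega> \<in> space P. u < hold n \<omega>} = {\<omega> \<in> space P. T n \<omega> \<in> B \<and> u < hold n \<omega>}" for B u by auto
    ultimately show "prob (a \<inter> b) = prob a * prob b" using tail by simp
  qed
  moreover have "Int_stable ?A"
  proof (rule Int_stableI)
    fix a b assume "a \<in> ?A" "b \<in> ?A"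
    then obtain A B where "A \<in> sets borel" "B \<in> sets borel" "a = T n -` A \<inter> space P" "b = T n -` B \<inter> space P" by auto
    then show "a \<inter> b \<in> ?A" by (auto intro!: exI[of _ "A \<inter> B"])
  qed
  moreover have "Int_stable ?B"
  proof (rule Int_stableI)
    fix a b assume "a \<in> ?B" "b \<in> ?B"
    then obtain u v where uv: "a = hold n -` {u<..} \<inter> space P" "b = hold n -` {v<..} \<inter> space P" by auto
    have "a \<inter> b = hold n -` {max u v<..} \<inter> space P" unfolding uv by auto
    then show "a \<inter> b \<in> ?B" by blast
  qed
  ultimately have "indep_set (sigma_sets (space P) ?A) (sigma_sets (space P) ?B)"
    by (rule indep_set_sigma_sets)
  also have "sigma_sets (space P) ?B = {hold n -` A \<inter> space P |A. A \<in> sigma_sets UNIV (range (\<lambda>a. {a<..}))}"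
    by (rule sigma_sets_vimage_commute[symmetric]) auto
  also have "sigma_sets UNIV (range (\<lambda>a::real. {a<..})) = sets borel"
    by (subst borel_Ioi) (simp add: sets_measure_of)
  finally have "indep_set (sigma_sets (space P) ?A) {hold n -` A \<inter> space P |A. A \<in> sets borel}" .
  moreover have "sigma_sets (space P) {hold n -` A \<inter> space P |A. A \<in> sets borel} = {hold n -` A \<inter> space P |A. A \<in> sets borel}"
    by (subst sigma_sets_vimage_commute[symmetric, where \<Omega>' = UNIV]) (auto simp: sets.sigma_sets_eq[of borel, simplified])
  ultimately show ?thesis unfolding indep_var_eq by simp
qed

text \<open>The mixed term vanishes by independence, so that the variances \<open>h\<^sup>2\<close> of the holding times add up.\<close>

lemma jump_time_variance:
  "integrable P (\<lambda>\<omega>. (T n \<omega> - real n * h)\<^sup>2) \<and> expectation (\<lambda>\<omega>. (T n \<omega> - real n * h)\<^sup>2) = real n * h\<^sup>2"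
proof (induction n)
  case 0
  have "integrable P (\<lambda>\<omega>. (T 0 \<omega> - real 0 * h)\<^sup>2) \<longleftrightarrow> integrable P (\<lambda>\<omega>. 0::real)"
    by (rule Bochner_Integration.integrable_cong) (auto simp: T_0)
  moreover have "expectation (\<lambda>\<omega>. (T 0 \<omega> - real 0 * h)\<^sup>2) = expectation (\<lambda>\<omega>. 0)"
    by (rule Bochner_Integration.integral_cong) (auto simp: T_0)
  ultimately show ?case by simp
next
  case (Suc n)
  have pos: "0 < real (N - 1)" using N2 by simp
  let ?A = "\<lambda>\<omega>. T n \<omega> - real n * h" and ?B = "\<lambda>\<omega>. hold n \<omega> - h"
  have EB: "expectation (hold n) = h" "expectation (\<lambda>\<omega>. (?B \<omega>)\<^sup>2) = h\<^sup>2"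
    using exponential_distributed_expectation[OF pos hold_exponential] exponential_distributed_variance[OF pos hold_exponential]
    by (simp_all add: h_def power_divide)
  \<comment> \<open>A non-integrable function has integral 0, so a positive integral certifies integrability.\<close>
  have iB: "integrable P (hold n)" using EB(1) h not_integrable_integral_eq by fastforce
  have iB2: "integrable P (\<lambda>\<omega>. (?B \<omega>)\<^sup>2)" using EB(2) h not_integrable_integral_eq by fastforce
  have iA2: "integrable P (\<lambda>\<omega>. (?A \<omega>)\<^sup>2)" and EA2: "expectation (\<lambda>\<omega>. (?A \<omega>)\<^sup>2) = real n * h\<^sup>2" using Suc.IH by auto
  have iA: "integrable P ?A"
    by (rule square_integrable_imp_integrable[OF _ iA2]) measurable
  have ind: "indep_var borel ?A borel ?B"
    using indep_var_compose[OF hold_indep[of n], of "\<lambda>x. x - real n * h" borel "\<lambda>x. x - h" borel] by (simp add: comp_def)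
  have iB': "integrable P ?B" using iB by simp
  have iAB: "integrable P (\<lambda>\<omega>. ?A \<omega> * ?B \<omega>)" by (rule indep_var_integrable[OF ind iA iB'])
  have "expectation ?B = 0" using iB EB(1) by (simp add: prob_space)
  then have EAB: "expectation (\<lambda>\<omega>. ?A \<omega> * ?B \<omega>) = 0"
    using indep_var_lebesgue_integral[OF ind iA iB'] by simp
  have eq: "(\<lambda>\<omega>. (T (Suc n) \<omega> - real (Suc n) * h)\<^sup>2) = (\<lambda>\<omega>. (?A \<omega>)\<^sup>2 + 2 * (?A \<omega> * ?B \<omega>) + (?B \<omega>)\<^sup>2)"
    by (rule ext) (simp add: power2_eq_square algebra_simps)
  have "expectation (\<lambda>\<omega>. (?A \<omega>)\<^sup>2 + 2 * (?A \<omega> * ?B \<omega>) + (?B \<omega>)\<^sup>2)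
    = expectation (\<lambda>\<omega>. (?A \<omega>)\<^sup>2) + 2 * expectation (\<lambda>\<omega>. ?A \<omega> * ?B \<omega>) + expectation (\<lambda>\<omega>. (?B \<omega>)\<^sup>2)"
    by (subst Bochner_Integration.integral_add Bochner_Integration.integral_mult_right | (intro Bochner_Integration.integrable_add integrable_mult_right iA2 iAB iB2) | simp only:)+
  then have "expectation (\<lambda>\<omega>. (T (Suc n) \<omega> - real (Suc n) * h)\<^sup>2) = real (Suc n) * h\<^sup>2"
    unfolding eq EA2 EAB EB(2) by (simp add: algebra_simps)
  moreover have "integrable P (\<lambda>\<omega>. (T (Suc n) \<omega> - real (Suc n) * h)\<^sup>2)"
    unfolding eq by (intro Bochner_Integration.integrable_add integrable_mult_right iA2 iAB iB2)
  ultimately show ?case by blast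
qed

lemma prob_large:
  assumes f: "integrable P (\<lambda>\<omega>. (f \<omega>)\<^sup>2)" "expectation (\<lambda>\<omega>. (f \<omega>)\<^sup>2) \<le> v" and d: "0 < \<delta>"
    and [measurable]: "f \<in> borel_measurable P"
  shows "prob {\<omega> \<in> space P. \<delta> < \<bar>f \<omega>\<bar>} \<le> v / \<delta>\<^sup>2"
proof -
  have "prob {\<omega> \<in> space P. \<delta> < \<bar>f \<omega>\<bar>} \<le> prob {\<omega> \<in> space P. \<delta>\<^sup>2 \<le> (f \<omega>)\<^sup>2}"
  proof (rule finite_measure_mono)
    show "{\<omega> \<in> space P. \<delta> < \<bar>f \<omega>\<bar>} \<subseteq> {\<omega> \<in> space P. \<delta>\<^sup>2 \<le> (f \<omega>)\<^sup>2}"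
      using d by (auto simp: abs_le_square_iff[symmetric])
  qed measurable
  also have "\<dots> \<le> expectation (\<lambda>\<omega>. (f \<omega>)\<^sup>2) / \<delta>\<^sup>2"
    by (rule integral_Markov_inequality_measure[OF f(1), of "{}"]) (use d in auto)
  also have "\<dots> \<le> v / \<delta>\<^sup>2" using f(2) by (intro divide_right_mono) auto
  finally show ?thesis .
qed

section \<open>Uniform closeness on a good event\<close>

text \<open>The number of jumps that are expected up to time \<open>k \<delta>\<close>.\<close>

definition grid :: "real \<Rightarrow> nat \<Rightarrow> nat" where
  "grid \<delta> k = nat \<lfloor>real k * \<delta> / h\<rfloor>"

lemma grid_bounds:
  assumes "0 \<le> \<delta>"
  shows "real (grid \<delta> k) * h \<le> real k * \<delta>" "real k * \<delta> < real (grid \<delta> k) * h + h"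
proof -
  have "0 \<le> real k * \<delta> / h" using assms h by simp
  then have "real (grid \<delta> k) \<le> real k * \<delta> / h" "real k * \<delta> / h < real (grid \<delta> k) + 1"
    unfolding grid_def by linarith+
  then show "real (grid \<delta> k) * h \<le> real k * \<delta>" "real k * \<delta> < real (grid \<delta> k) * h + h"
    using h by (simp_all add: field_simps)
qed

lemma T_mono:
  assumes w: "\<omega> \<in> space P" shows "i \<le> j \<Longrightarrow> T i \<omega> \<le> T j \<omega>"
  using lift_Suc_mono_le[of "\<lambda>n. T n \<omega>" i j] T_less[OF w] by (simp add: less_imp_le)

lemma mean_le_Y:
  assumes "w / real N \<le> m" "\<omega> \<in> space P"
  shows "mean_le m (empirical N (Y n \<omega>))"
  by (rule mean_le_empirical) (use N2 assms Y_space[OF assms(2), of n] in \<open>auto simp: space_wealth\<close>)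

text \<open>Between two grid points the chain makes about \<open>\<delta> / h\<close> jumps of size at most \<open>2 / N\<close>, and the jump times
  are squeezed by monotonicity, so that control at the grid points suffices. The constant collects
  \<open>\<delta>\<close> (error at the grid point), \<open>4 \<delta>\<close> (movement of the chain), \<open>12 \<delta>\<close> (movement of the flow during a time
  \<open>3 \<delta>\<close>) and \<open>2 m \<delta>\<close> (parameters between the grid points).\<close>

lemma grid_laplace_close:
  assumes \<mu>: "\<mu> \<in> M1" and m: "mean_le m \<mu>" "w / real N \<le> m" and d: "0 < \<delta>" "h \<le> \<delta>" and w: "\<omega> \<in> space P"
    and small: "\<And>k j. k \<le> K \<Longrightarrow> j \<le> J \<Longrightarrow> \<bar>err \<mu> (grid \<delta> k) (real j * \<delta>) \<omega>\<bar> \<le> \<delta>"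
    and times: "\<And>k. k \<le> K \<Longrightarrow> \<bar>T (grid \<delta> k) \<omega> - real (grid \<delta> k) * h\<bar> \<le> \<delta>"
    and steps: "\<And>n j. \<bar>laplace (empirical N (Y (Suc n) \<omega>)) (real j * \<delta>) - laplace (empirical N (Y n \<omega>)) (real j * \<delta>)\<bar> \<le> 2 / real N"
    and t: "T n \<omega> \<le> t" "t < T (Suc n) \<omega>" "0 \<le> t" "t \<le> (real K - 3) * \<delta>"
  shows "laplace_close (real J * \<delta>) ((17 + 2 * m) * \<delta>) (empirical N (Y n \<omega>)) (flow \<mu> t)"
proof -
  have d0: "0 \<le> \<delta>" using d by simp
  note gb = grid_bounds[OF d0]
  have ends: "n < grid \<delta> K"
  proof (rule ccontr)
    assume "\<not> n < grid \<delta> K"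
    then have "T (grid \<delta> K) \<omega> \<le> T n \<omega>" by (intro T_mono[OF w]) simp
    moreover have "real K * \<delta> - 2 * \<delta> < T (grid \<delta> K) \<omega>" using times[of K] gb(2)[of K] d by linarith
    ultimately show False using t d by (simp add: algebra_simps)
  qed
  have "\<exists>k<K. grid \<delta> k \<le> n \<and> n < grid \<delta> (Suc k)"
    using ends
  proof (induction K)
    case 0 then show ?case by (simp add: grid_def)
  next
    case (Suc K)
    then show ?case by (cases "n < grid \<delta> K") (auto simp: not_less less_Suc_eq)
  qed
  then obtain k where k: "k < K" "grid \<delta> k \<le> n" "n < grid \<delta> (Suc k)" by blast
  define g where "g = grid \<delta> k"
  have gk: "real g * h \<le> real k * \<delta>" "real k * \<delta> < real g * h + h" using gb[of k] by (auto simp: g_def)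
  have gS: "real (grid \<delta> (Suc k)) * h \<le> real k * \<delta> + \<delta>" using gb(1)[of "Suc k"] by (simp add: algebra_simps)
  have ng: "real (n - g) * h \<le> 2 * \<delta>"
  proof -
    have "real (n - g) * h = real n * h - real g * h" using k by (simp add: g_def of_nat_diff algebra_simps)
    also have "real n * h \<le> real (grid \<delta> (Suc k)) * h" using k h by (intro mult_right_mono) auto
    finally show ?thesis using gS gk d by linarith
  qed
  have tg: "\<bar>t - real g * h\<bar> \<le> 3 * \<delta>"
  proof -
    have "T g \<omega> \<le> T n \<omega>" using k by (intro T_mono[OF w]) (simp add: g_def)
    then have "real g * h - \<delta> \<le> t" using t times[of k] k by (simp add: g_def)
    moreover have "T (Suc n) \<omega> \<le> T (grid \<delta> (Suc k)) \<omega>" using k by (intro T_mono[OF w]) simp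
    then have "t \<le> real k * \<delta> + \<delta> + \<delta>" using t times[of "Suc k"] k gS by linarith
    ultimately show ?thesis using gk d by linarith
  qed
  have node: "\<bar>laplace (empirical N (Y n \<omega>)) (real j * \<delta>) - laplace (flow \<mu> t) (real j * \<delta>)\<bar> \<le> 17 * \<delta>" if j: "j \<le> J" for j
  proof -
    let ?f = "\<lambda>i. laplace (empirical N (Y i \<omega>)) (real j * \<delta>)"
    have "\<bar>?f (g + i) - ?f g\<bar> \<le> real i * (2 / real N)" for i
    proof (induction i)
      case (Suc i)
      have "real (Suc i) * (2 / real N) = real i * (2 / real N) + 2 / real N" by (simp add: distrib_right add_divide_distrib)
      then show ?case using Suc steps[of "g + i" j] by (simp only: add_Suc_right)
    qed simp
    from this[of "n - g"] have "\<bar>?f n - ?f g\<bar> \<le> real (n - g) * (2 / real N)" using k by (simp add: g_def)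
    also have "\<dots> \<le> real (n - g) * (2 * h)" using h(2) by (intro mult_left_mono) auto
    also have "\<dots> = 2 * (real (n - g) * h)" by simp
    also have "\<dots> \<le> 4 * \<delta>" using ng by linarith
    finally have 1: "\<bar>?f n - ?f g\<bar> \<le> 4 * \<delta>" .
    have 2: "\<bar>?f g - laplace (flow \<mu> (real g * h)) (real j * \<delta>)\<bar> \<le> \<delta>"
      using small[of k j] k j by (simp add: err_def g_def)
    have "\<bar>laplace (flow \<mu> t) (real j * \<delta>) - laplace (flow \<mu> (real g * h)) (real j * \<delta>)\<bar> \<le> 4 * 1 * \<bar>t - real g * h\<bar>"
      unfolding laplace_def
      by (rule flow_Lipschitz[OF \<mu> bounded_test_exp]) (use d0 h t in auto)
    also have "\<dots> \<le> 12 * \<delta>" using mult_left_mono[OF tg, of 4] by simp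
    finally show ?thesis using 1 2 by (simp only: abs_le_iff) linarith
  qed
  have mf: "mean_le m (flow \<mu> t)" by (rule mean_le_flow[OF \<mu> m(1)])
  have me: "mean_le m (empirical N (Y n \<omega>))" by (rule mean_le_Y[OF m(2) w])
  have "laplace_close (real J * \<delta>) (17 * \<delta> + 2 * m * \<delta>) (empirical N (Y n \<omega>)) (flow \<mu> t)"
    by (rule laplace_close_grid[OF empirical_in_M1[OF N2 Y_space[OF w]] me flow_M1[OF \<mu>] mf d(1) node])
  then show ?thesis by (simp add: algebra_simps)
qed

text \<open>Chebyshev's inequality at each grid point and a union bound. The number of grid points depends
  on \<open>\<delta>\<close> but not on the number of agents, so that the union costs only a constant factor.\<close>

lemma good_event:
  assumes \<mu>: "\<mu> \<in> M1" and m: "mean_le m \<mu>" "w / real N \<le> m" and d: "0 < \<delta>" "h \<le> \<delta>" and e0: "0 \<le> e0"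
    and init: "\<And>l. 0 \<le> l \<Longrightarrow> l \<le> real J * \<delta> \<Longrightarrow> expectation (\<lambda>\<omega>. (err \<mu> 0 l \<omega>)\<^sup>2) \<le> e0"
  obtains B where "B \<in> events"
    "prob B \<le> real (Suc K) * (real (Suc J) * (exp (8 * (real K * \<delta>)) * (e0 + 140 * (real K * \<delta>) * h) / \<delta>\<^sup>2) + real K * \<delta> * h / \<delta>\<^sup>2)"
    "\<And>\<omega> n t. \<omega> \<in> space P - B \<Longrightarrow> T n \<omega> \<le> t \<Longrightarrow> t < T (Suc n) \<omega> \<Longrightarrow> 0 \<le> t \<Longrightarrow> t \<le> (real K - 3) * \<delta> \<Longrightarrow>
       laplace_close (real J * \<delta>) ((17 + 2 * m) * \<delta>) (empirical N (Y n \<omega>)) (flow \<mu> t)"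
proof -
  have d0: "0 \<le> \<delta>" using d by simp
  have "AE \<omega> in P. \<forall>n j. \<bar>laplace (empirical N (Y (Suc n) \<omega>)) (real j * \<delta>) - laplace (empirical N (Y n \<omega>)) (real j * \<delta>)\<bar> \<le> 2 / real N"
    unfolding AE_all_countable by (intro allI laplace_step_close) (use d0 in auto)
  then obtain Z where Z: "Z \<in> null_sets P"
    "{\<omega> \<in> space P. \<not> (\<forall>n j. \<bar>laplace (empirical N (Y (Suc n) \<omega>)) (real j * \<delta>) - laplace (empirical N (Y n \<omega>)) (real j * \<delta>)\<bar> \<le> 2 / real N)} \<subseteq> Z"
    by (auto simp: eventually_ae_filter)
  define B1 where "B1 k j = {\<omega> \<in> space P. \<delta> < \<bar>err \<mu> (grid \<delta> k) (real j * \<delta>) \<omega>\<bar>}" for k j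
  define B2 where "B2 k = {\<omega> \<in> space P. \<delta> < \<bar>T (grid \<delta> k) \<omega> - real (grid \<delta> k) * h\<bar>}" for k
  have ev: "B1 k j \<in> events" "B2 k \<in> events" for k j unfolding B1_def B2_def by measurable
  let ?v1 = "exp (8 * (real K * \<delta>)) * (e0 + 140 * (real K * \<delta>) * h) / \<delta>\<^sup>2"
  let ?v2 = "real K * \<delta> * h / \<delta>\<^sup>2"
  have gK: "real (grid \<delta> k) * h \<le> real K * \<delta>" if "k \<le> K" for k
  proof -
    have "real k * \<delta> \<le> real K * \<delta>" using that d0 by (intro mult_right_mono) auto
    with grid_bounds(1)[OF d0, of k] show ?thesis by linarith
  qed
  have p1: "prob (B1 k j) \<le> ?v1" if k: "k \<le> K" and j: "j \<le> J" for k j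
    unfolding B1_def
  proof (rule prob_large[OF err_integrable[OF \<mu>] _ d(1)])
    have jl: "0 \<le> real j * \<delta>" "real j * \<delta> \<le> real J * \<delta>" using j d0 by (auto intro: mult_right_mono)
    let ?g = "real (grid \<delta> k)"
    have "expectation (\<lambda>\<omega>. (err \<mu> (grid \<delta> k) (real j * \<delta>) \<omega>)\<^sup>2) \<le> exp (8 * (?g * h)) * (e0 + 140 * (?g * h) * h)"
      using mean_square_error[OF \<mu> e0 init jl, of "grid \<delta> k"] by (simp add: power2_eq_square mult.assoc)
    also have "\<dots> \<le> exp (8 * (real K * \<delta>)) * (e0 + 140 * (real K * \<delta>) * h)"
    proof (rule mult_mono)
      show "exp (8 * (?g * h)) \<le> exp (8 * (real K * \<delta>))" using gK[OF k] by simp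
      show "e0 + 140 * (?g * h) * h \<le> e0 + 140 * (real K * \<delta>) * h"
        using mult_right_mono[OF gK[OF k], of h] h by simp
      show "0 \<le> e0 + 140 * (?g * h) * h" using e0 h by simp
    qed simp
    finally show "expectation (\<lambda>\<omega>. (err \<mu> (grid \<delta> k) (real j * \<delta>) \<omega>)\<^sup>2) \<le> exp (8 * (real K * \<delta>)) * (e0 + 140 * (real K * \<delta>) * h)" .
  qed (use d0 in auto)
  have p2: "prob (B2 k) \<le> ?v2" if k: "k \<le> K" for k
    unfolding B2_def
  proof (rule prob_large[OF _ _ d(1)])
    show "expectation (\<lambda>\<omega>. (T (grid \<delta> k) \<omega> - real (grid \<delta> k) * h)\<^sup>2) \<le> real K * \<delta> * h"
      using jump_time_variance[of "grid \<delta> k"] mult_right_mono[OF gK[OF k], of h] h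
      by (simp add: power2_eq_square mult.assoc)
  qed (use jump_time_variance[of "grid \<delta> k"] in auto)
  define B where "B = Z \<union> (\<Union>k\<in>{..K}. (\<Union>j\<in>{..J}. B1 k j) \<union> B2 k)"
  have U: "(\<Union>k\<in>{..K}. (\<Union>j\<in>{..J}. B1 k j) \<union> B2 k) \<in> events" using ev by auto
  show ?thesis
  proof (rule that[of B])
    show "B \<in> events" unfolding B_def using U Z by auto
    have "prob B = prob (\<Union>k\<in>{..K}. (\<Union>j\<in>{..J}. B1 k j) \<union> B2 k)"
      unfolding B_def by (subst Un_commute, rule measure_Un_null_set[OF U Z(1)])
    also have "\<dots> \<le> (\<Sum>k\<le>K. prob ((\<Union>j\<in>{..J}. B1 k j) \<union> B2 k))"
      using ev by (intro finite_measure_subadditive_finite) auto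
    also have "\<dots> \<le> (\<Sum>k\<le>K. real (Suc J) * ?v1 + ?v2)"
    proof (rule sum_mono)
      fix k assume "k \<in> {..K}" then have k: "k \<le> K" by simp
      have "prob ((\<Union>j\<in>{..J}. B1 k j) \<union> B2 k) \<le> prob (\<Union>j\<in>{..J}. B1 k j) + prob (B2 k)"
        using ev by (intro measure_Un_le) auto
      moreover have "prob (\<Union>j\<in>{..J}. B1 k j) \<le> (\<Sum>j\<le>J. prob (B1 k j))"
        using ev by (intro finite_measure_subadditive_finite) auto
      moreover have "\<dots> \<le> (\<Sum>j\<le>J. ?v1)" by (rule sum_mono) (use p1[OF k] in auto)
      ultimately show "prob ((\<Union>j\<in>{..J}. B1 k j) \<union> B2 k) \<le> real (Suc J) * ?v1 + ?v2"
        using p2[OF k] by simp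
    qed
    also have "\<dots> = real (Suc K) * (real (Suc J) * ?v1 + ?v2)" by simp
    finally show "prob B \<le> real (Suc K) * (real (Suc J) * ?v1 + ?v2)" .
    fix \<omega> n t
    assume w: "\<omega> \<in> space P - B" and t: "T n \<omega> \<le> t" "t < T (Suc n) \<omega>" "0 \<le> t" "t \<le> (real K - 3) * \<delta>"
    show "laplace_close (real J * \<delta>) ((17 + 2 * m) * \<delta>) (empirical N (Y n \<omega>)) (flow \<mu> t)"
    proof (rule grid_laplace_close[OF \<mu> m d _ _ _ _ t])
      show "\<bar>err \<mu> (grid \<delta> k) (real j * \<delta>) \<omega>\<bar> \<le> \<delta>" if "k \<le> K" "j \<le> J" for k j
        using w that by (auto simp: B_def B1_def not_less)
      show "\<bar>T (grid \<delta> k) \<omega> - real (grid \<delta> k) * h\<bar> \<le> \<delta>" if "k \<le> K" for k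
        using w that by (auto simp: B_def B2_def not_less)
      show "\<bar>laplace (empirical N (Y (Suc n) \<omega>)) (real j * \<delta>) - laplace (empirical N (Y n \<omega>)) (real j * \<delta>)\<bar> \<le> 2 / real N" for n j
        using w Z(2) by (auto simp: B_def)
    qed (use w in auto)
  qed
qed

end

section \<open>Paths of the particle system\<close>

locale particle_process = exchange_process +
  fixes X :: "real \<Rightarrow> 'a \<Rightarrow> nat \<Rightarrow> real"
  assumes T_top: "\<And>\<omega>. \<omega> \<in> space P \<Longrightarrow> filterlim (\<lambda>n. T n \<omega>) at_top sequentially"
    and X_eq: "\<And>\<omega> n t. \<omega> \<in> space P \<Longrightarrow> T n \<omega> \<le> t \<Longrightarrow> t < T (Suc n) \<omega> \<Longrightarrow> X t \<omega> = Y n \<omega>"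
begin

lemma current_jump:
  assumes w: "\<omega> \<in> space P" and t: "0 \<le> t"
  obtains n where "T n \<omega> \<le> t" "t < T (Suc n) \<omega>"
proof -
  have "\<forall>\<^sub>F n in sequentially. t < T n \<omega>"
    using T_top[OF w] by (simp add: filterlim_at_top_dense)
  then have ex: "\<exists>n. t < T n \<omega>" by (auto simp: eventually_sequentially)
  define n where "n = (LEAST n. t < T n \<omega>)"
  have n: "t < T n \<omega>" unfolding n_def by (rule LeastI_ex[OF ex])
  have "n \<noteq> 0" using n t T_0[OF w] by (cases n) auto
  then obtain k where k: "n = Suc k" by (cases n) auto
  have "\<not> t < T k \<omega>" using not_less_Least[of k "\<lambda>n. t < T n \<omega>"] k by (simp add: n_def)
  with n k that show ?thesis by (simp add: not_less)
qed

lemma X_space: "\<omega> \<in> space P \<Longrightarrow> 0 \<le> t \<Longrightarrow> X t \<omega> \<in> space S"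
  by (metis current_jump X_eq Y_space)

lemma X_M1: "\<omega> \<in> space P \<Longrightarrow> 0 \<le> t \<Longrightarrow> empirical N (X t \<omega>) \<in> M1"
  by (rule empirical_in_M1[OF N2 X_space])

text \<open>The path is constant to the right of each time up to the next jump, and to the left of each
  positive time down to the previous one.\<close>

lemma cadlag_empirical:
  assumes w: "\<omega> \<in> space P"
  shows "(\<lambda>t. empirical N (X t \<omega>)) \<in> cadlag_paths"
  unfolding cadlag_paths_def
proof (intro CollectI allI impI conjI)
  fix t :: real assume t: "0 \<le> t"
  obtain n where n: "T n \<omega> \<le> t" "t < T (Suc n) \<omega>" using current_jump[OF w t] .
  show M: "empirical N (X t \<omega>) \<in> M1" by (rule X_M1[OF w t])
  have "\<forall>\<^sub>F s in at_right t. s \<in> {t<..<T (Suc n) \<omega>}" using n by (intro eventually_at_right_real) simp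
  then have "\<forall>\<^sub>F s in at_right t. empirical N (X s \<omega>) = empirical N (X t \<omega>)"
  proof eventually_elim
    case (elim s)
    then show ?case using X_eq[OF w, of n s] X_eq[OF w, of n t] n by simp
  qed
  with M show "limitin weak_topology (\<lambda>t. empirical N (X t \<omega>)) (empirical N (X t \<omega>)) (at_right t)"
    by (intro limitin_eventually) (simp_all add: topspace_weak_topology)
  assume t0: "0 < t"
  obtain k where k: "T k \<omega> < t" "t \<le> T (Suc k) \<omega>"
  proof (cases "T n \<omega> < t")
    case True then show ?thesis using that[of n] n by simp
  next
    case False
    with n have e: "T n \<omega> = t" by simp
    with t0 T_0[OF w] obtain k where "n = Suc k" by (cases n) auto
    then show ?thesis using that[of k] T_less[OF w, of k] e by simp
  qed
  have "\<forall>\<^sub>F s in at_left t. s \<in> {T k \<omega><..<t}" using k by (intro eventually_at_left_real) simp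
  then have "\<forall>\<^sub>F s in at_left t. empirical N (X s \<omega>) = empirical N (Y k \<omega>)"
  proof eventually_elim
    case (elim s)
    then show ?case using X_eq[OF w, of k s] k by simp
  qed
  then have "limitin weak_topology (\<lambda>t. empirical N (X t \<omega>)) (empirical N (Y k \<omega>)) (at_left t)"
    by (intro limitin_eventually) (simp_all add: topspace_weak_topology empirical_in_M1[OF N2 Y_space[OF w]])
  then show "\<exists>l. limitin weak_topology (\<lambda>t. empirical N (X t \<omega>)) l (at_left t)" by blast
qed

text \<open>A step function is a series of multiples of indicators of intervals, hence Borel. Boundedness
  then gives integrability.\<close>

lemma step_path_integrable:
  fixes F :: "(nat \<Rightarrow> real) \<Rightarrow> real"
  assumes w: "\<omega> \<in> space P" and b: "\<And>x. x \<in> space S \<Longrightarrow> \<bar>F x\<bar> \<le> C"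
  shows "set_integrable lborel {0..t} (\<lambda>s. F (X s \<omega>))"
proof -
  let ?I = "\<lambda>n. {0..t} \<inter> {T n \<omega>..<T (Suc n) \<omega>}"
  have eq: "indicator {0..t} s * F (X s \<omega>) = (\<Sum>n. indicator (?I n) s * F (Y n \<omega>))" for s
  proof (cases "s \<in> {0..t}")
    case True
    then obtain k where k: "T k \<omega> \<le> s" "s < T (Suc k) \<omega>" using current_jump[OF w, of s] by auto
    have "indicator (?I n) s * F (Y n \<omega>) = 0" if "n \<notin> {k}" for n
    proof -
      have "s \<notin> {T n \<omega>..<T (Suc n) \<omega>}"
      proof (cases "n < k")
        case True then show ?thesis using T_mono[OF w, of "Suc n" k] k by auto
      next
        case False then show ?thesis using T_mono[OF w, of "Suc k" n] k that by auto
      qed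
      then show ?thesis by simp
    qed
    then have "(\<Sum>n. indicator (?I n) s * F (Y n \<omega>)) = (\<Sum>n\<in>{k}. indicator (?I n) s * F (Y n \<omega>))"
      by (intro suminf_finite) auto
    with True k show ?thesis using X_eq[OF w k] by simp
  next
    case False
    then have "(\<lambda>n. indicator (?I n) s * F (Y n \<omega>)) = (\<lambda>n. 0)" by (intro ext) auto
    with False show ?thesis by (simp only:) simp
  qed
  have m: "(\<lambda>s. indicator {0..t} s * F (X s \<omega>)) \<in> borel_measurable lborel"
    unfolding eq by measurable
  have "integrable lborel (\<lambda>s. indicator {0..t} s *\<^sub>R (indicator {0..t} s * F (X s \<omega>)))"
    by (rule integrableI_bounded_set_indicator[where B = C, OF _ m])
      (use b X_space[OF w] in \<open>auto simp: emeasure_lborel_Icc_eq\<close>)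
  moreover have "(\<lambda>s. indicator {0..t} s *\<^sub>R (indicator {0..t} s * F (X s \<omega>))) = (\<lambda>s. indicator {0..t} s *\<^sub>R F (X s \<omega>))"
    by (auto simp: indicator_def)
  ultimately show ?thesis unfolding set_integrable_def by simp
qed

lemma QN_path_integrable:
  assumes w: "\<omega> \<in> space P" and g: "bounded_test B g"
  shows "set_integrable lborel {0..t} (\<lambda>s. QN N w (empirical N (X s \<omega>)) g)"
proof (rule step_path_integrable[OF assms(1), where C = "4 * B + 4 * B / real N"])
  fix x assume x: "x \<in> space S"
  show "\<bar>QN N w (empirical N x) g\<bar> \<le> 4 * B + 4 * B / real N"
    using QN_close_Q[OF x g] Q_infinity_bound[OF empirical_in_M1[OF N2 x] g] N2 by auto
qed

end

lemma particle_processI: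
  assumes ps: "particle_system N w P X" and N: "2 \<le> N"
  obtains T Y where "particle_process P N w T Y X"
proof -
  note rep = ps[unfolded particle_system_def markov_jump_process_def]
  interpret prob_space P by (rule conjunct1[OF rep])
  have "\<exists>T Y. particle_process P N w T Y X"
    using conjunct2[OF rep]
  proof (elim exE conjE)
    fix T Y
    assume a: "\<forall>n. T n \<in> borel_measurable P \<and> Y n \<in> measurable P (wealth_space N w)"
      "\<forall>\<omega>\<in>space P. T 0 \<omega> = 0 \<and> (\<forall>n. T n \<omega> < T (Suc n) \<omega>) \<and> filterlim (\<lambda>n. T n \<omega>) at_top sequentially"
      "\<forall>\<omega>\<in>space P. \<forall>t n. T n \<omega> \<le> t \<and> t < T (Suc n) \<omega> \<longrightarrow> X t \<omega> = Y n \<omega>"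
      "\<forall>n. \<forall>C \<in> sets (\<Pi>\<^sub>M k\<in>{..n}. borel \<Otimes>\<^sub>M wealth_space N w). \<forall>u\<ge>0. \<forall>A \<in> sets (wealth_space N w).
           measure P {\<omega> \<in> space P. (\<lambda>k\<in>{..n}. (T k \<omega>, Y k \<omega>)) \<in> C
                        \<and> u < T (Suc n) \<omega> - T n \<omega> \<and> Y (Suc n) \<omega> \<in> A}
           = (\<integral>\<omega>\<in>{\<omega> \<in> space P. (\<lambda>k\<in>{..n}. (T k \<omega>, Y k \<omega>)) \<in> C}.
                exp (- exchange_rate N (Y n \<omega>) (space (wealth_space N w)) * u)
                * (exchange_rate N (Y n \<omega>) A / exchange_rate N (Y n \<omega>) (space (wealth_space N w))) \<partial>P)"
    have "particle_process P N w T Y X"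
    proof (unfold_locales, goal_cases)
      case 1 show ?case by (rule N)
    next
      case 2 show ?case using a(1) by blast
    next
      case 3 show ?case using a(1) by blast
    next
      case 4 then show ?case using a(2) by blast
    next
      case 5 then show ?case using a(2) by blast
    next
      case (6 n C u A)
      show ?case using a(4)[rule_format, of C n u A, OF 6(1) 6(2) 6(3)] .
    next
      case 7 then show ?case using a(2) by blast
    next
      case 8 then show ?case using a(3) by blast
    qed
    then show ?thesis by blast
  qed
  then show ?thesis using that by blast
qed

section \<open>Events of high probability\<close>

text \<open>With high probability: the exceptional set, measurable or not, is covered by measurable events whose
  probability tends to 0. This is the outer measure of \<open>tendsto_in_prob\<close> in a form that events can be
  combined in.\<close>

definition whp :: "(nat \<Rightarrow> 'w measure) \<Rightarrow> (nat \<Rightarrow> 'w \<Rightarrow> bool) \<Rightarrow> bool" where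
  "whp P E \<longleftrightarrow> (\<forall>\<epsilon>>0. \<forall>\<^sub>F n in sequentially.
     \<exists>B\<in>sets (P n). emeasure (P n) B \<le> ennreal \<epsilon> \<and> {\<omega> \<in> space (P n). \<not> E n \<omega>} \<subseteq> B)"

lemma whp_mono:
  assumes E: "whp P E" and "\<forall>\<^sub>F n in sequentially. \<forall>\<omega>\<in>space (P n). E n \<omega> \<longrightarrow> F n \<omega>"
  shows "whp P F"
  unfolding whp_def
proof (intro allI impI)
  fix \<epsilon> :: real assume "0 < \<epsilon>"
  with E have "\<forall>\<^sub>F n in sequentially. \<exists>B\<in>sets (P n). emeasure (P n) B \<le> ennreal \<epsilon> \<and> {\<omega> \<in> space (P n). \<not> E n \<omega>} \<subseteq> B"
    by (simp add: whp_def)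
  with assms(2) show "\<forall>\<^sub>F n in sequentially. \<exists>B\<in>sets (P n). emeasure (P n) B \<le> ennreal \<epsilon> \<and> {\<omega> \<in> space (P n). \<not> F n \<omega>} \<subseteq> B"
  proof eventually_elim
    case (elim n)
    then obtain B where B: "B \<in> sets (P n)" "emeasure (P n) B \<le> ennreal \<epsilon>" "{\<omega> \<in> space (P n). \<not> E n \<omega>} \<subseteq> B" by blast
    have "{\<omega> \<in> space (P n). \<not> F n \<omega>} \<subseteq> B" using elim(1) B(3) by blast
    with B show ?case by blast
  qed
qed

lemma tendsto_in_prob_iff_whp:
  "tendsto_in_prob P X Z c \<longleftrightarrow> c \<in> topspace X \<and> (\<forall>U. openin X U \<and> c \<in> U \<longrightarrow> whp P (\<lambda>n \<omega>. Z n \<omega> \<in> U))"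
proof -
  have "(\<lambda>n. outer_measure_of (P n) {\<omega> \<in> space (P n). Z n \<omega> \<notin> U}) \<longlonglongrightarrow> 0 \<longleftrightarrow> whp P (\<lambda>n \<omega>. Z n \<omega> \<in> U)" for U
  proof
    assume lim: "(\<lambda>n. outer_measure_of (P n) {\<omega> \<in> space (P n). Z n \<omega> \<notin> U}) \<longlonglongrightarrow> 0"
    show "whp P (\<lambda>n \<omega>. Z n \<omega> \<in> U)" unfolding whp_def
    proof (intro allI impI)
      fix \<epsilon> :: real assume "0 < \<epsilon>"
      then have "\<forall>\<^sub>F n in sequentially. outer_measure_of (P n) {\<omega> \<in> space (P n). Z n \<omega> \<notin> U} < ennreal \<epsilon>"
        by (intro order_tendstoD(2)[OF lim]) simp
      then show "\<forall>\<^sub>F n in sequentially. \<exists>B\<in>sets (P n). emeasure (P n) B \<le> ennreal \<epsilon> \<and> {\<omega> \<in> space (P n). Z n \<omega> \<notin> U} \<subseteq> B"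
      proof eventually_elim
        case (elim n)
        obtain B where "B \<in> sets (P n)" "{\<omega> \<in> space (P n). Z n \<omega> \<notin> U} \<subseteq> B"
          "outer_measure_of (P n) {\<omega> \<in> space (P n). Z n \<omega> \<notin> U} = emeasure (P n) B"
          using outer_measure_of_attain[of "{\<omega> \<in> space (P n). Z n \<omega> \<notin> U}" "P n"] by auto
        with elim show ?case by (intro bexI[of _ B]) auto
      qed
    qed
  next
    assume w: "whp P (\<lambda>n \<omega>. Z n \<omega> \<in> U)"
    show "(\<lambda>n. outer_measure_of (P n) {\<omega> \<in> space (P n). Z n \<omega> \<notin> U}) \<longlonglongrightarrow> 0"
    proof (rule order_tendstoI)
      fix a :: ennreal assume "0 < a"
      then obtain r where r: "0 < r" "ennreal r < a"
        by (metis dense ennreal_cases ennreal_less_zero_iff less_top_ennreal order.strict_trans ennreal_lessI)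
      have "\<forall>\<^sub>F n in sequentially. \<exists>B\<in>sets (P n). emeasure (P n) B \<le> ennreal r \<and> {\<omega> \<in> space (P n). Z n \<omega> \<notin> U} \<subseteq> B"
        using w r by (simp add: whp_def)
      then show "\<forall>\<^sub>F n in sequentially. outer_measure_of (P n) {\<omega> \<in> space (P n). Z n \<omega> \<notin> U} < a"
      proof eventually_elim
        case (elim n)
        then obtain B where B: "B \<in> sets (P n)" "emeasure (P n) B \<le> ennreal r" "{\<omega> \<in> space (P n). Z n \<omega> \<notin> U} \<subseteq> B" by blast
        have "outer_measure_of (P n) {\<omega> \<in> space (P n). Z n \<omega> \<notin> U} \<le> emeasure (P n) B"
          using outer_measure_of_mono[OF B(3), of "P n"] B(1) by simp
        with B(2) r(2) show ?case by order
      qed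
    qed simp
  qed
  then show ?thesis by (simp add: tendsto_in_prob_def)
qed

lemma tendsto_in_prob_realI:
  fixes Z :: "nat \<Rightarrow> 'w \<Rightarrow> real"
  assumes "\<And>\<delta>. 0 < \<delta> \<Longrightarrow> whp P (\<lambda>n \<omega>. \<bar>Z n \<omega> - c\<bar> \<le> \<delta>)"
  shows "tendsto_in_prob P euclideanreal Z c"
  unfolding tendsto_in_prob_iff_whp
proof (intro conjI allI impI)
  fix U assume "openin euclideanreal U \<and> c \<in> U"
  then obtain e where e: "0 < e" "ball c e \<subseteq> U" by (auto simp: open_contains_ball)
  show "whp P (\<lambda>n \<omega>. Z n \<omega> \<in> U)"
  proof (rule whp_mono[OF assms[of "e / 2"]])
    show "\<forall>\<^sub>F n in sequentially. \<forall>\<omega>\<in>space (P n). \<bar>Z n \<omega> - c\<bar> \<le> e / 2 \<longrightarrow> Z n \<omega> \<in> U"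
    proof (intro always_eventually allI ballI impI)
      fix n \<omega> assume "\<bar>Z n \<omega> - c\<bar> \<le> e / 2"
      then have "Z n \<omega> \<in> ball c e" using e by (simp add: dist_real_def abs_minus_commute)
      with e(2) show "Z n \<omega> \<in> U" by blast
    qed
  qed (use e in auto)
qed simp

section \<open>Uniform closeness implies closeness in the Skorokhod space\<close>

lemma topspace_skorokhod: "topspace skorokhod_topology = cadlag_paths"
proof -
  have "openin skorokhod_topology cadlag_paths"
    unfolding openin_skorokhod_topology skorokhod_open_def by (auto intro: exI[of _ 1])
  moreover have "openin skorokhod_topology (topspace skorokhod_topology)" by simp
  then have "topspace skorokhod_topology \<subseteq> cadlag_paths"
    unfolding openin_skorokhod_topology skorokhod_open_def by blast
  ultimately show ?thesis using openin_subset by blast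
qed

lemma cadlag_flow:
  assumes \<mu>: "\<mu> \<in> M1" shows "flow \<mu> \<in> cadlag_paths"
proof -
  have lim: "limitin weak_topology (flow \<mu>) (flow \<mu> t) (at t within A)"
    if t: "0 \<le> t" and A: "\<forall>\<^sub>F s in at t within A. 0 \<le> s" for t A
    unfolding limitin_def
  proof (intro conjI allI impI)
    show "flow \<mu> t \<in> topspace weak_topology" using flow_M1[OF \<mu>] by (simp add: topspace_weak_topology)
    fix U assume U: "openin weak_topology U \<and> flow \<mu> t \<in> U"
    then have "openin (top_of_set {0..}) {s \<in> topspace (top_of_set {0..}). flow \<mu> s \<in> U}"
      using continuous_map_flow[OF \<mu>] openin_continuous_map_preimage by blast
    then obtain V where V: "open V" "{s \<in> topspace (top_of_set {0..}). flow \<mu> s \<in> U} = {0..} \<inter> V"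
      by (auto simp: openin_open)
    have "t \<in> {0..} \<inter> V" using U t unfolding V(2)[symmetric] by simp
    then have "\<forall>\<^sub>F s in at t within A. s \<in> V"
      using V(1) by (intro topological_tendstoD[OF tendsto_ident_at]) auto
    with A show "\<forall>\<^sub>F s in at t within A. flow \<mu> s \<in> U"
    proof eventually_elim
      case (elim s)
      then have "s \<in> {0..} \<inter> V" by simp
      then show ?case unfolding V(2)[symmetric] by simp
    qed
  qed
  show ?thesis unfolding cadlag_paths_def
  proof (intro CollectI allI impI conjI)
    fix t :: real assume t: "0 \<le> t"
    show "flow \<mu> t \<in> M1" by (rule flow_M1[OF \<mu>])
    have "\<forall>\<^sub>F s in at_right t. t < s" by (simp add: eventually_at_filter)
    then have "\<forall>\<^sub>F s in at_right t. 0 \<le> s" by eventually_elim (use t in simp)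
    then show "limitin weak_topology (flow \<mu>) (flow \<mu> t) (at_right t)" by (rule lim[OF t])
    assume "0 < t"
    then have "\<forall>\<^sub>F s in at_left t. s \<in> {0<..<t}" by (rule eventually_at_left_real)
    then have "\<forall>\<^sub>F s in at_left t. 0 \<le> s" by eventually_elim simp
    then show "\<exists>l. limitin weak_topology (flow \<mu>) l (at_left t)" using lim[OF t] by blast
  qed
qed

lemma nn_integral_exp_tail: "(\<integral>\<^sup>+u. ennreal (exp (- u)) * indicator {a..} u \<partial>lborel) = ennreal (exp (- a))"
proof -
  have "((\<lambda>u::real. - exp (- u)) \<longlongrightarrow> - 0) at_top"
    by (intro tendsto_minus filterlim_compose[OF exp_at_bot] filterlim_uminus_at_bot_at_top)
  then have "(\<integral>\<^sup>+u. ennreal (exp (- u)) * indicator {a..} u \<partial>lborel) = ennreal (- 0 - - exp (- a))"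
    by (intro nn_integral_FTC_atLeast[where F = "\<lambda>u. - exp (- u)"]) (auto intro!: derivative_eq_intros)
  then show ?thesis by simp
qed

text \<open>The identity is an admissible time change with vanishing log-slope. The exponential weight makes
  times beyond \<open>c\<close> contribute at most \<open>exp (- c)\<close>, as the Prokhorov metric is bounded by 1.\<close>

lemma skorokhod_dist_le_uniform:
  assumes close: "\<And>s. 0 \<le> s \<Longrightarrow> s \<le> c \<Longrightarrow> prokhorov (x s) (y s) \<le> e"
    and one: "\<And>s. 0 \<le> s \<Longrightarrow> prokhorov (x s) (y s) \<le> 1" and c: "0 \<le> c" and e: "0 \<le> e"
  shows "skorokhod_dist x y \<le> ennreal (e + exp (- c))"
proof -
  have id: "(\<lambda>t. t) \<in> time_changes"
    by (auto simp: time_changes_def strict_mono_on_def bij_betw_def inj_on_def)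
  have log: "log_slope (\<lambda>t. t) = 0"
  proof -
    have "log_slope (\<lambda>t. t) \<le> 0" unfolding log_slope_def by (rule SUP_least) auto
    then show ?thesis by simp
  qed
  let ?s = "\<lambda>u. SUP t \<in> {0..}. ennreal (prokhorov (x (min t u)) (y (min t u)))"
  have s1: "?s u \<le> 1" if "0 \<le> u" for u
    using that by (intro SUP_least) (auto simp: one ennreal_le_1)
  have s2: "?s u \<le> ennreal e" if "0 \<le> u" "u \<le> c" for u
    using that by (intro SUP_least ennreal_leI close) auto
  have "skorokhod_dist x y \<le> max (log_slope (\<lambda>t. t)) (\<integral>\<^sup>+u\<in>{0..}. ennreal (exp (- u)) * ?s u \<partial>lborel)"
    unfolding skorokhod_dist_def by (rule INF_lower2[OF id]) simp
  also have "\<dots> = (\<integral>\<^sup>+u\<in>{0..}. ennreal (exp (- u)) * ?s u \<partial>lborel)" by (simp add: log)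
  also have "\<dots> \<le> (\<integral>\<^sup>+u. ennreal e * (ennreal (exp (- u)) * indicator {0..} u) + ennreal (exp (- u)) * indicator {c..} u \<partial>lborel)"
  proof (rule nn_integral_mono)
    fix u :: real
    show "ennreal (exp (- u)) * ?s u * indicator {0..} u
      \<le> ennreal e * (ennreal (exp (- u)) * indicator {0..} u) + ennreal (exp (- u)) * indicator {c..} u"
    proof (cases "0 \<le> u")
      case u: True
      show ?thesis
      proof (cases "u \<le> c")
        case True
        have "ennreal (exp (- u)) * ?s u \<le> ennreal (exp (- u)) * ennreal e" by (intro mult_left_mono s2 u True) simp
        also have "\<dots> \<le> ennreal e * ennreal (exp (- u)) + ennreal (exp (- u)) * indicator {c..} u"
          by (simp add: mult.commute)
        finally show ?thesis using u by simp
      next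
        case False
        have "ennreal (exp (- u)) * ?s u \<le> ennreal (exp (- u)) * 1" by (intro mult_left_mono s1 u) simp
        also have "\<dots> \<le> ennreal e * ennreal (exp (- u)) + ennreal (exp (- u)) * indicator {c..} u"
          using False by simp
        finally show ?thesis using u by simp
      qed
    qed simp
  qed
  also have "\<dots> = ennreal e * ennreal (exp (- 0)) + ennreal (exp (- c))"
    by (subst nn_integral_add) (auto simp: nn_integral_cmult nn_integral_exp_tail)
  also have "\<dots> = ennreal (e + exp (- c))" using e by (simp add: ennreal_plus)
  finally show ?thesis .
qed

section \<open>The limit of the particle systems\<close>

text \<open>The hypotheses in the form in which they are used; \<open>m\<close> bounds the means of the initial law and of
  all empirical measures.\<close>

locale exchange_limit =
  fixes P :: "nat \<Rightarrow> 'w measure" and W :: "nat \<Rightarrow> real" and X :: "nat \<Rightarrow> real \<Rightarrow> 'w \<Rightarrow> nat \<Rightarrow> real"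
    and \<mu>0 :: "real measure" and m :: real
  assumes system: "\<And>N. 2 \<le> N \<Longrightarrow> particle_system N (W N) (P N) (X N)"
    and \<mu>0: "\<mu>0 \<in> M1" and mean: "mean_le m \<mu>0"
    and wealth: "\<And>N. 2 \<le> N \<Longrightarrow> W N / real N \<le> m"
    and initial: "tendsto_in_prob P weak_topology (\<lambda>N \<omega>. empirical N (X N 0 \<omega>)) \<mu>0"
begin

abbreviation "emp N t \<omega> \<equiv> empirical N (X N t \<omega>)"

lemma m_nonneg: "0 \<le> m"
  using mean by (simp add: mean_le_def)

lemma state_space:
  assumes "2 \<le> N" "\<omega> \<in> space (P N)" "0 \<le> t"
  shows "X N t \<omega> \<in> space (wealth_space N (W N))"
proof -
  obtain T Y where "particle_process (P N) N (W N) T Y (X N)" using particle_processI[OF system[OF assms(1)] assms(1)] .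
  then interpret particle_process "P N" N "W N" T Y "X N" .
  show ?thesis by (rule X_space[OF assms(2,3)])
qed

lemma emp_M1: "2 \<le> N \<Longrightarrow> \<omega> \<in> space (P N) \<Longrightarrow> 0 \<le> t \<Longrightarrow> emp N t \<omega> \<in> M1"
  by (rule empirical_in_M1[OF _ state_space])

lemma emp_mean_le:
  assumes "2 \<le> N" "\<omega> \<in> space (P N)" "0 \<le> t"
  shows "mean_le m (emp N t \<omega>)"
  by (rule mean_le_empirical) (use assms wealth[OF assms(1)] state_space[OF assms] in \<open>auto simp: space_wealth\<close>)

lemma emp_cadlag:
  assumes "2 \<le> N" "\<omega> \<in> space (P N)"
  shows "(\<lambda>t. emp N t \<omega>) \<in> cadlag_paths"
proof -
  obtain T Y where "particle_process (P N) N (W N) T Y (X N)" using particle_processI[OF system[OF assms(1)] assms(1)] .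
  then interpret particle_process "P N" N "W N" T Y "X N" .
  show ?thesis by (rule cadlag_empirical[OF assms(2)])
qed

lemma QN_integrable:
  assumes "2 \<le> N" "\<omega> \<in> space (P N)" "bounded_test B g"
  shows "set_integrable lborel {0..t} (\<lambda>s. QN N (W N) (emp N s \<omega>) g)"
proof -
  obtain T Y where "particle_process (P N) N (W N) T Y (X N)" using particle_processI[OF system[OF assms(1)] assms(1)] .
  then interpret particle_process "P N" N "W N" T Y "X N" .
  show ?thesis by (rule QN_path_integrable[OF assms(2,3)])
qed

lemma whp_imp:
  assumes "whp P E" and "\<And>N \<omega>. 2 \<le> N \<Longrightarrow> \<omega> \<in> space (P N) \<Longrightarrow> E N \<omega> \<Longrightarrow> F N \<omega>"
  shows "whp P F"
  by (rule whp_mono[OF assms(1)], rule eventually_sequentiallyI[of 2]) (use assms(2) in blast)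

text \<open>Closeness at finitely many parameters is a weak neighbourhood of the initial law.\<close>

lemma initial_close:
  assumes d: "0 < \<delta>"
  shows "whp P (\<lambda>N \<omega>. laplace_close L \<delta> (emp N 0 \<omega>) \<mu>0)"
proof -
  define \<sigma> where "\<sigma> = \<delta> / (4 * (m + 1))"
  have s: "0 < \<sigma>" using d m_nonneg by (simp add: \<sigma>_def)
  have sm: "\<delta> / 2 + 2 * m * \<sigma> \<le> \<delta>"
  proof -
    have "4 * (m + 1) * \<sigma> = \<delta>" using m_nonneg by (simp add: \<sigma>_def)
    with s show ?thesis by (simp add: algebra_simps)
  qed
  define J where "J = nat \<lceil>L / \<sigma>\<rceil>"
  have J: "L \<le> real J * \<sigma>"
  proof -
    have "L / \<sigma> \<le> real J" unfolding J_def by linarith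
    then show ?thesis using s by (simp add: pos_divide_le_eq)
  qed
  define V where "V j = {\<mu> \<in> M1. (\<integral>x. exp (- (real j * \<sigma>) * x) \<partial>\<mu>) \<in> ball (laplace \<mu>0 (real j * \<sigma>)) (\<delta> / 2)}" for j :: nat
  define U where "U = (\<Inter>j\<in>{..J}. V j)"
  have "openin weak_topology (V j)" for j
    unfolding weak_topology_def
    by (rule topology_generated_by_Basis, rule CollectI, rule exI[of _ "\<lambda>x. exp (- (real j * \<sigma>) * x)"],
        rule exI[of _ "ball (laplace \<mu>0 (real j * \<sigma>)) (\<delta> / 2)"])
      (use s exp_Cb[of "real j * \<sigma>"] in \<open>simp add: V_def\<close>)
  then have "openin weak_topology U" unfolding U_def by (intro openin_INT2) auto
  moreover have "\<mu>0 \<in> U" using \<mu>0 d by (auto simp: U_def V_def laplace_def)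
  ultimately have "whp P (\<lambda>N \<omega>. emp N 0 \<omega> \<in> U)"
    using initial unfolding tendsto_in_prob_iff_whp by blast
  then show ?thesis
  proof (rule whp_imp)
    fix N \<omega> assume N: "2 \<le> N" and w: "\<omega> \<in> space (P N)" and U: "emp N 0 \<omega> \<in> U"
    have "laplace_close (real J * \<sigma>) (\<delta> / 2 + 2 * m * \<sigma>) (emp N 0 \<omega>) \<mu>0"
    proof (rule laplace_close_grid[OF emp_M1[OF N w] emp_mean_le[OF N w] \<mu>0 mean s])
      fix j assume "j \<le> J"
      with U have "emp N 0 \<omega> \<in> V j" by (auto simp: U_def)
      then show "\<bar>laplace (emp N 0 \<omega>) (real j * \<sigma>) - laplace \<mu>0 (real j * \<sigma>)\<bar> \<le> \<delta> / 2"
        by (auto simp: V_def laplace_def dist_real_def abs_minus_commute)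
    qed auto
    then show "laplace_close L \<delta> (emp N 0 \<omega>) \<mu>0" by (rule laplace_close_mono[OF _ J sm])
  qed
qed

lemma initial_mean_square:
  assumes e: "0 < e"
  shows "\<forall>\<^sub>F N in sequentially. \<forall>l. 0 \<le> l \<longrightarrow> l \<le> L \<longrightarrow>
    (\<integral>\<omega>. (laplace (emp N 0 \<omega>) l - laplace \<mu>0 l)\<^sup>2 \<partial>P N) \<le> e"
proof -
  have "\<forall>\<^sub>F N in sequentially. \<exists>B\<in>sets (P N). emeasure (P N) B \<le> ennreal (e / 2) \<and>
      {\<omega> \<in> space (P N). \<not> laplace_close L (e / 2) (emp N 0 \<omega>) \<mu>0} \<subseteq> B"
    using initial_close[of "e / 2" L] e by (simp add: whp_def)
  then show ?thesis using eventually_ge_at_top[of 2]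
  proof eventually_elim
    case (elim N)
    obtain T Y where "particle_process (P N) N (W N) T Y (X N)" using particle_processI[OF system[OF elim(2)] elim(2)] .
    then interpret particle_process "P N" N "W N" T Y "X N" .
    obtain B where B: "B \<in> events" "emeasure (P N) B \<le> ennreal (e / 2)"
      "{\<omega> \<in> space (P N). \<not> laplace_close L (e / 2) (emp N 0 \<omega>) \<mu>0} \<subseteq> B"
      using elim(1) by blast
    have pB: "prob B \<le> e / 2" using B(2) e by (simp add: emeasure_eq_measure)
    show ?case
    proof (intro allI impI)
      fix l assume l: "0 \<le> l" "l \<le> L"
      have "expectation (\<lambda>\<omega>. (laplace (emp N 0 \<omega>) l - laplace \<mu>0 l)\<^sup>2) \<le> expectation (\<lambda>\<omega>. e / 2 + indicator B \<omega>)"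
      proof (rule integral_mono')
        show "integrable (P N) (\<lambda>\<omega>. e / 2 + indicator B \<omega>)" using B by (simp add: emeasure_eq_measure)
        fix \<omega> assume w: "\<omega> \<in> space (P N)"
        have b1: "\<bar>laplace (emp N 0 \<omega>) l - laplace \<mu>0 l\<bar> \<le> 1"
          using laplace_bounds[OF emp_M1[OF elim(2) w] l(1), of 0] laplace_bounds[OF \<mu>0 l(1)] by auto
        have sq: "(laplace (emp N 0 \<omega>) l - laplace \<mu>0 l)\<^sup>2 \<le> \<bar>laplace (emp N 0 \<omega>) l - laplace \<mu>0 l\<bar>"
          using mult_left_mono[OF b1, of "\<bar>laplace (emp N 0 \<omega>) l - laplace \<mu>0 l\<bar>"]
          by (simp add: power2_eq_square abs_mult[symmetric])
        show "(laplace (emp N 0 \<omega>) l - laplace \<mu>0 l)\<^sup>2 \<le> e / 2 + indicator B \<omega>"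
        proof (cases "\<omega> \<in> B")
          case True
          then show ?thesis using sq b1 e by simp
        next
          case False
          then have "laplace_close L (e / 2) (emp N 0 \<omega>) \<mu>0" using B(3) w by blast
          then have "\<bar>laplace (emp N 0 \<omega>) l - laplace \<mu>0 l\<bar> \<le> e / 2"
            using l by (simp add: laplace_close_def)
          then show ?thesis using sq False by simp
        qed
      qed (use e in auto)
      also have "\<dots> = e / 2 + prob B" using B by (simp add: prob_space emeasure_eq_measure)
      also have "\<dots> \<le> e" using pB by simp
      finally show "expectation (\<lambda>\<omega>. (laplace (emp N 0 \<omega>) l - laplace \<mu>0 l)\<^sup>2) \<le> e" .
    qed
  qed
qed

text \<open>Fix the grid first, in terms of the required accuracy. Then the bound on the bad event is linear in
  the initial error and in \<open>h\<close>, both of which tend to 0.\<close>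

lemma close_to_flow:
  assumes d: "0 < \<delta>" and t: "0 \<le> t"
  shows "whp P (\<lambda>N \<omega>. \<forall>s\<in>{0..t}. laplace_close D \<delta> (emp N s \<omega>) (flow \<mu>0 s))"
  unfolding whp_def
proof (intro allI impI)
  fix \<epsilon> :: real assume eps: "0 < \<epsilon>"
  define \<sigma> where "\<sigma> = \<delta> / (17 + 2 * m)"
  have s: "0 < \<sigma>" "(17 + 2 * m) * \<sigma> = \<delta>" using d m_nonneg by (auto simp: \<sigma>_def)
  define J where "J = nat \<lceil>D / \<sigma>\<rceil>"
  \<comment> \<open>The control given by \<open>good_event\<close> ends three grid steps early.\<close>
  define K where "K = nat \<lceil>t / \<sigma>\<rceil> + 3"
  have "D / \<sigma> \<le> real J" "t / \<sigma> \<le> real K - 3" unfolding J_def K_def by linarith+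
  then have J: "D \<le> real J * \<sigma>" and K: "t \<le> (real K - 3) * \<sigma>" using s by (simp_all add: pos_divide_le_eq)
  define c1 where "c1 = real (Suc K) * (real (Suc J) * exp (8 * (real K * \<sigma>)) / \<sigma>\<^sup>2)"
  define c2 where "c2 = real (Suc K) * (real (Suc J) * (exp (8 * (real K * \<sigma>)) * (140 * (real K * \<sigma>)) / \<sigma>\<^sup>2) + real K * \<sigma> / \<sigma>\<^sup>2)"
  have c: "0 \<le> c1" "0 \<le> c2" using s by (auto simp: c1_def c2_def)
  define e0 where "e0 = \<epsilon> / (2 * (c1 + 1))"
  have e0: "0 < e0" "c1 * e0 \<le> \<epsilon> / 2" using eps c by (auto simp: e0_def field_simps)
  define h0 where "h0 = min \<sigma> (\<epsilon> / (2 * (c2 + 1)))"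
  have h0: "0 < h0" "h0 \<le> \<sigma>" using eps c s by (auto simp: h0_def)
  have c2h: "c2 * x \<le> \<epsilon> / 2" if "0 \<le> x" "x \<le> h0" for x
  proof -
    have "c2 * x \<le> c2 * (\<epsilon> / (2 * (c2 + 1)))" using that c by (intro mult_left_mono) (auto simp: h0_def)
    also have "\<dots> \<le> \<epsilon> / 2" using eps c by (simp add: field_simps)
    finally show ?thesis .
  qed
  have "(\<lambda>N. 1 / real (N - 1)) \<longlonglongrightarrow> 0"
    by (rule filterlim_sequentially_Suc[THEN iffD1]) (simp add: lim_1_over_n)
  then have "\<forall>\<^sub>F N in sequentially. 1 / real (N - 1) < h0" using h0(1) by (rule order_tendstoD)
  with initial_mean_square[OF e0(1), of "real J * \<sigma>"] eventually_ge_at_top[of 2]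
  show "\<forall>\<^sub>F N in sequentially. \<exists>B\<in>sets (P N). emeasure (P N) B \<le> ennreal \<epsilon> \<and>
     {\<omega> \<in> space (P N). \<not> (\<forall>s\<in>{0..t}. laplace_close D \<delta> (emp N s \<omega>) (flow \<mu>0 s))} \<subseteq> B"
  proof eventually_elim
    case (elim N)
    obtain T Y where "particle_process (P N) N (W N) T Y (X N)" using particle_processI[OF system[OF elim(2)] elim(2)] .
    then interpret particle_process "P N" N "W N" T Y "X N" .
    have hs: "h \<le> h0" using elim(3) by (simp add: h_def)
    have init: "expectation (\<lambda>\<omega>. (err \<mu>0 0 l \<omega>)\<^sup>2) \<le> e0" if l: "0 \<le> l" "l \<le> real J * \<sigma>" for l
    proof -
      have "expectation (\<lambda>\<omega>. (err \<mu>0 0 l \<omega>)\<^sup>2) = expectation (\<lambda>\<omega>. (laplace (emp N 0 \<omega>) l - laplace \<mu>0 l)\<^sup>2)"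
      proof (rule Bochner_Integration.integral_cong[OF refl])
        fix \<omega> assume w: "\<omega> \<in> space (P N)"
        have "X N 0 \<omega> = Y 0 \<omega>" using X_eq[OF w, of 0 0] T_0[OF w] T_less[OF w, of 0] by simp
        then show "(err \<mu>0 0 l \<omega>)\<^sup>2 = (laplace (emp N 0 \<omega>) l - laplace \<mu>0 l)\<^sup>2"
          by (simp add: err_def laplace_flow_0[OF \<mu>0 l(1)])
      qed
      with elim(1) l show ?thesis by simp
    qed
    obtain B where B: "B \<in> events"
      "prob B \<le> real (Suc K) * (real (Suc J) * (exp (8 * (real K * \<sigma>)) * (e0 + 140 * (real K * \<sigma>) * h) / \<sigma>\<^sup>2) + real K * \<sigma> * h / \<sigma>\<^sup>2)"
      "\<And>\<omega> n u. \<omega> \<in> space (P N) - B \<Longrightarrow> T n \<omega> \<le> u \<Longrightarrow> u < T (Suc n) \<omega> \<Longrightarrow> 0 \<le> u \<Longrightarrow> u \<le> (real K - 3) * \<sigma> \<Longrightarrow>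
       laplace_close (real J * \<sigma>) ((17 + 2 * m) * \<sigma>) (empirical N (Y n \<omega>)) (flow \<mu>0 u)"
      by (rule good_event[OF \<mu>0 mean wealth[OF elim(2)] s(1) order_trans[OF hs h0(2)] less_imp_le[OF e0(1)] init, of J K]) auto
    have "prob B \<le> c1 * e0 + c2 * h"
    proof -
      have "a * (b * (E * (e0 + k * h) / S) + d * h / S) = a * (b * E / S) * e0 + a * (b * (E * k / S) + d / S) * h"
        for a b E k S d :: real
        by (simp add: add_divide_distrib distrib_left distrib_right mult.assoc mult.left_commute)
      then show ?thesis using B(2) unfolding c1_def c2_def by simp
    qed
    then have pB: "prob B \<le> \<epsilon>" using e0(2) c2h[of h] hs h(1) by linarith
    have "laplace_close D \<delta> (emp N u \<omega>) (flow \<mu>0 u)" if w: "\<omega> \<in> space (P N)" "\<omega> \<notin> B" and u: "u \<in> {0..t}" for \<omega> u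
    proof -
      obtain n where n: "T n \<omega> \<le> u" "u < T (Suc n) \<omega>" using current_jump[OF w(1), of u] u by auto
      have "laplace_close (real J * \<sigma>) ((17 + 2 * m) * \<sigma>) (empirical N (Y n \<omega>)) (flow \<mu>0 u)"
        using B(3)[of \<omega> n u] w u n K by auto
      then show ?thesis unfolding X_eq[OF w(1) n] s(2) by (rule laplace_close_mono[OF _ J]) simp
    qed
    then have "{\<omega> \<in> space (P N). \<not> (\<forall>s\<in>{0..t}. laplace_close D \<delta> (emp N s \<omega>) (flow \<mu>0 s))} \<subseteq> B" by blast
    with B(1) pB show ?case by (intro bexI[of _ B]) (simp_all add: emeasure_eq_measure ennreal_leI)
  qed
qed

lemma prokhorov_close:
  assumes e: "0 < e" and t: "0 \<le> t"
  shows "whp P (\<lambda>N \<omega>. \<forall>s\<in>{0..t}. prokhorov (flow \<mu>0 s) (emp N s \<omega>) \<le> e)"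
proof -
  obtain D \<delta> where D: "0 < \<delta>" "0 \<le> D"
    "\<And>\<mu> \<nu>. \<mu> \<in> M1 \<Longrightarrow> \<nu> \<in> M1 \<Longrightarrow> mean_le m \<mu> \<Longrightarrow> mean_le m \<nu> \<Longrightarrow> laplace_close D \<delta> \<mu> \<nu> \<Longrightarrow> prokhorov \<mu> \<nu> \<le> e"
    by (rule laplace_close_prokhorov[OF m_nonneg e]) auto
  show ?thesis
  proof (rule whp_imp[OF close_to_flow[OF D(1) t, of D]], rule ballI)
    fix N \<omega> s assume N: "2 \<le> N" and w: "\<omega> \<in> space (P N)" and s: "s \<in> {0..t}"
      and c: "\<forall>s\<in>{0..t}. laplace_close D \<delta> (emp N s \<omega>) (flow \<mu>0 s)"
    have "laplace_close D \<delta> (flow \<mu>0 s) (emp N s \<omega>)"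
      using c s by (auto simp: laplace_close_def abs_minus_commute)
    then show "prokhorov (flow \<mu>0 s) (emp N s \<omega>) \<le> e"
      using s by (intro D(3) flow_M1 \<mu>0 emp_M1 N w mean_le_flow mean emp_mean_le) auto
  qed
qed

text \<open>The drift is an affine combination of integrals against \<open>\<mu>\<close> and \<open>collide \<mu> \<mu>\<close>, so both statements are
  instances of the same approximation.\<close>

lemma test_and_drift_close:
  assumes g: "g \<in> Cb" and e: "0 < e" and t: "0 \<le> t"
  shows "whp P (\<lambda>N \<omega>. \<forall>s\<in>{0..t}. \<bar>(\<integral>x. g x \<partial>emp N s \<omega>) - (\<integral>x. g x \<partial>flow \<mu>0 s)\<bar> \<le> e
    \<and> \<bar>QN N (W N) (emp N s \<omega>) g - Q \<infinity> (flow \<mu>0 s) g\<bar> \<le> e)"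
proof -
  obtain B where B: "bounded_test B g" using bounded_test_Cb[OF g] by blast
  have e5: "0 < e / 5" using e by simp
  obtain D \<delta> where D: "0 < \<delta>" "0 \<le> D"
    "\<And>\<mu> \<nu>. \<mu> \<in> M1 \<Longrightarrow> \<nu> \<in> M1 \<Longrightarrow> mean_le m \<mu> \<Longrightarrow> mean_le m \<nu> \<Longrightarrow> laplace_close D \<delta> \<mu> \<nu> \<Longrightarrow>
       \<bar>(\<integral>x. g x \<partial>\<mu>) - (\<integral>x. g x \<partial>\<nu>)\<bar> \<le> e / 5"
    by (rule laplace_close_integral[OF g m_nonneg e5]) auto
  have "(\<lambda>N. 4 * B / real N) \<longlonglongrightarrow> 0" by (intro tendsto_divide_0[OF tendsto_const] filterlim_at_top_imp_at_infinity filterlim_real_sequentially)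
  then have "\<forall>\<^sub>F N in sequentially. 4 * B / real N < e / 5" using e5 by (rule order_tendstoD)
  then have ev: "\<forall>\<^sub>F N in sequentially. 2 \<le> N \<and> 4 * B / real N < e / 5"
    using eventually_ge_at_top[of 2] by eventually_elim simp
  show ?thesis
  proof (rule whp_mono[OF close_to_flow[of "\<delta> / 2" t D]])
    show "\<forall>\<^sub>F N in sequentially. \<forall>\<omega>\<in>space (P N). (\<forall>s\<in>{0..t}. laplace_close D (\<delta> / 2) (emp N s \<omega>) (flow \<mu>0 s))
      \<longrightarrow> (\<forall>s\<in>{0..t}. \<bar>(\<integral>x. g x \<partial>emp N s \<omega>) - (\<integral>x. g x \<partial>flow \<mu>0 s)\<bar> \<le> e
    \<and> \<bar>QN N (W N) (emp N s \<omega>) g - Q \<infinity> (flow \<mu>0 s) g\<bar> \<le> e)"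
      using ev
    proof eventually_elim
      case (elim N)
      then have N: "2 \<le> N" and BN: "4 * B / real N < e / 5" by auto
      show ?case
      proof (intro ballI impI)
        fix \<omega> s assume w: "\<omega> \<in> space (P N)" and c: "\<forall>s\<in>{0..t}. laplace_close D (\<delta> / 2) (emp N s \<omega>) (flow \<mu>0 s)" and s: "s \<in> {0..t}"
        then have s0: "0 \<le> s" by simp
        note E = emp_M1[OF N w s0] and F = flow_M1[OF \<mu>0]
        have cs: "laplace_close D (\<delta> / 2) (emp N s \<omega>) (flow \<mu>0 s)" using c s by blast
        have 1: "\<bar>(\<integral>x. g x \<partial>emp N s \<omega>) - (\<integral>x. g x \<partial>flow \<mu>0 s)\<bar> \<le> e / 5"
          by (intro D(3) E F mean_le_flow \<mu>0 mean emp_mean_le N w s0 laplace_close_mono[OF cs]) (use D in auto)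
        have "laplace_close D (2 * (\<delta> / 2)) (collide (emp N s \<omega>) (emp N s \<omega>)) (collide (flow \<mu>0 s) (flow \<mu>0 s))"
          by (rule laplace_close_collide[OF E F cs])
        then have 2: "\<bar>(\<integral>x. g x \<partial>collide (emp N s \<omega>) (emp N s \<omega>)) - (\<integral>x. g x \<partial>collide (flow \<mu>0 s) (flow \<mu>0 s))\<bar> \<le> e / 5"
          by (intro D(3) collide_M1 mean_le_collide E F mean_le_flow \<mu>0 mean emp_mean_le N w s0) simp
        have 3: "\<bar>QN N (W N) (emp N s \<omega>) g - Q \<infinity> (emp N s \<omega>) g\<bar> \<le> 4 * B / real N"
          by (rule QN_close_Q[OF state_space[OF N w s0] B]) (use N in simp)
        have "\<bar>QN N (W N) (emp N s \<omega>) g - Q \<infinity> (flow \<mu>0 s) g\<bar> \<le> e"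
          using 1 2 3 BN unfolding Q_infinity[OF E B] Q_infinity[OF F B] abs_le_iff by linarith
        with 1 e show "\<bar>(\<integral>x. g x \<partial>emp N s \<omega>) - (\<integral>x. g x \<partial>flow \<mu>0 s)\<bar> \<le> e
          \<and> \<bar>QN N (W N) (emp N s \<omega>) g - Q \<infinity> (flow \<mu>0 s) g\<bar> \<le> e" by linarith
      qed
    qed
  qed (use D t in auto)
qed

text \<open>The kinetic equation says that \<open>Mg\<close> would vanish if the limit and \<open>Q\<close> replaced the empirical measure
  and \<open>QN\<close>; each of its three terms is uniformly close to the corresponding term of the limit.\<close>

lemma uniform_convergence:
  assumes g: "g \<in> Cb" and d: "0 < \<delta>" and t: "0 \<le> t"
  shows "whp P (\<lambda>N \<omega>. \<forall>s\<in>{0..t}. \<bar>(\<integral>x. g x \<partial>emp N s \<omega>) - (\<integral>x. g x \<partial>flow \<mu>0 s)\<bar> \<le> \<delta>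
    \<and> \<bar>(LBINT u:{0..s}. QN N (W N) (emp N u \<omega>) g) - (LBINT u:{0..s}. Q \<infinity> (flow \<mu>0 u) g)\<bar> \<le> \<delta>
    \<and> \<bar>Mg N (W N) g (\<lambda>s. emp N s \<omega>) s\<bar> \<le> \<delta>)"
proof -
  obtain B where B: "bounded_test B g" using bounded_test_Cb[OF g] by blast
  define e where "e = \<delta> / (t + 2)"
  have e: "0 < e" "(t + 2) * e = \<delta>" using d t by (auto simp: e_def)
  show ?thesis
  proof (rule whp_imp[OF test_and_drift_close[OF g e(1) t]], rule ballI)
    fix N \<omega> s assume N: "2 \<le> N" and w: "\<omega> \<in> space (P N)" and s: "s \<in> {0..t}"
      and c: "\<forall>s\<in>{0..t}. \<bar>(\<integral>x. g x \<partial>emp N s \<omega>) - (\<integral>x. g x \<partial>flow \<mu>0 s)\<bar> \<le> e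
          \<and> \<bar>QN N (W N) (emp N s \<omega>) g - Q \<infinity> (flow \<mu>0 s) g\<bar> \<le> e"
    have c1: "\<bar>(\<integral>x. g x \<partial>emp N u \<omega>) - (\<integral>x. g x \<partial>flow \<mu>0 u)\<bar> \<le> e" if "u \<in> {0..t}" for u using c that by blast
    have c2: "\<bar>QN N (W N) (emp N u \<omega>) g - Q \<infinity> (flow \<mu>0 u) g\<bar> \<le> e" if "u \<in> {0..t}" for u using c that by blast
    have iN: "set_integrable lborel {0..s} (\<lambda>u. QN N (W N) (emp N u \<omega>) g)" by (rule QN_integrable[OF N w B])
    have kin: "set_integrable lborel {0..s} (\<lambda>u. Q \<infinity> (flow \<mu>0 u) g)"
      "(\<integral>x. g x \<partial>flow \<mu>0 s) = (\<integral>x. g x \<partial>\<mu>0) + (LBINT u:{0..s}. Q \<infinity> (flow \<mu>0 u) g)"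
      using kinetic_solution_flow[OF \<mu>0] g s unfolding kinetic_solution_def by auto
    have "\<bar>LBINT u:{0..s}. QN N (W N) (emp N u \<omega>) g - Q \<infinity> (flow \<mu>0 u) g\<bar>
       \<le> (LBINT u:{0..s}. \<bar>QN N (W N) (emp N u \<omega>) g - Q \<infinity> (flow \<mu>0 u) g\<bar>)"
      using set_integral_norm_bound[OF set_integral_diff(1)[OF iN kin(1)]] by simp
    also have "\<dots> \<le> (LBINT u:{0..s}. e)"
    proof (rule set_integral_mono)
      show "set_integrable lborel {0..s} (\<lambda>u. \<bar>QN N (W N) (emp N u \<omega>) g - Q \<infinity> (flow \<mu>0 u) g\<bar>)"
        by (rule set_integrable_abs[OF set_integral_diff(1)[OF iN kin(1)]])
      show "set_integrable lborel {0..s} (\<lambda>u. e)"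
        by (rule borel_integrable_atLeastAtMost') simp
      show "\<bar>QN N (W N) (emp N u \<omega>) g - Q \<infinity> (flow \<mu>0 u) g\<bar> \<le> e" if "u \<in> {0..s}" for u
        using that s by (intro c2) auto
    qed
    also have "\<dots> = s * e" using s by (simp add: set_lebesgue_integral_def)
    also have "\<dots> \<le> t * e" using s e by (intro mult_right_mono) auto
    finally have I: "\<bar>(LBINT u:{0..s}. QN N (W N) (emp N u \<omega>) g) - (LBINT u:{0..s}. Q \<infinity> (flow \<mu>0 u) g)\<bar> \<le> t * e"
      unfolding set_integral_diff(2)[OF iN kin(1)] .
    have te: "t * e + 2 * e = \<delta>" using e(2) by (simp add: algebra_simps)
    have te0: "0 \<le> t * e" using t e by simp
    have "\<bar>(\<integral>x. g x \<partial>emp N 0 \<omega>) - (\<integral>x. g x \<partial>\<mu>0)\<bar> \<le> e"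
      using c1[of 0] t integral_flow_0[OF \<mu>0 B] by simp
    then have "\<bar>Mg N (W N) g (\<lambda>s. emp N s \<omega>) s\<bar> \<le> \<delta>"
      using c1[OF s] I kin(2) te unfolding Mg_def abs_le_iff by linarith
    moreover have "\<bar>(\<integral>x. g x \<partial>emp N s \<omega>) - (\<integral>x. g x \<partial>flow \<mu>0 s)\<bar> \<le> \<delta>"
      using c1[OF s] te te0 e(1) by linarith
    moreover have "\<bar>(LBINT u:{0..s}. QN N (W N) (emp N u \<omega>) g) - (LBINT u:{0..s}. Q \<infinity> (flow \<mu>0 u) g)\<bar> \<le> \<delta>"
      using I te e(1) by linarith
    ultimately show "\<bar>(\<integral>x. g x \<partial>emp N s \<omega>) - (\<integral>x. g x \<partial>flow \<mu>0 s)\<bar> \<le> \<delta>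
      \<and> \<bar>(LBINT u:{0..s}. QN N (W N) (emp N u \<omega>) g) - (LBINT u:{0..s}. Q \<infinity> (flow \<mu>0 u) g)\<bar> \<le> \<delta>
      \<and> \<bar>Mg N (W N) g (\<lambda>s. emp N s \<omega>) s\<bar> \<le> \<delta>" by blast
  qed
qed

lemma convergence_skorokhod:
  "tendsto_in_prob P skorokhod_topology (\<lambda>N \<omega> t. emp N t \<omega>) (flow \<mu>0)"
  unfolding tendsto_in_prob_iff_whp
proof (intro conjI allI impI)
  show "flow \<mu>0 \<in> topspace skorokhod_topology" by (simp add: topspace_skorokhod cadlag_flow[OF \<mu>0])
  fix U assume "openin skorokhod_topology U \<and> flow \<mu>0 \<in> U"
  then obtain e where e: "0 < e" "\<And>y. y \<in> cadlag_paths \<Longrightarrow> skorokhod_dist (flow \<mu>0) y < ennreal e \<Longrightarrow> y \<in> U"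
    unfolding openin_skorokhod_topology skorokhod_open_def by blast
  define c where "c = max 0 (- ln (e / 4))"
  have c: "0 \<le> c" "exp (- c) \<le> e / 4"
  proof -
    have "exp (- c) \<le> exp (ln (e / 4))" by (simp add: c_def)
    then show "exp (- c) \<le> e / 4" using e by simp
  qed (simp add: c_def)
  have e4: "0 < e / 4" using e by simp
  show "whp P (\<lambda>N \<omega>. (\<lambda>t. emp N t \<omega>) \<in> U)"
  proof (rule whp_imp[OF prokhorov_close[OF e4 c(1)]])
    fix N \<omega> assume N: "2 \<le> N" and w: "\<omega> \<in> space (P N)"
      and s: "\<forall>s\<in>{0..c}. prokhorov (flow \<mu>0 s) (emp N s \<omega>) \<le> e / 4"
    have "skorokhod_dist (flow \<mu>0) (\<lambda>t. emp N t \<omega>) \<le> ennreal (e / 4 + exp (- c))"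
      by (rule skorokhod_dist_le_uniform) (use s c e in \<open>auto intro!: prokhorov_le_1 flow_M1 \<mu>0 emp_M1 N w\<close>)
    also have "\<dots> < ennreal e" using c e by (intro ennreal_lessI) auto
    finally show "(\<lambda>t. emp N t \<omega>) \<in> U" by (intro e(2) emp_cadlag N w)
  qed
qed

text \<open>A measure with small mean has a Laplace transform close to 1, so the transform of the initial law
  equals 1 at the parameter 1, which forces the law to be concentrated at 0.\<close>

lemma vanishing_wealth_density:
  assumes lim: "(\<lambda>N. W N / real N) \<longlonglongrightarrow> 0"
  shows "(\<integral>x. x \<partial>\<mu>0) = 0"
proof -
  interpret M: prob_space \<mu>0 using M1_D[OF \<mu>0] by simp
  have le: "1 - laplace \<mu>0 1 \<le> 2 * e" if e: "0 < e" for e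
  proof -
    have "\<forall>\<^sub>F N in sequentially. \<exists>B\<in>sets (P N). emeasure (P N) B \<le> ennreal (1 / 2) \<and>
      {\<omega> \<in> space (P N). \<not> laplace_close 1 e (emp N 0 \<omega>) \<mu>0} \<subseteq> B"
      by (rule initial_close[OF e, unfolded whp_def, rule_format]) simp
    moreover have "\<forall>\<^sub>F N in sequentially. W N / real N < e" using lim e by (rule order_tendstoD)
    ultimately have "\<forall>\<^sub>F N in sequentially. 2 \<le> N \<and> W N / real N < e \<and> (\<exists>B\<in>sets (P N). emeasure (P N) B \<le> ennreal (1 / 2) \<and>
      {\<omega> \<in> space (P N). \<not> laplace_close 1 e (emp N 0 \<omega>) \<mu>0} \<subseteq> B)"
      using eventually_ge_at_top[of 2] by eventually_elim simp
    then obtain N B where N: "2 \<le> N" "W N / real N < e" and B: "B \<in> sets (P N)" "emeasure (P N) B \<le> ennreal (1 / 2)"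
      "{\<omega> \<in> space (P N). \<not> laplace_close 1 e (emp N 0 \<omega>) \<mu>0} \<subseteq> B"
      unfolding eventually_sequentially by blast
    obtain T Y where "particle_process (P N) N (W N) T Y (X N)" using particle_processI[OF system[OF N(1)] N(1)] .
    then interpret particle_process "P N" N "W N" T Y "X N" .
    \<comment> \<open>The bad event has probability at most 1/2, so some outcome avoids it.\<close>
    have "\<not> space (P N) \<subseteq> B"
    proof
      assume "space (P N) \<subseteq> B"
      then have "prob (space (P N)) \<le> prob B" using B(1) by (rule finite_measure_mono)
      moreover have "ennreal (prob B) \<le> ennreal (1 / 2)" using B(2) unfolding emeasure_eq_measure .
      then have "prob B \<le> 1 / 2" by (subst (asm) ennreal_le_iff) simp_all
      ultimately show False unfolding prob_space by linarith
    qed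
    then obtain \<omega> where w: "\<omega> \<in> space (P N)" "\<omega> \<notin> B" by blast
    then have "laplace_close 1 e (emp N 0 \<omega>) \<mu>0" using B(3) by blast
    then have 1: "\<bar>laplace (emp N 0 \<omega>) 1 - laplace \<mu>0 1\<bar> \<le> e" by (simp add: laplace_close_def)
    note E = emp_M1[OF N(1) w(1), of 0, simplified]
    interpret E: prob_space "emp N 0 \<omega>" using M1_D[OF E] by simp
    have "mean_le (W N / real N) (emp N 0 \<omega>)"
      by (rule mean_le_empirical) (use N X_space[OF w(1), of 0] in \<open>auto simp: space_wealth\<close>)
    then have "\<bar>laplace (emp N 0 \<omega>) 0 - laplace (emp N 0 \<omega>) 1\<bar> \<le> W N / real N * \<bar>0 - 1\<bar>"
      by (intro laplace_Lipschitz[OF E]) simp_all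
    moreover have "laplace (emp N 0 \<omega>) 0 = 1" using E.prob_space by (simp add: laplace_def)
    ultimately have "1 - laplace (emp N 0 \<omega>) 1 \<le> W N / real N" by simp
    with 1 N(2) show ?thesis by linarith
  qed
  have "1 - laplace \<mu>0 1 \<le> 0"
  proof (rule ccontr)
    assume "\<not> 1 - laplace \<mu>0 1 \<le> 0"
    with le[of "(1 - laplace \<mu>0 1) / 4"] show False by simp
  qed
  moreover have "(\<integral>x. 1 - exp (- x) \<partial>\<mu>0) = 1 - laplace \<mu>0 1"
    using bounded_test_integrable(1)[OF \<mu>0 bounded_test_exp[of 1]] by (simp add: laplace_def M.prob_space)
  moreover have nn: "AE x in \<mu>0. 0 \<le> 1 - exp (- x)" by (rule AE_I2) (simp add: M1_D[OF \<mu>0])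
  ultimately have "(\<integral>x. 1 - exp (- x) \<partial>\<mu>0) = 0" using integral_nonneg_AE[OF nn] by linarith
  then have "AE x in \<mu>0. 1 - exp (- x) = 0"
    using bounded_test_integrable(1)[OF \<mu>0 bounded_test_exp[of 1]]
    by (subst (asm) integral_nonneg_eq_0_iff_AE[OF _ nn]) auto
  then have "AE x in \<mu>0. x = 0" by eventually_elim simp
  then have "(\<integral>x. x \<partial>\<mu>0) = (\<integral>x. 0 \<partial>\<mu>0)"
    by (intro integral_cong_AE) (auto simp: measurable_cong_sets[OF M1_D(2)[OF \<mu>0] refl])
  then show ?thesis by simp
qed

end

theorem theorem2p4:
  fixes P :: "nat \<Rightarrow> 'w measure"
    and W :: "nat \<Rightarrow> real" and w0 :: ereal
    and X :: "nat \<Rightarrow> real \<Rightarrow> 'w \<Rightarrow> nat \<Rightarrow> real"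
    and \<mu>N :: "nat \<Rightarrow> real \<Rightarrow> 'w \<Rightarrow> real measure"
    and \<mu>0 :: "real measure"
  assumes W_nonneg: "\<And>N. 2 \<le> N \<Longrightarrow> 0 \<le> W N"
    and W_mono: "\<And>N N'. 2 \<le> N \<Longrightarrow> N \<le> N' \<Longrightarrow> W N \<le> W N'"
    and W_lim: "(\<lambda>N. ereal (W N)) \<longlonglongrightarrow> w0" and w0_pos: "0 < w0"
    and X: "\<And>N. 2 \<le> N \<Longrightarrow> particle_system N (W N) (P N) (X N)"
    and \<mu>N: "\<And>N t \<omega>. \<mu>N N t \<omega> = empirical N (X N t \<omega>)"
    and \<mu>0: "\<mu>0 \<in> M1"
    and mean_finite: "integrable \<mu>0 (\<lambda>x. x)"
    and mean_le: "\<And>N \<omega>. 2 \<le> N \<Longrightarrow> \<omega> \<in> space (P N) \<Longrightarrow>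
                    (\<integral>x. x \<partial>\<mu>N N 0 \<omega>) \<le> (\<integral>x. x \<partial>\<mu>0)"
    and initial: "tendsto_in_prob P weak_topology (\<lambda>N \<omega>. \<mu>N N 0 \<omega>) \<mu>0"
  shows "\<exists>\<mu> :: real \<Rightarrow> real measure.
      (\<forall>N\<ge>2. \<forall>\<omega>\<in>space (P N). (\<lambda>t. \<mu>N N t \<omega>) \<in> cadlag_paths)
    \<and> tendsto_in_prob P skorokhod_topology (\<lambda>N \<omega> t. \<mu>N N t \<omega>) \<mu>
    \<and> continuous_map (top_of_set {0..}) weak_topology \<mu>
    \<and> kinetic_solution w0 \<mu>0 \<mu>
    \<and> (\<forall>g\<in>Cb. \<forall>t\<ge>0.
          tendsto_in_prob P euclideanreal
            (\<lambda>N \<omega>. SUP s\<in>{0..t}. (\<integral>x. g x \<partial>\<mu>N N s \<omega>) - (\<integral>x. g x \<partial>\<mu> s)) 0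
        \<and> tendsto_in_prob P euclideanreal
            (\<lambda>N \<omega>. SUP s\<in>{0..t}. \<bar>Mg N (W N) g (\<lambda>s. \<mu>N N s \<omega>) s\<bar>) 0
        \<and> tendsto_in_prob P euclideanreal
            (\<lambda>N \<omega>. LBINT s:{0..t}. QN N (W N) (\<mu>N N s \<omega>) g)
            (LBINT s:{0..t}. Q w0 (\<mu> s) g))
    \<and> (\<forall>g\<in>Cb. \<forall>t\<ge>0.
          tendsto_in_prob P euclideanreal (\<lambda>N \<omega>. Mg N (W N) g (\<lambda>s. \<mu>N N s \<omega>) t) 0
        \<and> tendsto_in_prob P euclideanreal (\<lambda>N \<omega>. \<integral>x. g x \<partial>\<mu>N N t \<omega>) (\<integral>x. g x \<partial>\<mu> t)
        \<and> tendsto_in_prob P euclideanreal (\<lambda>N \<omega>. \<integral>x. g x \<partial>\<mu>N N 0 \<omega>) (\<integral>x. g x \<partial>\<mu>0)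
        \<and> tendsto_in_prob P euclideanreal
            (\<lambda>N \<omega>. (\<integral>x. g x \<partial>\<mu>N N t \<omega>) - (\<integral>x. g x \<partial>\<mu>N N 0 \<omega>)
                     - (LBINT s:{0..t}. QN N (W N) (\<mu>N N s \<omega>) g))
            ((\<integral>x. g x \<partial>\<mu> t) - (\<integral>x. g x \<partial>\<mu>0) - (LBINT s:{0..t}. Q w0 (\<mu> s) g))
        \<and> (\<integral>x. g x \<partial>\<mu> t) = (\<integral>x. g x \<partial>\<mu>0) + (LBINT s:{0..t}. Q w0 (\<mu> s) g))"
proof -
  define m where "m = (\<integral>x. x \<partial>\<mu>0)"
  have m0: "0 \<le> m" unfolding m_def by (rule integral_nonneg_AE, rule AE_I2) (simp add: M1_D[OF \<mu>0])
  have "(\<integral>\<^sup>+x. ennreal x \<partial>\<mu>0) = ennreal m"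
    unfolding m_def by (rule nn_integral_eq_integral[OF mean_finite]) (rule AE_I2, simp add: M1_D[OF \<mu>0])
  then have mean: "mean_le m \<mu>0" using m0 by (simp add: mean_le_def)
  have wealth: "W N / real N \<le> m" if N: "2 \<le> N" for N
  proof -
    obtain T Y where "particle_process (P N) N (W N) T Y (X N)" using particle_processI[OF X[OF N] N] .
    then interpret particle_process "P N" N "W N" T Y "X N" .
    obtain \<omega> where w: "\<omega> \<in> space (P N)" using not_empty by blast
    have S: "X N 0 \<omega> \<in> space (wealth_space N (W N))" by (rule X_space[OF w]) simp
    have "(\<integral>x. x \<partial>empirical N (X N 0 \<omega>)) = (\<Sum>i<N. X N 0 \<omega> i) / real N"
      by (rule integral_empirical) (use S in \<open>auto simp: space_wealth\<close>)
    then show ?thesis using mean_le[OF N w] S by (simp add: space_wealth m_def \<mu>N)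
  qed
  interpret exchange_limit P W X \<mu>0 m
    by unfold_locales (use X \<mu>0 mean wealth initial in \<open>auto simp: \<mu>N\<close>)
  have w0: "w0 = \<infinity>"
  proof (rule ccontr)
    assume "w0 \<noteq> \<infinity>"
    with w0_pos obtain r where r: "w0 = ereal r" "0 < r" by (cases w0) auto
    have Wr: "W \<longlonglongrightarrow> r" using W_lim unfolding r(1) by simp
    have "(\<lambda>N. W N * inverse (real N)) \<longlonglongrightarrow> r * 0"
      by (intro tendsto_mult Wr lim_inverse_n)
    then have "(\<lambda>N. W N / real N) \<longlonglongrightarrow> 0" by (simp add: divide_inverse)
    then have "m = 0" unfolding m_def by (rule vanishing_wealth_density)
    then have "W N \<le> 0" if "2 \<le> N" for N
      using wealth[OF that] that by (simp add: divide_le_0_iff)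
    then have "\<forall>\<^sub>F N in sequentially. W N \<le> 0"
      by (intro eventually_sequentiallyI[of 2])
    then have "r \<le> 0" by (intro tendsto_upperbound[OF Wr]) simp_all
    with r(2) show False by simp
  qed
  have eq: "\<mu>N = (\<lambda>N t \<omega>. emp N t \<omega>)" by (intro ext) (simp add: \<mu>N)
  note kinetic = kinetic_solution_flow[OF \<mu>0]
  have A: "tendsto_in_prob P euclideanreal (\<lambda>N \<omega>. SUP s\<in>{0..t}. (\<integral>x. g x \<partial>emp N s \<omega>) - (\<integral>x. g x \<partial>flow \<mu>0 s)) 0"
    and B: "tendsto_in_prob P euclideanreal (\<lambda>N \<omega>. SUP s\<in>{0..t}. \<bar>Mg N (W N) g (\<lambda>s. emp N s \<omega>) s\<bar>) 0"
    and C: "tendsto_in_prob P euclideanreal (\<lambda>N \<omega>. LBINT s:{0..t}. QN N (W N) (emp N s \<omega>) g)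
            (LBINT s:{0..t}. Q \<infinity> (flow \<mu>0 s) g)"
    and M: "tendsto_in_prob P euclideanreal (\<lambda>N \<omega>. Mg N (W N) g (\<lambda>s. emp N s \<omega>) t) 0"
    and G: "tendsto_in_prob P euclideanreal (\<lambda>N \<omega>. \<integral>x. g x \<partial>emp N t \<omega>) (\<integral>x. g x \<partial>flow \<mu>0 t)"
    if g: "g \<in> Cb" and t: "0 \<le> t" for g t
  proof -
    have ne: "{0..t} \<noteq> {}" and tt: "t \<in> {0..t}" using t by auto
    note U = uniform_convergence[OF g _ t]
    show "tendsto_in_prob P euclideanreal (\<lambda>N \<omega>. SUP s\<in>{0..t}. (\<integral>x. g x \<partial>emp N s \<omega>) - (\<integral>x. g x \<partial>flow \<mu>0 s)) 0"
      by (rule tendsto_in_prob_realI, rule whp_mono[OF U], assumption)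
        (use ne in \<open>auto intro!: always_eventually cSup_abs_le\<close>)
    show "tendsto_in_prob P euclideanreal (\<lambda>N \<omega>. SUP s\<in>{0..t}. \<bar>Mg N (W N) g (\<lambda>s. emp N s \<omega>) s\<bar>) 0"
      by (rule tendsto_in_prob_realI, rule whp_mono[OF U], assumption)
        (use ne in \<open>auto intro!: always_eventually cSup_abs_le\<close>)
    show "tendsto_in_prob P euclideanreal (\<lambda>N \<omega>. LBINT s:{0..t}. QN N (W N) (emp N s \<omega>) g)
            (LBINT s:{0..t}. Q \<infinity> (flow \<mu>0 s) g)"
      by (rule tendsto_in_prob_realI, rule whp_mono[OF U], assumption)
        (use tt in \<open>blast intro!: always_eventually\<close>)
    show "tendsto_in_prob P euclideanreal (\<lambda>N \<omega>. Mg N (W N) g (\<lambda>s. emp N s \<omega>) t) 0"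
      by (rule tendsto_in_prob_realI, rule whp_mono[OF U], assumption)
        (use tt in \<open>auto intro!: always_eventually\<close>)
    show "tendsto_in_prob P euclideanreal (\<lambda>N \<omega>. \<integral>x. g x \<partial>emp N t \<omega>) (\<integral>x. g x \<partial>flow \<mu>0 t)"
      by (rule tendsto_in_prob_realI, rule whp_mono[OF U], assumption)
        (use tt in \<open>blast intro!: always_eventually\<close>)
  qed
  have G0: "tendsto_in_prob P euclideanreal (\<lambda>N \<omega>. \<integral>x. g x \<partial>emp N 0 \<omega>) (\<integral>x. g x \<partial>\<mu>0)" if g: "g \<in> Cb" for g
  proof -
    obtain B where "bounded_test B g" using bounded_test_Cb[OF g] by blast
    from integral_flow_0[OF \<mu>0 this] G[OF g, of 0] show ?thesis by simp
  qed
  have K: "(\<integral>x. g x \<partial>flow \<mu>0 t) = (\<integral>x. g x \<partial>\<mu>0) + (LBINT s:{0..t}. Q \<infinity> (flow \<mu>0 s) g)"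
    if "g \<in> Cb" "0 \<le> t" for g t
    using kinetic that unfolding kinetic_solution_def by blast
  have I: "tendsto_in_prob P euclideanreal
            (\<lambda>N \<omega>. (\<integral>x. g x \<partial>emp N t \<omega>) - (\<integral>x. g x \<partial>emp N 0 \<omega>) - (LBINT s:{0..t}. QN N (W N) (emp N s \<omega>) g))
            ((\<integral>x. g x \<partial>flow \<mu>0 t) - (\<integral>x. g x \<partial>\<mu>0) - (LBINT s:{0..t}. Q \<infinity> (flow \<mu>0 s) g))"
    if "g \<in> Cb" "0 \<le> t" for g t
    using M[OF that] K[OF that] by (simp add: Mg_def)
  show ?thesis
    unfolding eq w0
    by (rule exI[of _ "flow \<mu>0"])
      (intro conjI allI ballI impI emp_cadlag convergence_skorokhod continuous_map_flow[OF \<mu>0] kinetic A B C M G G0 I K)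
qed

end
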